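(* Let $A_1,\dots,A_n$ be configurations in $\mathbb Z^n$ with Cayley matrix $A=\mathrm{Cay}(A_1,\dots,A_n)$. The mixed discriminant equals the $A$-discriminant of the Cayley matrix: $$\Delta_{A_1,\dots,A_n}=\Delta_A .$$
   Context: Let $K$ be an algebraically closed field. A configuration is a finite subset of $\mathbb Z^n$. Given configurations $A_1,\dots,A_n\subset\mathbb Z^n$, consider Laurent polynomials $f_i(x)=\sum_{a\in A_i}c_{i,a}x^a$, $i=1,\dots,n$, in $x=(x_1,\dots,x_n)$. Both discriminants below are defined up to sign. Mixed discriminant. An isolated solution $u\in(K^* )^n$ of $f_1=\dots=f_n=0$ is a non-degenerate multiple root if the $n$ gradient vectors $\nabla_xf_i(u)$ are linearly dependent but any $n-1$ of them are linearly independent. The discriminantal variety is the closure of the locus of coefficients $(c_{i,a})$ for which the system has a non-degenerate multiple root. If it is a hypersurface, the mixed discriminant $\Delta_{A_1,\dots,A_n}$ is the unique (up to sign) irreducible polynomial with integer coefficients in the $c_{i,a}$ defining it; otherwise one sets $\Delta_{A_1,\dots,A_n}=1$. Cayley matrix and $A$-discriminant. $A=\mathrm{Cay}(A_1,\dots,A_n)$ is the matrix with $2n$ rows and $m=\sum_i|A_i|$ columns whose columns are the vectors $(e_i,a)\in\mathbb Z^n\times\mathbb Z^n$ for $a\in A_i$, $i=1,\dots,n$. With new variables $y_1,\dots,y_n$, the system is encoded by the polynomial $\phi(x,y)=y_1f_1(x)+\dots+y_nf_n(x)$ with support in $A$. Let $X_A\subset\mathbb P^{m-1}$ be the projective toric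 variety associated with $A$. If the dual variety $(X_A)^\vee$ is a hypersurface, $\Delta_A$ is its defining equation, i.e. the unique (up to sign) irreducible polynomial with integer coefficients in the $c_{i,a}$ which vanishes whenever the hypersurface $\{(x,y)\in(K^* )^{2n}:\phi(x,y)=0\}$ is not smooth; if $(X_A)^\vee$ is not a hypersurface, one sets $\Delta_A=1$.
   Formalization: The Cayley matrix A is assumed to have full row rank 2n over K; without this the claim fails, e.g. n=2, A_1={0,e_1}, A_2={0,e_1,2e_1}: the mixed discriminant is 1 but Δ_A is the resultant. Excluded cases where equality still holds have both discriminants equal to 1. *)

theory Defs
  imports
    "HOL-Analysis.Analysis"
    "HOL-Library.Poly_Mapping"
    "HOL-Library.Function_Algebras"
    "HOL-Computational_Algebra.Computational_Algebra"
begin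

section \<open>Polynomials in finitely many named variables, affine varieties\<close>

text \<open>
  A polynomial is a finitely supported map from monomials to coefficients, where a monomial is a
  finitely supported map from variables to exponents; the ring structure is the convolution ring
  of \<^theory>\<open>HOL-Library.Poly_Mapping\<close>.
\<close>

type_synonym ('v, 'a) mpoly = "('v \<Rightarrow>\<^sub>0 nat) \<Rightarrow>\<^sub>0 'a"

definition mvars :: "('v, 'a::zero) mpoly \<Rightarrow> 'v set" where
  "mvars g = (\<Union>m\<in>Poly_Mapping.keys g. Poly_Mapping.keys m)"

definition meval :: "('v, 'a::comm_semiring_1) mpoly \<Rightarrow> ('v \<Rightarrow> 'a) \<Rightarrow> 'a" where
  "meval g x = (\<Sum>m\<in>Poly_Mapping.keys g. Poly_Mapping.lookup g m *
      (\<Prod>v\<in>Poly_Mapping.keys m. x v ^ Poly_Mapping.lookup m v))"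

definition mpartial :: "'v \<Rightarrow> ('v, 'a::comm_semiring_1) mpoly \<Rightarrow> ('v, 'a) mpoly" where
  "mpartial v g = (\<Sum>m\<in>Poly_Mapping.keys g.
      Poly_Mapping.single (m - Poly_Mapping.single v 1)
        (of_nat (Poly_Mapping.lookup m v) * Poly_Mapping.lookup g m))"

text \<open>The space \<open>K\<^sup>S\<close>; coordinates outside the index set \<open>S\<close> are normalised to \<open>0\<close>.\<close>

definition coord_space :: "'v set \<Rightarrow> ('v \<Rightarrow> 'k::zero) set" where
  "coord_space S = {x. \<forall>v. v \<notin> S \<longrightarrow> x v = 0}"

definition zero_set :: "'v set \<Rightarrow> ('v, 'k::field) mpoly \<Rightarrow> ('v \<Rightarrow> 'k) set" where
  "zero_set S g = {x \<in> coord_space S. meval g x = 0}"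

definition vanishing_ideal :: "'v set \<Rightarrow> ('v \<Rightarrow> 'k::field) set \<Rightarrow> ('v, 'k) mpoly set" where
  "vanishing_ideal S X = {g. mvars g \<subseteq> S \<and> (\<forall>x\<in>X. meval g x = 0)}"

definition zariski_closure :: "'v set \<Rightarrow> ('v \<Rightarrow> 'k::field) set \<Rightarrow> ('v \<Rightarrow> 'k) set" where
  "zariski_closure S X = {x \<in> coord_space S. \<forall>g\<in>vanishing_ideal S X. meval g x = 0}"

definition hypersurface :: "'v set \<Rightarrow> ('v \<Rightarrow> 'k::field) set \<Rightarrow> bool" where
  "hypersurface S Z \<longleftrightarrow> (\<exists>g. mvars g \<subseteq> S \<and> mvars g \<noteq> {} \<and> Z = zero_set S g)"

text \<open>
  \<open>D\<close> is an irreducible integer polynomial that defines \<open>Z\<close> over \<open>K\<close>. Irreducibility is in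
  \<open>\<int>[c]\<close>, so that in characteristic \<open>0\<close> and for irreducible \<open>Z\<close> it pins \<open>D\<close> down up to sign.
\<close>

definition irreducible_equation :: "'v set \<Rightarrow> ('v \<Rightarrow> 'k::field) set \<Rightarrow> ('v, int) mpoly \<Rightarrow> bool" where
  "irreducible_equation S Z D \<longleftrightarrow>
     mvars D \<subseteq> S \<and> irreducible D \<and> Z = zero_set S (Poly_Mapping.map of_int D)"

definition is_discriminant_of :: "'v set \<Rightarrow> ('v \<Rightarrow> 'k::field) set \<Rightarrow> ('v, int) mpoly \<Rightarrow> bool" where
  "is_discriminant_of S Z D \<longleftrightarrow>
     (if hypersurface S Z then irreducible_equation S Z D else D = 1)"


section \<open>Laurent systems and the mixed discriminant\<close>

definition torus :: "('d \<Rightarrow> 'k::field) set" where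
  "torus = {x. \<forall>j. x j \<noteq> 0}"

definition laurent_monomial :: "('d::finite \<Rightarrow> 'k::field) \<Rightarrow> int ^ 'd \<Rightarrow> 'k" where
  "laurent_monomial x a = (\<Prod>j\<in>UNIV. x j powi (a $ j))"

text \<open>
  The configurations are a family \<open>A :: 'n \<Rightarrow> (int ^ 'n) set\<close>, where \<open>'n\<close> is an index type with
  \<open>n\<close> elements. The coefficient \<open>c\<^sub>i\<^sub>,\<^sub>a\<close> is \<open>c (i, a)\<close>, indexed by the pairs in \<open>cayley_index A\<close>.
\<close>

definition cayley_index :: "('n \<Rightarrow> (int ^ 'n) set) \<Rightarrow> ('n \<times> (int ^ 'n)) set" where
  "cayley_index A = (SIGMA i : UNIV. A i)"

definition laurent_poly ::
  "('n::finite \<Rightarrow> (int ^ 'n) set) \<Rightarrow> ('n \<times> (int ^ 'n) \<Rightarrow> 'k::field) \<Rightarrow> 'n \<Rightarrow> ('n \<Rightarrow> 'k) \<Rightarrow> 'k" where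
  "laurent_poly A c i x = (\<Sum>a\<in>A i. c (i, a) * laurent_monomial x a)"

definition laurent_gradient ::
  "('n::finite \<Rightarrow> (int ^ 'n) set) \<Rightarrow> ('n \<times> (int ^ 'n) \<Rightarrow> 'k::field) \<Rightarrow> 'n \<Rightarrow> ('n \<Rightarrow> 'k) \<Rightarrow> 'k ^ 'n" where
  "laurent_gradient A c i x =
     (\<chi> j. \<Sum>a\<in>A i. c (i, a) * (of_int (a $ j) * laurent_monomial x (a - axis j 1)))"

definition solutions ::
  "('n::finite \<Rightarrow> (int ^ 'n) set) \<Rightarrow> ('n \<times> (int ^ 'n) \<Rightarrow> 'k::field) \<Rightarrow> ('n \<Rightarrow> 'k) set" where
  "solutions A c = {x \<in> torus. \<forall>i. laurent_poly A c i x = 0}"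

text \<open>Isolated means isolated in the Zariski topology: \<open>u\<close> is not in the closure of the others.\<close>

definition isolated_solution ::
  "('n::finite \<Rightarrow> (int ^ 'n) set) \<Rightarrow> ('n \<times> (int ^ 'n) \<Rightarrow> 'k::field) \<Rightarrow> ('n \<Rightarrow> 'k) \<Rightarrow> bool" where
  "isolated_solution A c u \<longleftrightarrow>
     u \<in> solutions A c \<and> u \<notin> zariski_closure UNIV (solutions A c - {u})"

text \<open>Independence of a family: repeated vectors count as dependent.\<close>

definition independent_family :: "('i \<Rightarrow> 'k::field ^ 'n) \<Rightarrow> 'i set \<Rightarrow> bool" where
  "independent_family v I \<longleftrightarrow> inj_on v I \<and> vec.independent (v ` I)"

definition nondegenerate_multiple_root ::
  "('n::finite \<Rightarrow> (int ^ 'n) set) \<Rightarrow> ('n \<times> (int ^ 'n) \<Rightarrow> 'k::field) \<Rightarrow> ('n \<Rightarrow> 'k) \<Rightarrow> bool" where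
  "nondegenerate_multiple_root A c u \<longleftrightarrow>
     isolated_solution A c u \<and>
     \<not> independent_family (\<lambda>i. laurent_gradient A c i u) UNIV \<and>
     (\<forall>I. card I = CARD('n) - 1 \<longrightarrow> independent_family (\<lambda>i. laurent_gradient A c i u) I)"

definition discriminantal_variety ::
  "('n::finite \<Rightarrow> (int ^ 'n) set) \<Rightarrow> ('n \<times> (int ^ 'n) \<Rightarrow> 'k::field) set" where
  "discriminantal_variety A = zariski_closure (cayley_index A)
     {c \<in> coord_space (cayley_index A). \<exists>u. nondegenerate_multiple_root A c u}"

definition is_mixed_discriminant ::
  "'k::alg_closed_field itself \<Rightarrow> ('n::finite \<Rightarrow> (int ^ 'n) set) \<Rightarrow> ('n \<times> (int ^ 'n), int) mpoly \<Rightarrow> bool" where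
  "is_mixed_discriminant _ A D \<longleftrightarrow>
     is_discriminant_of (cayley_index A)
       (discriminantal_variety A :: ('n \<times> (int ^ 'n) \<Rightarrow> 'k) set) D"


section \<open>Toric varieties, dual varieties and the A-discriminant\<close>

text \<open>
  Projective varieties in \<open>\<P>(K\<^sup>S)\<close> are represented by their affine cones in \<open>K\<^sup>S\<close>: the points
  of the variety are the lines through the nonzero points of the cone. An integer matrix is given
  by its columns \<open>M s\<close>, \<open>s \<in> S\<close>.
\<close>

definition toric_cone :: "'s set \<Rightarrow> ('s \<Rightarrow> int ^ 'd::finite) \<Rightarrow> ('s \<Rightarrow> 'k::field) set" where
  "toric_cone S M = zariski_closure S
     {(\<lambda>s. if s \<in> S then l * laurent_monomial t (M s) else 0) | l t. l \<noteq> 0 \<and> t \<in> torus}"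

definition tangent_space :: "'s set \<Rightarrow> ('s \<Rightarrow> 'k::field) set \<Rightarrow> ('s \<Rightarrow> 'k) \<Rightarrow> ('s \<Rightarrow> 'k) set" where
  "tangent_space S X p = {v \<in> coord_space S.
     \<forall>g\<in>vanishing_ideal S X. (\<Sum>s\<in>S. meval (mpartial s g) p * v s) = 0}"

definition fun_dim :: "('s \<Rightarrow> 'k::field) set \<Rightarrow> nat" where
  "fun_dim = vector_space.dim (\<lambda>r v s. r * v s)"

text \<open>
  A point of an irreducible variety is smooth when its Zariski tangent space has the least
  dimension that occurs on the variety (this least value is the dimension of the variety). For
  cones the vertex \<open>0\<close> is not a point of the projective variety.
\<close>

definition smooth_cone_point :: "'s set \<Rightarrow> ('s \<Rightarrow> 'k::field) set \<Rightarrow> ('s \<Rightarrow> 'k) \<Rightarrow> bool" where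
  "smooth_cone_point S X p \<longleftrightarrow> p \<in> X \<and> p \<noteq> 0 \<and>
     (\<forall>q\<in>X. q \<noteq> 0 \<longrightarrow> fun_dim (tangent_space S X p) \<le> fun_dim (tangent_space S X q))"

text \<open>
  The cone over the dual variety: the closure of the set of hyperplanes
  \<open>\<Sum>\<^sub>s c\<^sub>s z\<^sub>s = 0\<close>, \<open>c \<noteq> 0\<close>, that contain the tangent space at some smooth point. If there is no
  such hyperplane, the result is empty rather than \<open>{0}\<close>.
\<close>

definition dual_cone :: "'s set \<Rightarrow> ('s \<Rightarrow> 'k::field) set \<Rightarrow> ('s \<Rightarrow> 'k) set" where
  "dual_cone S X = zariski_closure S
     {c \<in> coord_space S. c \<noteq> 0 \<and>
        (\<exists>p. smooth_cone_point S X p \<and> (\<forall>v\<in>tangent_space S X p. (\<Sum>s\<in>S. c s * v s) = 0))}"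

definition is_A_discriminant ::
  "'k::alg_closed_field itself \<Rightarrow> 's set \<Rightarrow> ('s \<Rightarrow> int ^ 'd::finite) \<Rightarrow> ('s, int) mpoly \<Rightarrow> bool" where
  "is_A_discriminant _ S M D \<longleftrightarrow>
     is_discriminant_of S (dual_cone S (toric_cone S M) :: ('s \<Rightarrow> 'k) set) D"

text \<open>
  The column \<open>(e\<^sub>i, a)\<close>. The rows \<open>Inl _\<close> carry the variables \<open>y\<close>, the rows \<open>Inr _\<close> the
  variables \<open>x\<close>.
\<close>

definition cayley_matrix :: "'n \<times> (int ^ 'n) \<Rightarrow> int ^ ('n + 'n)" where
  "cayley_matrix = (\<lambda>(i, a). \<chi> r. case r of Inl k \<Rightarrow> (if k = i then 1 else 0) | Inr j \<Rightarrow> a $ j)"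

definition matrix_rank_over ::
  "'k::field itself \<Rightarrow> 's set \<Rightarrow> ('s \<Rightarrow> int ^ 'd::finite) \<Rightarrow> nat" where
  "matrix_rank_over _ S M = vec.dim ((\<lambda>s. (\<chi> r. of_int (M s $ r)) :: 'k ^ 'd) ` S)"

end

theory Submission
  imports Defs
begin

text \<open>
  By the action of the torus, the dual variety is the closure of the set of the \<open>c\<close> for which
  \<open>\<phi> = \<Sum> y\<^sub>i f\<^sub>i\<close> has a singular point \<open>(x, y)\<close> in the torus; such a point is a solution \<open>x\<close>
  together with a relation between the gradients that has no zero coefficient. A non-degenerate
  multiple root provides one, so the discriminantal variety is contained in the dual variety. The
  full rank of the Cayley matrix gives a parametrisation of the dual variety by \<open>m - 1\<close>
  parameters: the singular point up to scaling, and the coefficients outside a basis. Hence the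
  two varieties agree if the smaller one is a hypersurface. If the larger one is a hypersurface,
  its general point has only finitely many singular points up to scaling. This finiteness forces
  the relation between the gradients to be unique and the solution to be isolated, so that
  general points of the dual variety have a non-degenerate multiple root. No Hessians occur,
  which makes the argument independent of the characteristic.
\<close>

section \<open>Linear algebra for finite families of functions\<close>

text \<open>No equality of the varieties is claimed when neither is a hypersurface, because both
  discriminants are 1 then. It remains to compare them when one of the two is a hypersurface.
  Dimension theory is replaced by two elementary facts. Counting Laurent monomials shows that
  \<open>m\<close> Laurent functions of \<open>m - 1\<close> parameters satisfy a polynomial
  relation; solving \<open>g = 0\<close> for one coordinate shows that the other
  \<open>m - 1\<close> coordinates satisfy none on that hypersurface. A vanishing statement proved
  off the zeros of a nonzero function extends everywhere, since a product vanishes identically only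
  if a factor does. Two definitions reach beyond the torus. The dual cone uses all smooth points, so
  torus points must be recognised as smooth and the other conormal vectors shown to add nothing to
  the closure. Isolation refers to closure in affine space, so Laurent functions serve as tests only
  after clearing denominators. The rank is taken over the ground field because a maximal minor must
  be nonzero there: relations between columns are found over the integers, as exponents of
  binomials, and then divided by that minor.\<close>

lemma underdetermined_system:
  fixes a :: "'j \<Rightarrow> 'r \<Rightarrow> 'k::field"
  assumes "finite R" "finite J" "card R < card J"
  shows "\<exists>b. (\<exists>j\<in>J. b j \<noteq> 0) \<and> (\<forall>r\<in>R. (\<Sum>j\<in>J. b j * a j r) = 0)"
  using assms
proof (induction R arbitrary: J a rule: finite_induct)
  case empty
  then obtain j where "j \<in> J" by fastforce
  then show ?case by (intro exI[of _ "\<lambda>_. 1"]) auto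
next
  case (insert r R)
  show ?case
  proof (cases "\<forall>j\<in>J. a j r = 0")
    case True
    with insert.IH[of J a] insert.prems insert.hyps obtain b
      where "\<exists>j\<in>J. b j \<noteq> 0" "\<forall>r\<in>R. (\<Sum>j\<in>J. b j * a j r) = 0" by auto
    with True show ?thesis by (intro exI[of _ b]) auto
  next
    case False
    then obtain j0 where j0: "j0 \<in> J" "a j0 r \<noteq> 0" by blast
    let ?J = "J - {j0}"
    have "card R < card ?J" using insert j0 by auto
    then obtain b where b: "\<exists>j\<in>?J. b j \<noteq> 0"
      "\<And>r'. r' \<in> R \<Longrightarrow> (\<Sum>j\<in>?J. b j * (a j r' - a j r / a j0 r * a j0 r')) = 0"
      using insert.IH[of ?J "\<lambda>j r'. a j r' - a j r / a j0 r * a j0 r'"] insert.prems by auto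
    \<comment> \<open>The value at \<open>j0\<close> is forced by the equation \<open>r\<close>; the
      other entries come from the system in which \<open>j0\<close> has been eliminated.\<close>
    define b' where "b' = b(j0 := - (\<Sum>j\<in>?J. b j * a j r) / a j0 r)"
    have *: "(\<Sum>j\<in>J. b' j * a j r') = (\<Sum>j\<in>?J. b j * (a j r' - a j r / a j0 r * a j0 r'))" for r'
    proof -
      have "(\<Sum>j\<in>J. b' j * a j r') = b' j0 * a j0 r' + (\<Sum>j\<in>?J. b' j * a j r')"
        using insert.prems j0 by (intro sum.remove) auto
      also have "(\<Sum>j\<in>?J. b' j * a j r') = (\<Sum>j\<in>?J. b j * a j r')"
        by (intro sum.cong) (auto simp: b'_def)
      also have "b' j0 * a j0 r' = - (\<Sum>j\<in>?J. b j * (a j r / a j0 r * a j0 r'))"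
        by (simp add: b'_def sum_distrib_left sum_distrib_right sum_divide_distrib algebra_simps)
      finally show ?thesis by (simp add: sum_subtractf algebra_simps)
    qed
    have "(\<Sum>j\<in>J. b' j * a j r') = 0" if "r' \<in> insert r R" for r'
    proof (cases "r' = r")
      case True
      then show ?thesis using j0 unfolding * by simp
    next
      case False
      then show ?thesis using b(2) that unfolding * by simp
    qed
    moreover have "\<exists>j\<in>J. b' j \<noteq> 0" using b(1) by (auto simp: b'_def)
    ultimately show ?thesis by blast
  qed
qed

text \<open>Sum and scaling are merged into one condition, the form in which
  \<open>lin_comb_meval\<close> delivers combinations of differentials.\<close>

definition lin_closed :: "('s \<Rightarrow> 'k::field) set \<Rightarrow> bool" where
  "lin_closed L \<longleftrightarrow> (\<lambda>_. 0) \<in> L \<and> (\<forall>v\<in>L. \<forall>w\<in>L. \<forall>a. (\<lambda>s. v s + a * w s) \<in> L)"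

lemma lin_closedD:
  assumes "lin_closed L"
  shows "(\<lambda>_. 0) \<in> L" "v \<in> L \<Longrightarrow> w \<in> L \<Longrightarrow> (\<lambda>s. v s + a * w s) \<in> L"
  using assms by (simp_all add: lin_closed_def)

text \<open>Take a maximal \<open>J\<close> that admits a family in \<open>L\<close> restricting to
  the identity matrix on \<open>J\<close>. An element of \<open>L\<close> that is zero on
  \<open>J\<close> but not on \<open>S\<close> could be normalised and would enlarge
  \<open>J\<close>, so the entries in \<open>J\<close> determine all entries in
  \<open>S\<close>.\<close>

lemma echelon_basis:
  fixes L :: "('s \<Rightarrow> 'k::field) set"
  assumes S: "finite S"
    and L: "lin_closed L"
  shows "\<exists>J l. J \<subseteq> S \<and> (\<forall>j\<in>J. l j \<in> L) \<and> (\<forall>j\<in>J. \<forall>i\<in>J. l j i = (if i = j then 1 else 0)) \<and>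
           (\<forall>v\<in>L. \<forall>s\<in>S. v s = (\<Sum>j\<in>J. v j * l j s))"
proof -
  note L1 = lin_closedD(1)[OF L] and L2 = lin_closedD(2)[OF L]
  define P where "P J l \<longleftrightarrow> J \<subseteq> S \<and> (\<forall>j\<in>J. l j \<in> L) \<and>
    (\<forall>j\<in>J. \<forall>i\<in>J. l j i = (if i = j then 1 else 0))" for J and l :: "'s \<Rightarrow> 's \<Rightarrow> 'k"
  have fin: "finite {J. \<exists>l. P J l}"
    by (rule finite_subset[OF _ finite_Pow_iff[THEN iffD2, OF S]]) (auto simp: P_def)
  moreover have "{} \<in> {J. \<exists>l. P J l}" by (auto simp: P_def)
  ultimately obtain J where J: "J \<in> {J. \<exists>l. P J l}"
    and max: "\<And>J'. J' \<in> {J. \<exists>l. P J l} \<Longrightarrow> J \<subseteq> J' \<Longrightarrow> J' = J"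
    using finite_has_maximal2[of "{J. \<exists>l. P J l}" "{}"] by metis
  then obtain l where l: "P J l" by auto
  have fJ: "finite J" using l S finite_subset by (auto simp: P_def)
  have vanish: "v s = 0" if v: "v \<in> L" "\<forall>j\<in>J. v j = 0" "s \<in> S" for v s
  proof (rule ccontr)
    assume vs: "v s \<noteq> 0"
    then have sJ: "s \<notin> J" using v by auto
    define w where "w = (\<lambda>i. 0 + inverse (v s) * v i)"
    have w: "w \<in> L" "w s = 1" "\<forall>j\<in>J. w j = 0"
      unfolding w_def using L2[OF L1 v(1)] vs v by auto
    define l' where "l' j = (if j = s then w else (\<lambda>i. l j i + (- l j s) * w i))" for j
    have "l' j \<in> L" if "j \<in> insert s J" for j
      using l w that L2[OF _ w(1), of "l j" "- l j s"] unfolding P_def l'_def by auto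
    then have "P (insert s J) l'"
      using l w sJ v(3) unfolding P_def l'_def by auto
    then show False using max[of "insert s J"] sJ by auto
  qed
  have sumL: "(\<lambda>s. v s - (\<Sum>j\<in>I. c j * l j s)) \<in> L" if "v \<in> L" "I \<subseteq> J" "finite I" for v c I
    using that(3,1,2)
  proof (induction I rule: finite_induct)
    case (insert i I)
    have "(\<lambda>s. (v s - (\<Sum>j\<in>I. c j * l j s)) + (- c i) * l i s) \<in> L"
      using insert l by (intro L2) (auto simp: P_def)
    then show ?case using insert by (simp add: algebra_simps)
  qed simp
  have "v s = (\<Sum>j\<in>J. v j * l j s)" if v: "v \<in> L" "s \<in> S" for v s
  proof -
    have "v i - (\<Sum>j\<in>J. v j * l j i) = 0" if "i \<in> J" for i
    proof -
      have "(\<Sum>j\<in>J. v j * l j i) = (\<Sum>j\<in>J. if j = i then v j else 0)"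
        using l that by (intro sum.cong) (auto simp: P_def)
      then show ?thesis using that fJ by simp
    qed
    then have "v s - (\<Sum>j\<in>J. v j * l j s) = 0"
      using vanish[OF sumL[OF v(1) order_refl fJ] _ v(2)] by blast
    then show ?thesis by simp
  qed
  then show ?thesis using l by (intro exI[of _ J] exI[of _ l]) (simp_all add: P_def)
qed

text \<open>For \<open>s\<close> outside the pivot set \<open>J\<close>, the unit vector at
  \<open>s\<close> minus the unit vectors at \<open>j\<close> in \<open>J\<close> weighted by
  \<open>l j s\<close> annihilates \<open>L\<close>. Pairing it with \<open>c\<close> expresses
  \<open>c s\<close> through the pivot entries of \<open>c\<close>, just as for elements of
  \<open>L\<close>.\<close>

lemma double_annihilator:
  fixes L :: "('s \<Rightarrow> 'k::field) set"
  assumes S: "finite S"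
    and L: "lin_closed L"
    and c: "\<And>v. v \<in> coord_space S \<Longrightarrow> (\<forall>l\<in>L. (\<Sum>s\<in>S. l s * v s) = 0) \<Longrightarrow> (\<Sum>s\<in>S. c s * v s) = 0"
  shows "\<exists>l\<in>L. \<forall>s\<in>S. c s = l s"
proof -
  note L1 = lin_closedD(1)[OF L] and L2 = lin_closedD(2)[OF L]
  obtain J l where J: "J \<subseteq> S" "\<And>j. j \<in> J \<Longrightarrow> l j \<in> L"
    "\<And>i j. j \<in> J \<Longrightarrow> i \<in> J \<Longrightarrow> l j i = (if i = j then 1 else 0)"
    "\<And>v s. v \<in> L \<Longrightarrow> s \<in> S \<Longrightarrow> v s = (\<Sum>j\<in>J. v j * l j s)"
    using echelon_basis[OF S L] by metis
  have fJ: "finite J" using J(1) S finite_subset by auto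
  have "(\<lambda>s. \<Sum>j\<in>I. c j * l j s) \<in> L" if "finite I" "I \<subseteq> J" for I
    using that
  proof (induction I rule: finite_induct)
    case (insert i I)
    then have "(\<lambda>s. (\<Sum>j\<in>I. c j * l j s) + c i * l i s) \<in> L"
      using J(2) by (intro L2) auto
    then show ?case using insert by (simp add: algebra_simps)
  qed (simp add: L1)
  moreover have "c s = (\<Sum>j\<in>J. c j * l j s)" if s: "s \<in> S" for s
  proof (cases "s \<in> J")
    case True
    have "(\<Sum>j\<in>J. c j * l j s) = (\<Sum>j\<in>J. if j = s then c j else 0)"
      using J(3) True by (intro sum.cong) auto
    then show ?thesis using True fJ by simp
  next
    case False
    define v where "v i = (if i = s then 1 else if i \<in> J then - l i s else 0)" for i
    have *: "(\<Sum>i\<in>S. u i * v i) = u s - (\<Sum>j\<in>J. u j * l j s)" for u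
    proof -
      have "(\<Sum>i\<in>S. u i * v i) = (\<Sum>i\<in>insert s J. u i * v i)"
        using S s J(1) by (intro sum.mono_neutral_right) (auto simp: v_def)
      also have "\<dots> = u s + (\<Sum>j\<in>J. u j * v j)"
        using fJ False by (simp add: v_def)
      also have "(\<Sum>j\<in>J. u j * v j) = (\<Sum>j\<in>J. - (u j * l j s))"
        using False by (intro sum.cong) (auto simp: v_def)
      finally show ?thesis by (simp add: sum_negf)
    qed
    have "v \<in> coord_space S" using s J(1) by (auto simp: v_def coord_space_def)
    moreover have "\<forall>l\<in>L. (\<Sum>i\<in>S. l i * v i) = 0" unfolding * using J(4) s by auto
    ultimately have "(\<Sum>i\<in>S. c i * v i) = 0" by (rule c)
    then show ?thesis unfolding * by simp
  qed
  ultimately show ?thesis using fJ by (intro bexI[of _ "\<lambda>s. \<Sum>j\<in>J. c j * l j s"]) auto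
qed

section \<open>Algebras of polynomial and Laurent polynomial functions\<close>

text \<open>
  Working with functions instead of formal Laurent polynomials loses nothing, since the ground
  field is infinite. \<open>T\<close> is the set of the invertible variables.
\<close>

inductive_set lfun :: "'v set \<Rightarrow> 'v set \<Rightarrow> (('v \<Rightarrow> 'k::field) \<Rightarrow> 'k) set" for V T where
  const: "(\<lambda>_. a) \<in> lfun V T"
| var: "v \<in> V \<Longrightarrow> (\<lambda>x. x v) \<in> lfun V T"
| inv: "v \<in> T \<Longrightarrow> (\<lambda>x. inverse (x v)) \<in> lfun V T"
| add: "F \<in> lfun V T \<Longrightarrow> G \<in> lfun V T \<Longrightarrow> (\<lambda>x. F x + G x) \<in> lfun V T"
| mult: "F \<in> lfun V T \<Longrightarrow> G \<in> lfun V T \<Longrightarrow> (\<lambda>x. F x * G x) \<in> lfun V T"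

definition units_on :: "'v set \<Rightarrow> ('v \<Rightarrow> 'k::field) set" where
  "units_on T = {x. \<forall>v\<in>T. x v \<noteq> 0}"

lemma units_on_empty [simp]: "units_on {} = UNIV"
  by (simp add: units_on_def)

lemma lfun_sum: "(\<And>i. i \<in> I \<Longrightarrow> F i \<in> lfun V T) \<Longrightarrow> (\<lambda>x. \<Sum>i\<in>I. F i x) \<in> lfun V T"
  by (induction I rule: infinite_finite_induct) (simp_all add: lfun.const lfun.add)

lemma lfun_prod: "(\<And>i. i \<in> I \<Longrightarrow> F i \<in> lfun V T) \<Longrightarrow> (\<lambda>x. \<Prod>i\<in>I. F i x) \<in> lfun V T"
  by (induction I rule: infinite_finite_induct) (simp_all add: lfun.const lfun.mult)

lemma lfun_power: "F \<in> lfun V T \<Longrightarrow> (\<lambda>x. F x ^ n) \<in> lfun V T"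
  by (induction n) (simp_all add: lfun.const lfun.mult)

lemma lfun_cmult: "F \<in> lfun V T \<Longrightarrow> (\<lambda>x. a * F x) \<in> lfun V T"
  by (rule lfun.mult[OF lfun.const])

lemma lfun_uminus: "F \<in> lfun V T \<Longrightarrow> (\<lambda>x. - F x) \<in> lfun V T"
  using lfun_cmult[of F V T "-1"] by simp

lemma lfun_diff: "F \<in> lfun V T \<Longrightarrow> G \<in> lfun V T \<Longrightarrow> (\<lambda>x. F x - G x) \<in> lfun V T"
  using lfun.add[of F V T "\<lambda>x. - G x"] lfun_uminus[of G V T] by simp

lemma lfun_power_int: "v \<in> V \<Longrightarrow> v \<in> T \<Longrightarrow> (\<lambda>x. x v powi n) \<in> lfun V T"
  unfolding power_int_def by (cases "n \<ge> 0") (simp_all add: lfun_power lfun.var lfun.inv)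

lemmas lfun_intros = lfun.intros lfun_sum lfun_prod lfun_power lfun_cmult lfun_uminus lfun_diff

lemma lfun_mono: "F \<in> lfun V T \<Longrightarrow> V \<subseteq> V' \<Longrightarrow> T \<subseteq> T' \<Longrightarrow> F \<in> lfun V' T'"
proof (induction rule: lfun.induct)
  case (add F G)
  then show ?case by (intro lfun.add) auto
next
  case (mult F G)
  then show ?case by (intro lfun.mult) auto
qed (auto intro: lfun.const lfun.var lfun.inv)

lemma lfun_cong: "F \<in> lfun V T \<Longrightarrow> (\<And>v. v \<in> V \<union> T \<Longrightarrow> x v = y v) \<Longrightarrow> F x = F y"
  by (induction rule: lfun.induct) auto

lemma lfun_subst:
  "F \<in> lfun I {} \<Longrightarrow> (\<And>i. i \<in> I \<Longrightarrow> G i \<in> lfun V T) \<Longrightarrow> (\<lambda>x. F (\<lambda>i. G i x)) \<in> lfun V T"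
proof (induction rule: lfun.induct)
  case (add F G)
  then show ?case by (intro lfun.add) auto
next
  case (mult F G)
  then show ?case by (intro lfun.mult) auto
qed (auto intro: lfun.const)

section \<open>Generic non-vanishing over an infinite field\<close>

lemma infinite_alg_closed: "infinite (UNIV :: 'k::alg_closed_field set)"
proof
  assume fin: "finite (UNIV :: 'k set)"
  define p :: "'k poly" where "p = (\<Prod>a\<in>UNIV. [:- a, 1:]) + 1"
  have "degree (\<Prod>a\<in>(UNIV :: 'k set). [:- a, 1:]) = card (UNIV :: 'k set)"
    by (subst degree_prod_eq_sum_degree) auto
  moreover have "card (UNIV :: 'k set) > 0" using fin by (simp add: finite_UNIV_card_ge_0)
  ultimately have "degree p > 0" unfolding p_def by (subst degree_add_eq_left) auto
  then obtain x where "poly p x = 0" using alg_closed_imp_poly_has_root by blast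
  moreover have "poly p x = 1" using fin by (auto simp: p_def poly_prod)
  ultimately show False by simp
qed

text \<open>
  The denominator \<open>Q\<close> of the restriction to a line does not vanish at the two given points, so
  that non-vanishing at these points is inherited by the numerator \<open>P\<close>.
\<close>

lemma lfun_line:
  fixes p q :: "'v \<Rightarrow> 'k::field"
  assumes "F \<in> lfun V T" "p \<in> units_on T" "q \<in> units_on T"
  shows "\<exists>P Q. poly Q 0 \<noteq> 0 \<and> poly Q 1 \<noteq> 0 \<and>
    (\<forall>s. F (\<lambda>v. p v + s * (q v - p v)) * poly Q s = poly P s)"
  using assms
proof (induction rule: lfun.induct)
  case (const a)
  then show ?case by (intro exI[of _ "[:a:]"] exI[of _ 1]) auto
next
  case (var v)
  then show ?case by (intro exI[of _ "[:p v, q v - p v:]"] exI[of _ 1]) (auto simp: algebra_simps)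
next
  case (inv v)
  define l where "l = [:p v, q v - p v:]"
  have "p v + s * (q v - p v) = poly l s" for s by (simp add: l_def)
  then have "inverse (p v + s * (q v - p v)) * poly (l ^ 2) s = poly l s" for s
    by (cases "poly l s = 0") (auto simp: power2_eq_square)
  then show ?case
    by (intro exI[of _ "l"] exI[of _ "l ^ 2"]) (use inv in \<open>auto simp: l_def units_on_def\<close>)
next
  case (add F G)
  then obtain P Q P' Q' where *: "poly Q 0 \<noteq> 0" "poly Q 1 \<noteq> 0" "poly Q' 0 \<noteq> 0" "poly Q' 1 \<noteq> 0"
    "\<And>s. F (\<lambda>v. p v + s * (q v - p v)) * poly Q s = poly P s"
    "\<And>s. G (\<lambda>v. p v + s * (q v - p v)) * poly Q' s = poly P' s" by blast
  show ?case
    by (rule exI[of _ "P * Q' + P' * Q"], rule exI[of _ "Q * Q'"])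
       (use *(1-4) in \<open>auto simp: *(5,6)[symmetric] algebra_simps\<close>)
next
  case (mult F G)
  then obtain P Q P' Q' where *: "poly Q 0 \<noteq> 0" "poly Q 1 \<noteq> 0" "poly Q' 0 \<noteq> 0" "poly Q' 1 \<noteq> 0"
    "\<And>s. F (\<lambda>v. p v + s * (q v - p v)) * poly Q s = poly P s"
    "\<And>s. G (\<lambda>v. p v + s * (q v - p v)) * poly Q' s = poly P' s" by blast
  show ?case
    by (rule exI[of _ "P * P'"], rule exI[of _ "Q * Q'"])
       (use *(1-4) in \<open>auto simp: *(5,6)[symmetric] algebra_simps\<close>)
qed

text \<open>On the line through \<open>p\<close> and \<open>q\<close> the numerator of
  \<open>F\<close> is nonzero at parameter 0 and that of \<open>G\<close> at parameter 1, so both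
  are nonzero polynomials. The linear factors in \<open>R\<close> keep the chosen point of the line
  inside \<open>units_on T\<close>.\<close>

lemma lfun_common_nonzero2:
  fixes p q :: "'v \<Rightarrow> 'k::field"
  assumes inf: "infinite (UNIV :: 'k set)" and T: "finite T"
    and F: "F \<in> lfun V T" "p \<in> units_on T" "F p \<noteq> 0"
    and G: "G \<in> lfun V T" "q \<in> units_on T" "G q \<noteq> 0"
  shows "\<exists>r\<in>units_on T. F r \<noteq> 0 \<and> G r \<noteq> 0"
proof -
  let ?l = "\<lambda>s v. p v + s * (q v - p v)"
  have l01: "?l 0 = p" "?l 1 = q" by auto
  obtain P Q where P: "poly Q 0 \<noteq> 0" "\<And>s. F (?l s) * poly Q s = poly P s"
    using lfun_line[OF F(1,2) G(2)] by blast
  obtain P' Q' where P': "poly Q' 1 \<noteq> 0" "\<And>s. G (?l s) * poly Q' s = poly P' s"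
    using lfun_line[OF G(1) F(2) G(2)] by blast
  define R where "R = P * P' * (\<Prod>v\<in>T. [:p v, q v - p v:])"
  have "poly P 0 \<noteq> 0" using P(2)[of 0] P(1) F(3) by auto
  moreover have "poly P' 1 \<noteq> 0" using P'(2)[of 1] P'(1) G(3) by auto
  moreover have "(\<Prod>v\<in>T. [:p v, q v - p v:]) \<noteq> 0"
    using T F(2) by (auto simp: units_on_def)
  ultimately have "R \<noteq> 0" by (auto simp: R_def)
  then have "finite {s. poly R s = 0}" by (rule poly_roots_finite)
  then obtain s where "poly R s \<noteq> 0"
    using inf by (metis (mono_tags) ex_new_if_finite mem_Collect_eq)
  then have "poly P s \<noteq> 0" "poly P' s \<noteq> 0" "\<forall>v\<in>T. p v + s * (q v - p v) \<noteq> 0"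
    using T by (auto simp: R_def poly_prod mult.commute)
  then show ?thesis using P(2)[of s] P'(2)[of s]
    by (intro bexI[of _ "?l s"]) (auto simp: units_on_def)
qed

text \<open>Irreducibility of \<open>units_on T\<close>. The genericity arguments below use it to
  discard the locus where an auxiliary factor is zero.\<close>

lemma lfun_prod_eq_0:
  fixes F :: "('v \<Rightarrow> 'k::field) \<Rightarrow> 'k"
  assumes "infinite (UNIV :: 'k set)" "finite T" "F \<in> lfun V T" "G \<in> lfun V T"
    and "\<And>p. p \<in> units_on T \<Longrightarrow> F p * G p = 0"
  shows "(\<forall>p\<in>units_on T. F p = 0) \<or> (\<forall>p\<in>units_on T. G p = 0)"
  using lfun_common_nonzero2[OF assms(1-3) _ _ assms(4)] assms(5) mult_eq_0_iff by blast

lemma lfun_common_nonzero: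
  fixes F :: "'i \<Rightarrow> ('v \<Rightarrow> 'k::field) \<Rightarrow> 'k"
  assumes "infinite (UNIV :: 'k set)" "finite T" "finite I"
    and "\<And>i. i \<in> I \<Longrightarrow> F i \<in> lfun V T" "\<And>i. i \<in> I \<Longrightarrow> \<exists>p\<in>units_on T. F i p \<noteq> 0"
  shows "\<exists>p\<in>units_on T. \<forall>i\<in>I. F i p \<noteq> 0"
  using assms(3-5)
proof (induction I rule: finite_induct)
  case empty
  have "(\<lambda>_. 1) \<in> (units_on T :: ('v \<Rightarrow> 'k) set)" by (simp add: units_on_def)
  then show ?case by blast
next
  case (insert i I)
  then obtain p where p: "p \<in> units_on T" "\<And>i. i \<in> I \<Longrightarrow> F i p \<noteq> 0" by auto
  obtain q where q: "q \<in> units_on T" "F i q \<noteq> 0" using insert.prems by auto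
  have "\<exists>r\<in>units_on T. (\<Prod>i\<in>I. F i r) \<noteq> 0 \<and> F i r \<noteq> 0"
    using p q insert by (intro lfun_common_nonzero2[OF assms(1,2) _ p(1) _ _ q(1)])
      (auto intro: lfun_prod)
  then show ?case using insert.hyps by auto
qed

text \<open>The proof is fraction-free Gaussian elimination.\<close>

lemma lfun_independence_open:
  fixes v :: "'j \<Rightarrow> 's \<Rightarrow> ('v \<Rightarrow> 'k::field) \<Rightarrow> 'k"
  assumes "finite J" "\<And>j s. j \<in> J \<Longrightarrow> s \<in> S \<Longrightarrow> v j s \<in> lfun V T"
    and "\<And>b. (\<And>s. s \<in> S \<Longrightarrow> (\<Sum>j\<in>J. b j * v j s q) = 0) \<Longrightarrow> \<forall>j\<in>J. b j = 0"
  shows "\<exists>h\<in>lfun V T. h q \<noteq> 0 \<and>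
    (\<forall>p b. h p \<noteq> 0 \<longrightarrow> (\<forall>s\<in>S. (\<Sum>j\<in>J. b j * v j s p) = 0) \<longrightarrow> (\<forall>j\<in>J. b j = 0))"
  using assms
proof (induction J arbitrary: v rule: finite_induct)
  case empty
  then show ?case by (intro bexI[of _ "\<lambda>_. 1"]) (auto intro: lfun.intros)
next
  case (insert i J)
  note fin = \<open>finite J\<close> and iJ = \<open>i \<notin> J\<close>
  have sumi: "(\<Sum>j\<in>insert i J. f j) = f i + (\<Sum>j\<in>J. f j)" for f :: "'j \<Rightarrow> 'k"
    using fin iJ by simp
  obtain r where r: "r \<in> S" "v i r q \<noteq> 0"
  proof (rule ccontr)
    assume "\<not> thesis"
    then have "(\<Sum>j\<in>insert i J. (if j = i then 1 else 0) * v j s q) = 0" if "s \<in> S" for s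
    proof -
      have "(\<Sum>j\<in>J. (if j = i then 1 else 0) * v j s q) = 0" using iJ by (intro sum.neutral) auto
      then show ?thesis
        using that \<open>\<not> thesis\<close> \<open>\<And>r. r \<in> S \<Longrightarrow> v i r q \<noteq> 0 \<Longrightarrow> thesis\<close> by (auto simp: sumi)
    qed
    from insert.prems(2)[OF this] show False by auto
  qed
  define w where "w j s p = v i r p * v j s p - v j r p * v i s p" for j s p
  have sumw: "(\<Sum>j\<in>J. b j * w j s p) =
      v i r p * (\<Sum>j\<in>J. b j * v j s p) - (\<Sum>j\<in>J. b j * v j r p) * v i s p" for b s p
    by (simp add: w_def sum_distrib_left sum_distrib_right sum_subtractf algebra_simps)
  have "\<exists>h\<in>lfun V T. h q \<noteq> 0 \<and>
    (\<forall>p b. h p \<noteq> 0 \<longrightarrow> (\<forall>s\<in>S. (\<Sum>j\<in>J. b j * w j s p) = 0) \<longrightarrow> (\<forall>j\<in>J. b j = 0))"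
  proof (rule insert.IH)
    show "w j s \<in> lfun V T" if "j \<in> J" "s \<in> S" for j s
      unfolding w_def using insert.prems(1) that r by (intro lfun_diff lfun.mult) auto
    show "\<forall>j\<in>J. b j = 0" if b: "\<And>s. s \<in> S \<Longrightarrow> (\<Sum>j\<in>J. b j * w j s q) = 0" for b
    proof -
      \<comment> \<open>The coefficient at \<open>i\<close> makes the combination \<open>b'\<close>
        of the original rows equal to the combination \<open>b\<close> of the eliminated
        rows.\<close>
      define b' where "b' = (\<lambda>j. if j = i then - (\<Sum>j\<in>J. b j * v j r q) else b j * v i r q)"
      have "(\<Sum>j\<in>J. b' j * v j s q) = v i r q * (\<Sum>j\<in>J. b j * v j s q)" for s
        unfolding sum_distrib_left using iJ by (intro sum.cong) (auto simp: b'_def)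
      then have "(\<Sum>j\<in>insert i J. b' j * v j s q) = 0" if "s \<in> S" for s
        using b[OF that] unfolding sumw sumi by (simp add: b'_def)
      from insert.prems(2)[OF this] show ?thesis using r iJ by (auto simp: b'_def split: if_splits)
    qed
  qed
  then obtain h where h: "h \<in> lfun V T" "h q \<noteq> 0"
    "\<And>p b. h p \<noteq> 0 \<Longrightarrow> (\<forall>s\<in>S. (\<Sum>j\<in>J. b j * w j s p) = 0) \<Longrightarrow> (\<forall>j\<in>J. b j = 0)" by blast
  show ?case
  proof (intro bexI[of _ "\<lambda>p. h p * v i r p"] conjI allI impI)
    show "(\<lambda>p. h p * v i r p) \<in> lfun V T" using h insert.prems r by (intro lfun.mult) auto
    show "h q * v i r q \<noteq> 0" using h r by auto
  next
    fix p b assume p: "h p * v i r p \<noteq> 0" and "\<forall>s\<in>S. (\<Sum>j\<in>insert i J. b j * v j s p) = 0"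
    then have b: "(\<Sum>j\<in>J. b j * v j s p) = - (b i * v i s p)" if "s \<in> S" for s
      using that unfolding sumi by (metis add.commute add_eq_0_iff)
    have "(\<Sum>j\<in>J. b j * w j s p) = 0" if "s \<in> S" for s
      unfolding sumw using b[OF that] b[OF r(1)] by simp
    then have "\<forall>j\<in>J. b j = 0" using h(3)[of p b] p by auto
    moreover from this have "b i * v i r p = 0" using b[OF r(1)] by simp
    ultimately show "\<forall>j\<in>insert i J. b j = 0" using p by auto
  qed
qed

text \<open>The degree of \<open>Q x\<close> can drop at special points \<open>x\<close>. The bound
  \<open>D\<close>, uniform in \<open>x\<close>, allows sums over the coefficients to have a fixed
  index range.\<close>

lemma lfun_as_poly:
  assumes "F \<in> lfun V {}"
  shows "\<exists>Q D. (\<forall>x. F x = poly (Q x) (x v0)) \<and> (\<forall>k. (\<lambda>x. coeff (Q x) k) \<in> lfun (V - {v0}) {}) \<and>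
    (\<forall>x. degree (Q x) \<le> D)"
  using assms
proof (induction rule: lfun.induct)
  case (const a)
  have "(\<lambda>x. coeff [:a:] k) \<in> lfun (V - {v0}) {}" for k by (rule lfun.const)
  then show ?case by (intro exI[of _ "\<lambda>_. [:a:]"] exI[of _ 0]) auto
next
  case (var v)
  show ?case
  proof (cases "v = v0")
    case True
    have "(\<lambda>x. coeff [:0, 1:] k) \<in> lfun (V - {v0}) {}" for k by (rule lfun.const)
    then show ?thesis using True by (intro exI[of _ "\<lambda>_. [:0, 1:]"] exI[of _ 1]) auto
  next
    case False
    have "(\<lambda>x. coeff [:x v:] k) \<in> lfun (V - {v0}) {}" for k
      by (cases k) (use var False in \<open>auto intro: lfun.intros\<close>)
    then show ?thesis by (intro exI[of _ "\<lambda>x. [:x v:]"] exI[of _ 0]) auto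
  qed
next
  case (inv v)
  then show ?case by simp
next
  case (add F G)
  then obtain Q D Q' D' where *: "\<And>x. F x = poly (Q x) (x v0)" "\<And>x. G x = poly (Q' x) (x v0)"
    "\<And>k. (\<lambda>x. coeff (Q x) k) \<in> lfun (V - {v0}) {}" "\<And>k. (\<lambda>x. coeff (Q' x) k) \<in> lfun (V - {v0}) {}"
    "\<And>x. degree (Q x) \<le> D" "\<And>x. degree (Q' x) \<le> D'" by metis
  then have "degree (Q x + Q' x) \<le> D + D'" for x
    by (intro degree_add_le) (auto intro: le_trans trans_le_add1 trans_le_add2)
  then show ?case using * by (intro exI[of _ "\<lambda>x. Q x + Q' x"] exI[of _ "D + D'"])
      (auto intro: lfun.intros)
next
  case (mult F G)
  then obtain Q D Q' D' where *: "\<And>x. F x = poly (Q x) (x v0)" "\<And>x. G x = poly (Q' x) (x v0)"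
    "\<And>k. (\<lambda>x. coeff (Q x) k) \<in> lfun (V - {v0}) {}" "\<And>k. (\<lambda>x. coeff (Q' x) k) \<in> lfun (V - {v0}) {}"
    "\<And>x. degree (Q x) \<le> D" "\<And>x. degree (Q' x) \<le> D'" by metis
  then have "degree (Q x * Q' x) \<le> D + D'" for x
    by (meson add_mono degree_mult_le le_trans)
  then show ?case using * by (intro exI[of _ "\<lambda>x. Q x * Q' x"] exI[of _ "D + D'"])
      (auto simp: coeff_mult intro!: lfun_intros)
qed

section \<open>Algebraic dependence by counting Laurent monomials\<close>

text \<open>Exponents are total functions, so they need to be distinguished on \<open>I\<close>.
  Sorting \<open>M\<close> by the exponent of one variable gives, for fixed values of the others, a
  polynomial in one variable with infinitely many zeros; its coefficients are sums over fewer
  variables.\<close>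

lemma monomials_independent:
  fixes a :: "('v \<Rightarrow> nat) \<Rightarrow> 'k::field"
  assumes inf: "infinite (UNIV :: 'k set)" and "finite I" "finite M"
    and "inj_on (\<lambda>m. restrict m I) M"
    and "\<And>x. (\<Sum>m\<in>M. a m * (\<Prod>i\<in>I. x i ^ m i)) = 0"
  shows "\<forall>m\<in>M. a m = 0"
  using assms(2-)
proof (induction I arbitrary: M rule: finite_induct)
  case empty
  show ?case
  proof
    fix m assume m: "m \<in> M"
    then have "M = {m}" using empty.prems(2) by (auto simp: inj_on_def restrict_def)
    then show "a m = 0" using empty.prems(3)[of "\<lambda>_. 0"] by simp
  qed
next
  case (insert i I)
  define Mk where "Mk k = {m\<in>M. m i = k}" for k
  have "\<forall>m\<in>Mk k. a m = 0" for k
  proof (rule insert.IH)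
    show "finite (Mk k)" using insert.prems by (auto simp: Mk_def)
    show "inj_on (\<lambda>m. restrict m I) (Mk k)"
    proof (rule inj_onI)
      fix m m' assume *: "m \<in> Mk k" "m' \<in> Mk k" "restrict m I = restrict m' I"
      then have "restrict m (insert i I) = restrict m' (insert i I)"
        unfolding Mk_def restrict_def fun_eq_iff by (metis (mono_tags, lifting) insertE mem_Collect_eq)
      moreover have "m \<in> M" "m' \<in> M" using *(1,2) by (auto simp: Mk_def)
      ultimately show "m = m'" by (rule inj_onD[OF insert.prems(2)])
    qed
    fix x :: "'v \<Rightarrow> 'k"
    define p where "p = (\<Sum>m\<in>M. monom (a m * (\<Prod>j\<in>I. x j ^ m j)) (m i))"
    have "poly p t = 0" for t
    proof -
      have "(\<Prod>j\<in>I. (x(i := t)) j ^ m j) = (\<Prod>j\<in>I. x j ^ m j)" for m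
        using insert.hyps by (intro prod.cong) auto
      then show ?thesis using insert.prems(3)[of "x(i := t)"] insert.hyps
        by (simp add: p_def poly_sum poly_monom algebra_simps)
    qed
    then have "p = 0" using inf poly_roots_finite[of p] by auto
    then have "coeff p k = 0" by simp
    also have "coeff p k = (\<Sum>m\<in>M. if m i = k then a m * (\<Prod>j\<in>I. x j ^ m j) else 0)"
      by (simp add: p_def coeff_sum)
    also have "\<dots> = (\<Sum>m\<in>Mk k. a m * (\<Prod>j\<in>I. x j ^ m j))"
      using insert.prems(1) by (simp add: Mk_def sum.inter_filter)
    finally show "(\<Sum>m\<in>Mk k. a m * (\<Prod>j\<in>I. x j ^ m j)) = 0" .
  qed
  then show ?case by (auto simp: Mk_def)
qed

text \<open>Laurent polynomials with exponents in a box, as functions on the torus.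
  \<open>PiE\<close> makes the exponents extensional, so that the box is finite with
  \<open>(2 D + 1) ^ card V\<close> elements for finite \<open>V\<close>; off the torus
  \<open>powi\<close> is not additive in the exponent.\<close>

definition laurent_span :: "'v set \<Rightarrow> nat \<Rightarrow> (('v \<Rightarrow> 'k::field) \<Rightarrow> 'k) set" where
  "laurent_span V D = {F. \<exists>a :: ('v \<Rightarrow> int) \<Rightarrow> 'k. \<forall>x\<in>units_on V.
     F x = (\<Sum>e\<in>PiE V (\<lambda>_. {- int D..int D}). a e * (\<Prod>v\<in>V. x v powi e v))}"

lemma laurent_span_mono:
  assumes V: "finite V" and e: "\<And>v. v \<in> V \<Longrightarrow> \<bar>e v\<bar> \<le> int D"
  shows "(\<lambda>x :: 'v \<Rightarrow> 'k::field. \<Prod>v\<in>V. x v powi e v) \<in> laurent_span V D"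
proof -
  let ?E = "PiE V (\<lambda>_. {- int D..int D})"
  have re: "restrict e V \<in> ?E" using e by (fastforce simp: abs_le_iff)
  have "(\<Prod>v\<in>V. x v powi e v) =
      (\<Sum>e'\<in>?E. (if e' = restrict e V then 1 else 0) * (\<Prod>v\<in>V. x v powi e' v))" for x :: "'v \<Rightarrow> 'k"
  proof -
    have "(\<Sum>e'\<in>?E. (if e' = restrict e V then 1 else 0) * (\<Prod>v\<in>V. x v powi e' v)) =
       (\<Sum>e'\<in>?E. if e' = restrict e V then \<Prod>v\<in>V. x v powi e' v else 0)"
      by (intro sum.cong) auto
    also have "\<dots> = (\<Prod>v\<in>V. x v powi restrict e V v)"
      using re V by (simp add: sum.delta finite_PiE)
    finally show ?thesis by simp
  qed
  then show ?thesis unfolding laurent_span_def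
    by (intro CollectI exI[of _ "\<lambda>e'. if e' = restrict e V then 1 else 0"]) blast
qed

lemma laurent_span_add:
  assumes "F \<in> laurent_span V D" "G \<in> laurent_span V D"
  shows "(\<lambda>x. F x + G x) \<in> laurent_span V D"
proof -
  obtain a b where "\<forall>x\<in>units_on V. F x = (\<Sum>e\<in>PiE V (\<lambda>_. {- int D..int D}). a e * (\<Prod>v\<in>V. x v powi e v))"
    "\<forall>x\<in>units_on V. G x = (\<Sum>e\<in>PiE V (\<lambda>_. {- int D..int D}). b e * (\<Prod>v\<in>V. x v powi e v))"
    using assms unfolding laurent_span_def by blast
  then show ?thesis unfolding laurent_span_def
    by (intro CollectI exI[of _ "\<lambda>e. a e + b e"]) (auto simp: sum.distrib algebra_simps)
qed

lemma laurent_span_cmult: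
  assumes "F \<in> laurent_span V D"
  shows "(\<lambda>x. c * F x) \<in> laurent_span V D"
proof -
  obtain a where "\<forall>x\<in>units_on V. F x = (\<Sum>e\<in>PiE V (\<lambda>_. {- int D..int D}). a e * (\<Prod>v\<in>V. x v powi e v))"
    using assms unfolding laurent_span_def by blast
  then show ?thesis unfolding laurent_span_def
    by (intro CollectI exI[of _ "\<lambda>e. c * a e"]) (auto simp: sum_distrib_left algebra_simps)
qed

lemma laurent_span_sum:
  "(\<And>i. i \<in> I \<Longrightarrow> F i \<in> laurent_span V D) \<Longrightarrow> (\<lambda>x. \<Sum>i\<in>I. F i x) \<in> laurent_span V D"
proof (induction I rule: infinite_finite_induct)
  case empty
  then show ?case unfolding laurent_span_def by (intro CollectI exI[of _ "\<lambda>_. 0"]) auto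
next
  case (infinite I)
  then show ?case unfolding laurent_span_def by (intro CollectI exI[of _ "\<lambda>_. 0"]) auto
qed (auto intro: laurent_span_add)

lemma laurent_span_cong:
  "F \<in> laurent_span V D \<Longrightarrow> (\<And>x. x \<in> units_on V \<Longrightarrow> G x = F x) \<Longrightarrow> G \<in> laurent_span V D"
  unfolding laurent_span_def by auto

lemma laurent_span_mult:
  fixes F :: "('v \<Rightarrow> 'k::field) \<Rightarrow> 'k"
  assumes V: "finite V" and F: "F \<in> laurent_span V D" and G: "G \<in> laurent_span V D'"
  shows "(\<lambda>x. F x * G x) \<in> laurent_span V (D + D')"
proof -
  let ?E = "\<lambda>D. PiE V (\<lambda>_. {- int D..int D})"
  let ?m = "\<lambda>e x. \<Prod>v\<in>V. x v powi e v :: 'k"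
  obtain a b where a: "\<And>x. x \<in> units_on V \<Longrightarrow> F x = (\<Sum>e\<in>?E D. a e * ?m e x)"
    and b: "\<And>x. x \<in> units_on V \<Longrightarrow> G x = (\<Sum>e\<in>?E D'. b e * ?m e x)"
    using F G unfolding laurent_span_def by blast
  have "(\<lambda>x. \<Sum>e\<in>?E D. a e * (\<Sum>e'\<in>?E D'. b e' * ?m (\<lambda>v. e v + e' v) x)) \<in> laurent_span V (D + D')"
  proof (intro laurent_span_sum laurent_span_cmult laurent_span_mono V)
    fix e e' v assume "e \<in> ?E D" "e' \<in> ?E D'" "v \<in> V"
    then have "e v \<in> {- int D..int D}" "e' v \<in> {- int D'..int D'}" by (auto dest: PiE_mem)
    then show "\<bar>e v + e' v\<bar> \<le> int (D + D')" by auto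
  qed
  then show ?thesis
  proof (rule laurent_span_cong)
    fix x :: "'v \<Rightarrow> 'k" assume x: "x \<in> units_on V"
    have "?m (\<lambda>v. e v + e' v) x = ?m e x * ?m e' x" for e e'
      unfolding prod.distrib[symmetric]
      using x by (intro prod.cong) (auto simp: units_on_def power_int_add)
    then show "F x * G x = (\<Sum>e\<in>?E D. a e * (\<Sum>e'\<in>?E D'. b e' * ?m (\<lambda>v. e v + e' v) x))"
      unfolding a[OF x] b[OF x] sum_distrib_right
      by (intro sum.cong) (simp_all add: sum_distrib_left mult_ac)
  qed
qed

lemma laurent_span_le:
  assumes "finite V" "F \<in> laurent_span V D" "D \<le> D'"
  shows "F \<in> laurent_span V D'"
proof -
  have "(\<lambda>x. \<Prod>v\<in>V. x v powi (\<lambda>_. 0) v) \<in> laurent_span V (D' - D)"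
    by (rule laurent_span_mono[OF assms(1)]) auto
  from laurent_span_mult[OF assms(1,2) this] show ?thesis using assms(3) by simp
qed

lemma lfun_laurent_span:
  fixes F :: "('v \<Rightarrow> 'k::field) \<Rightarrow> 'k"
  assumes V: "finite V" and F: "F \<in> lfun V V"
  shows "\<exists>D. F \<in> laurent_span V D"
  using F
proof (induction rule: lfun.induct)
  case (const a)
  have "(\<lambda>x. a * (\<Prod>v\<in>V. x v powi (\<lambda>_. 0) v)) \<in> laurent_span V 0"
    by (intro laurent_span_cmult laurent_span_mono V) auto
  then show ?case by auto
next
  case (var v)
  have "(\<lambda>x :: 'v \<Rightarrow> 'k. \<Prod>u\<in>V. x u powi (if u = v then 1 else 0)) \<in> laurent_span V 1"
    by (intro laurent_span_mono V) auto
  also have "(\<lambda>x :: 'v \<Rightarrow> 'k. \<Prod>u\<in>V. x u powi (if u = v then 1 else 0)) = (\<lambda>x. x v)"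
  proof
    fix x :: "'v \<Rightarrow> 'k"
    have "(\<Prod>u\<in>V. x u powi (if u = v then 1 else 0)) = (\<Prod>u\<in>V. if u = v then x u else 1)"
      by (intro prod.cong) auto
    then show "(\<Prod>u\<in>V. x u powi (if u = v then 1 else 0)) = x v" using V var by simp
  qed
  finally show ?case by blast
next
  case (inv v)
  have "(\<lambda>x :: 'v \<Rightarrow> 'k. \<Prod>u\<in>V. x u powi (if u = v then -1 else 0)) \<in> laurent_span V 1"
    by (intro laurent_span_mono V) auto
  also have "(\<lambda>x :: 'v \<Rightarrow> 'k. \<Prod>u\<in>V. x u powi (if u = v then -1 else 0)) = (\<lambda>x. inverse (x v))"
  proof
    fix x :: "'v \<Rightarrow> 'k"
    have "(\<Prod>u\<in>V. x u powi (if u = v then -1 else 0)) = (\<Prod>u\<in>V. if u = v then inverse (x u) else 1)"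
      by (intro prod.cong) auto
    then show "(\<Prod>u\<in>V. x u powi (if u = v then -1 else 0)) = inverse (x v)" using V inv by simp
  qed
  finally show ?case by blast
next
  case (add F G)
  then obtain D D' where "F \<in> laurent_span V D" "G \<in> laurent_span V D'" by blast
  then have "F \<in> laurent_span V (D + D')" "G \<in> laurent_span V (D + D')"
    using laurent_span_le[OF V] by (meson le_add1 le_add2)+
  then show ?case using laurent_span_add by blast
next
  case (mult F G)
  then show ?case using laurent_span_mult[OF V] by blast
qed

lemma laurent_span_power:
  assumes V: "finite V" and "F \<in> laurent_span V D"
  shows "(\<lambda>x. F x ^ n) \<in> laurent_span V (n * D)"
proof (induction n)
  case 0
  have "(\<lambda>x. \<Prod>v\<in>V. x v powi (\<lambda>_. 0) v) \<in> laurent_span V 0"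
    by (intro laurent_span_mono V) auto
  then show ?case by simp
qed (use assms in \<open>auto intro: laurent_span_mult\<close>)

lemma laurent_span_prod:
  assumes V: "finite V" and "finite I" "\<And>i. i \<in> I \<Longrightarrow> F i \<in> laurent_span V D"
  shows "(\<lambda>x. \<Prod>i\<in>I. F i x) \<in> laurent_span V (card I * D)"
  using assms(2,3)
proof (induction I rule: finite_induct)
  case empty
  have "(\<lambda>x. \<Prod>v\<in>V. x v powi (\<lambda>_. 0) v) \<in> laurent_span V 0"
    by (intro laurent_span_mono V) auto
  then show ?case by simp
qed (use V in \<open>auto intro: laurent_span_mult\<close>)

text \<open>
  There are \<open>(E + 1) ^ (card V + 1)\<close> monomials with exponents at most \<open>E\<close> in the \<open>F i\<close>, and they
  lie in a space whose dimension grows only like \<open>E ^ card V\<close>.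
\<close>

theorem lfun_algebraically_dependent:
  fixes F :: "'i \<Rightarrow> ('v \<Rightarrow> 'k::field) \<Rightarrow> 'k"
  assumes inf: "infinite (UNIV :: 'k set)" and V: "finite V" and T: "T \<subseteq> V"
    and I: "finite I" "card I = card V + 1" and F: "\<And>i. i \<in> I \<Longrightarrow> F i \<in> lfun V T"
  shows "\<exists>P\<in>lfun I {}. (\<exists>x. P x \<noteq> 0) \<and> (\<forall>p\<in>units_on T. P (\<lambda>i. F i p) = 0)"
proof -
  have "\<forall>i\<in>I. \<exists>D. F i \<in> laurent_span V D"
    using F lfun_mono[OF _ _ T] lfun_laurent_span[OF V] by blast
  then obtain Df where Df: "\<And>i. i \<in> I \<Longrightarrow> F i \<in> laurent_span V (Df i)" by metis
  define D where "D = (\<Sum>i\<in>I. Df i)"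
  have FD: "F i \<in> laurent_span V D" if "i \<in> I" for i
    using Df[OF that] I(1) that member_le_sum[of i I Df] unfolding D_def
    by (intro laurent_span_le[OF V Df[OF that]]) auto
  define k where "k = card V"
  \<comment> \<open>The constants are made for \<open>(2 N + 1) ^ k < (E + 1) ^ (k + 1)\<close>.
    With this \<open>c\<close> one has \<open>2 N + 1 \<le> c (E + 1)\<close>, which leaves
    \<open>c ^ k < E + 1\<close>, and \<open>E = c ^ k\<close> is the least choice.\<close>
  define c where "c = 2 * (card I * D) + 1"
  define E where "E = c ^ k"
  define N where "N = card I * (E * D)"
  let ?J = "PiE I (\<lambda>_. {..E})" and ?R = "PiE V (\<lambda>_. {- int N..int N})"
  have mon: "(\<lambda>x. \<Prod>i\<in>I. F i x ^ e i) \<in> laurent_span V N" if "e \<in> ?J" for e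
    unfolding N_def
  proof (rule laurent_span_prod[OF V I(1)])
    fix i assume i: "i \<in> I"
    then have "e i * D \<le> E * D" using that by (auto dest: PiE_mem)
    then show "(\<lambda>x. F i x ^ e i) \<in> laurent_span V (E * D)"
      using laurent_span_power[OF V FD[OF i]] laurent_span_le[OF V] by blast
  qed
  have "\<exists>a. \<forall>e\<in>?J. \<forall>x\<in>units_on V.
     (\<Prod>i\<in>I. F i x ^ e i) = (\<Sum>r\<in>?R. a e r * (\<Prod>v\<in>V. x v powi r v))"
  proof (rule bchoice, rule ballI)
    fix e assume "e \<in> ?J"
    from mon[OF this] show "\<exists>a. \<forall>x\<in>units_on V.
      (\<Prod>i\<in>I. F i x ^ e i) = (\<Sum>r\<in>?R. a r * (\<Prod>v\<in>V. x v powi r v))"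
      unfolding laurent_span_def by auto
  qed
  then obtain a where a: "\<And>e x. e \<in> ?J \<Longrightarrow> x \<in> units_on V \<Longrightarrow>
     (\<Prod>i\<in>I. F i x ^ e i) = (\<Sum>r\<in>?R. a e r * (\<Prod>v\<in>V. x v powi r v))" by blast
  have "card ?R = (2 * N + 1) ^ k"
    using V by (simp add: card_PiE k_def nat_add_distrib nat_mult_distrib)
  also have "\<dots> \<le> (c * (E + 1)) ^ k"
    by (intro power_mono) (auto simp: N_def c_def algebra_simps)
  also have "\<dots> = c ^ k * (E + 1) ^ k" by (rule power_mult_distrib)
  also have "\<dots> < (E + 1) * (E + 1) ^ k" by (simp add: E_def)
  also have "\<dots> = card ?J" using I by (simp add: card_PiE k_def)
  finally have "\<exists>b. (\<exists>e\<in>?J. b e \<noteq> 0) \<and> (\<forall>r\<in>?R. (\<Sum>e\<in>?J. b e * a e r) = 0)"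
    using V I(1) by (intro underdetermined_system) (auto intro: finite_PiE)
  then obtain b where b: "\<exists>e\<in>?J. b e \<noteq> 0" "\<And>r. r \<in> ?R \<Longrightarrow> (\<Sum>e\<in>?J. b e * a e r) = 0" by blast
  define P where "P x = (\<Sum>e\<in>?J. b e * (\<Prod>i\<in>I. x i ^ e i))" for x
  have P: "P \<in> lfun I {}" unfolding P_def by (intro lfun_intros)
  have "\<exists>x. P x \<noteq> 0"
  proof (rule ccontr)
    assume "\<nexists>x. P x \<noteq> 0"
    moreover have "finite ?J" using I(1) by (intro finite_PiE) auto
    moreover have "inj_on (\<lambda>m. restrict m I) ?J" by (intro inj_onI) (metis PiE_restrict)
    ultimately have "\<forall>e\<in>?J. b e = 0" unfolding P_def
      by (intro monomials_independent[OF inf I(1)]) auto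
    then show False using b(1) by blast
  qed
  moreover have zero: "P (\<lambda>i. F i p) = 0" if p: "p \<in> units_on V" for p
  proof -
    have "P (\<lambda>i. F i p) = (\<Sum>e\<in>?J. \<Sum>r\<in>?R. b e * a e r * (\<Prod>v\<in>V. p v powi r v))"
      unfolding P_def by (intro sum.cong) (auto simp: a[OF _ p] sum_distrib_left algebra_simps)
    also have "\<dots> = (\<Sum>r\<in>?R. (\<Sum>e\<in>?J. b e * a e r) * (\<Prod>v\<in>V. p v powi r v))"
      by (subst sum.swap) (simp add: sum_distrib_right)
    also have "\<dots> = 0" using b(2) by simp
    finally show ?thesis .
  qed
  \<comment> \<open>The count works where all variables are invertible. Multiplying by the product
    of the variables and cancelling this nonzero factor passes to \<open>units_on T\<close>.\<close>
  moreover have "\<forall>p\<in>units_on T. P (\<lambda>i. F i p) = 0"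
  proof -
    have "(\<forall>p\<in>units_on T. P (\<lambda>i. F i p) = 0) \<or> (\<forall>p\<in>units_on T. (\<Prod>v\<in>V. p v :: 'k) = 0)"
    proof (rule lfun_prod_eq_0[OF inf])
      show "finite T" using T V finite_subset by blast
      show "(\<lambda>p. P (\<lambda>i. F i p)) \<in> lfun V T" by (rule lfun_subst[OF P F])
      show "(\<lambda>p. \<Prod>v\<in>V. p v) \<in> lfun V T" by (intro lfun_intros)
      show "P (\<lambda>i. F i p) * (\<Prod>v\<in>V. p v) = 0" for p
        using zero[of p] V by (auto simp: units_on_def)
    qed
    moreover have "(\<lambda>_. 1) \<in> units_on T" "(\<Prod>v\<in>V. (\<lambda>_. 1 :: 'k) v) \<noteq> 0"
      by (auto simp: units_on_def)
    ultimately show ?thesis by blast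
  qed
  ultimately show ?thesis using P by blast
qed


section \<open>Polynomials and polynomial functions\<close>

definition mmon :: "('v \<Rightarrow>\<^sub>0 nat) \<Rightarrow> ('v \<Rightarrow> 'a::comm_semiring_1) \<Rightarrow> 'a" where
  "mmon m x = (\<Prod>v\<in>Poly_Mapping.keys m. x v ^ Poly_Mapping.lookup m v)"

lemma mmon_superset:
  "finite A \<Longrightarrow> Poly_Mapping.keys m \<subseteq> A \<Longrightarrow> mmon m x = (\<Prod>v\<in>A. x v ^ Poly_Mapping.lookup m v)"
  unfolding mmon_def by (intro prod.mono_neutral_left) (auto simp: in_keys_iff)

lemma mmon_add: "mmon (m + m') x = mmon m x * mmon m' x"
proof -
  let ?A = "Poly_Mapping.keys m \<union> Poly_Mapping.keys m'"
  have "Poly_Mapping.keys (m + m') \<subseteq> ?A" by (rule keys_add)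
  then show ?thesis
    by (simp add: mmon_superset[of ?A] lookup_add power_add prod.distrib)
qed

lemma mmon_single: "mmon (Poly_Mapping.single v n) x = x v ^ n"
  by (simp add: mmon_superset[of "{v}"])

lemma meval_superset:
  "finite A \<Longrightarrow> Poly_Mapping.keys g \<subseteq> A \<Longrightarrow>
    meval g x = (\<Sum>m\<in>A. Poly_Mapping.lookup g m * mmon m x)"
  unfolding meval_def mmon_def by (intro sum.mono_neutral_left) (auto simp: in_keys_iff)

lemma meval_0: "meval 0 x = 0"
  by (simp add: meval_def)

lemma meval_add: "meval (g + h) x = meval g x + meval h x"
proof -
  let ?A = "Poly_Mapping.keys g \<union> Poly_Mapping.keys h"
  have "Poly_Mapping.keys (g + h) \<subseteq> ?A" by (rule keys_add)
  then show ?thesis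
    by (simp add: meval_superset[of ?A] lookup_add distrib_right sum.distrib)
qed

lemma meval_sum: "meval (\<Sum>i\<in>I. g i) x = (\<Sum>i\<in>I. meval (g i) x)"
  by (induction I rule: infinite_finite_induct) (simp_all add: meval_0 meval_add)

lemma meval_single: "meval (Poly_Mapping.single m a) x = a * mmon m x"
  by (simp add: meval_superset[of "{m}"])

lemma mvars_add: "mvars (g + h) \<subseteq> mvars g \<union> mvars h"
  using keys_add[of g h] unfolding mvars_def by blast

lemma mvars_sum: "(\<And>i. i \<in> I \<Longrightarrow> mvars (g i) \<subseteq> V) \<Longrightarrow> mvars (\<Sum>i\<in>I. g i) \<subseteq> V"
proof (induction I rule: infinite_finite_induct)
  case (insert i I)
  then show ?case using mvars_add[of "g i" "sum g I"] by auto
qed (simp_all add: mvars_def)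

lemma mvars_single: "mvars (Poly_Mapping.single m a) \<subseteq> Poly_Mapping.keys m"
  by (auto simp: mvars_def)

lemma keys_mvars: "m \<in> Poly_Mapping.keys g \<Longrightarrow> Poly_Mapping.keys m \<subseteq> mvars g"
  by (auto simp: mvars_def)

lemma meval_lfun: "mvars g \<subseteq> V \<Longrightarrow> (\<lambda>x. meval g x) \<in> lfun V {}"
  unfolding meval_def mvars_def by (intro lfun_sum lfun_cmult lfun_prod lfun_power lfun.var) auto

lemma lfun_meval: "F \<in> lfun V {} \<Longrightarrow> \<exists>g. mvars g \<subseteq> V \<and> (\<forall>x. F x = meval g x)"
proof (induction rule: lfun.induct)
  case (const a)
  show ?case by (intro exI[of _ "Poly_Mapping.single 0 a"]) (auto simp: meval_single mmon_def mvars_def)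
next
  case (var v)
  then show ?case by (intro exI[of _ "Poly_Mapping.single (Poly_Mapping.single v 1) 1"])
      (auto simp: meval_single mmon_single mvars_def)
next
  case (add F G)
  then obtain g h where "mvars g \<subseteq> V" "\<forall>x. F x = meval g x" "mvars h \<subseteq> V" "\<forall>x. G x = meval h x"
    by blast
  then show ?case using mvars_add[of g h] by (intro exI[of _ "g + h"]) (auto simp: meval_add)
next
  case (mult F G)
  then obtain g h where gh: "mvars g \<subseteq> V" "\<And>x. F x = meval g x" "mvars h \<subseteq> V" "\<And>x. G x = meval h x"
    by blast
  define k where "k = (\<Sum>m\<in>Poly_Mapping.keys g. \<Sum>m'\<in>Poly_Mapping.keys h.
    Poly_Mapping.single (m + m') (Poly_Mapping.lookup g m * Poly_Mapping.lookup h m'))"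
  have "mvars k \<subseteq> V"
    unfolding k_def
  proof (intro mvars_sum)
    fix m m' assume "m \<in> Poly_Mapping.keys g" "m' \<in> Poly_Mapping.keys h"
    then have "Poly_Mapping.keys m \<subseteq> V" "Poly_Mapping.keys m' \<subseteq> V"
      using keys_mvars gh(1,3) by (meson order_trans)+
    then have "Poly_Mapping.keys (m + m') \<subseteq> V"
      using keys_add[of m m'] by (meson Un_least order_trans)
    then show "mvars (Poly_Mapping.single (m + m')
        (Poly_Mapping.lookup g m * Poly_Mapping.lookup h m')) \<subseteq> V"
      using mvars_single by (rule order_trans[rotated])
  qed
  moreover have "F x * G x = meval k x" for x
    unfolding k_def gh meval_sum meval_single mmon_add
    by (simp add: meval_superset[OF finite_keys order_refl] sum_product mult_ac)
  ultimately show ?case by blast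
qed simp

text \<open>The formal ideal is traded for polynomial functions, which compose with parametrisations
  and multiply pointwise.\<close>

lemma zariski_closure_iff:
  "x \<in> zariski_closure S X \<longleftrightarrow>
    x \<in> coord_space S \<and> (\<forall>F\<in>lfun S {}. (\<forall>y\<in>X. F y = 0) \<longrightarrow> F x = 0)"
proof -
  have "(\<forall>g\<in>vanishing_ideal S X. meval g x = 0) \<longleftrightarrow>
    (\<forall>F\<in>lfun S {}. (\<forall>y\<in>X. F y = 0) \<longrightarrow> F x = 0)" (is "?l \<longleftrightarrow> ?r")
  proof
    assume ?l
    show ?r
    proof (intro ballI impI)
      fix F :: "('a \<Rightarrow> 'b) \<Rightarrow> 'b" assume F: "F \<in> lfun S {}" and F0: "\<forall>y\<in>X. F y = 0"
      obtain g where g: "mvars g \<subseteq> S" "\<And>x. F x = meval g x" using lfun_meval[OF F] by metis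
      then have "g \<in> vanishing_ideal S X" using F0 by (simp add: vanishing_ideal_def)
      then show "F x = 0" using \<open>?l\<close> g(2) by simp
    qed
  next
    assume ?r
    show ?l
    proof
      fix g assume "g \<in> vanishing_ideal S X"
      then have "mvars g \<subseteq> S" "\<forall>y\<in>X. meval g y = 0" by (auto simp: vanishing_ideal_def)
      then show "meval g x = 0" using \<open>?r\<close> meval_lfun[of g S] by (simp add: Ball_def)
    qed
  qed
  then show ?thesis by (simp add: zariski_closure_def)
qed

lemma zariski_closureD:
  "x \<in> zariski_closure S X \<Longrightarrow> F \<in> lfun S {} \<Longrightarrow> (\<And>y. y \<in> X \<Longrightarrow> F y = 0) \<Longrightarrow> F x = 0"
  unfolding zariski_closure_iff by blast

lemma zariski_closure_eqI:
  assumes "\<And>F. F \<in> lfun S {} \<Longrightarrow> (\<forall>y\<in>X. F y = 0) \<longleftrightarrow> (\<forall>y\<in>Y. F y = 0)"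
  shows "zariski_closure S X = zariski_closure S Y"
  using assms by (auto simp: zariski_closure_iff)

lemma zariski_closure_superset: "X \<subseteq> coord_space S \<Longrightarrow> X \<subseteq> zariski_closure S X"
  by (auto simp: zariski_closure_iff)

lemma meval_mpartial_superset:
  assumes "finite A" "Poly_Mapping.keys g \<subseteq> A"
  shows "meval (mpartial s g) x = (\<Sum>m\<in>A. of_nat (Poly_Mapping.lookup m s) *
    Poly_Mapping.lookup g m * mmon (m - Poly_Mapping.single s 1) x)"
  unfolding mpartial_def meval_sum meval_single
  by (intro sum.mono_neutral_left assms) (auto simp: in_keys_iff)

text \<open>The factor \<open>x s\<close> undoes the truncated subtraction of exponents in
  \<open>mpartial\<close>; where the exponent is 0 and truncation occurs, the coefficient is 0 as
  well.\<close>

lemma meval_mpartial_times: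
  "meval (mpartial s g) x * x s = (\<Sum>m\<in>Poly_Mapping.keys g. of_nat (Poly_Mapping.lookup m s) *
    Poly_Mapping.lookup g m * mmon m x)"
proof -
  have *: "mmon (m - Poly_Mapping.single s 1) x * x s = mmon m x"
    if "Poly_Mapping.lookup m s \<noteq> 0" for m
  proof -
    have "m = (m - Poly_Mapping.single s 1) + Poly_Mapping.single s 1"
      using that by (intro poly_mapping_eqI) (auto simp: lookup_add lookup_minus lookup_single when_def)
    then show ?thesis by (metis mmon_add mmon_single power_one_right)
  qed
  then show ?thesis
    unfolding meval_mpartial_superset[OF finite_keys order_refl] sum_distrib_right
  proof (intro sum.cong refl)
    fix m
    show "of_nat (Poly_Mapping.lookup m s) * Poly_Mapping.lookup g m *
        mmon (m - Poly_Mapping.single s 1) x * x s =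
      of_nat (Poly_Mapping.lookup m s) * Poly_Mapping.lookup g m * mmon m x"
      by (cases "Poly_Mapping.lookup m s = 0") (simp_all only: * mult.assoc of_nat_0 mult_zero_left not_False_eq_True)
  qed
qed

lemma mvars_mpartial: "mvars g \<subseteq> V \<Longrightarrow> mvars (mpartial s g) \<subseteq> V"
  unfolding mpartial_def
proof (intro mvars_sum)
  fix m assume "mvars g \<subseteq> V" "m \<in> Poly_Mapping.keys g"
  moreover have "Poly_Mapping.keys (m - Poly_Mapping.single s 1) \<subseteq> Poly_Mapping.keys m"
    by (auto simp: in_keys_iff lookup_minus)
  ultimately have "Poly_Mapping.keys (m - Poly_Mapping.single s 1) \<subseteq> V"
    using keys_mvars[of m g] by (meson order_trans)
  then show "mvars (Poly_Mapping.single (m - Poly_Mapping.single s 1)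
      (of_nat (Poly_Mapping.lookup m s) * Poly_Mapping.lookup g m)) \<subseteq> V"
    using mvars_single by (rule order_trans[rotated])
qed

lemma mpartial_lfun: "mvars g \<subseteq> V \<Longrightarrow> (\<lambda>x. meval (mpartial s g) x) \<in> lfun V {}"
  by (rule meval_lfun[OF mvars_mpartial])

lemma lookup_scaled:
  fixes g :: "('v, 'k::field) mpoly"
  shows "Poly_Mapping.lookup (Poly_Mapping.map ((*) a) g) m = a * Poly_Mapping.lookup g m"
  by (simp add: map.rep_eq when_def)

lemma lin_comb_meval:
  fixes g h :: "('v, 'k::field) mpoly" and a :: 'k
  defines "k \<equiv> g + Poly_Mapping.map ((*) a) h"
  shows "meval k x = meval g x + a * meval h x"
    and "meval (mpartial s k) x = meval (mpartial s g) x + a * meval (mpartial s h) x"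
    and "mvars k \<subseteq> mvars g \<union> mvars h"
proof -
  let ?A = "Poly_Mapping.keys g \<union> Poly_Mapping.keys h"
  have A: "finite ?A" by simp
  have kA: "Poly_Mapping.keys k \<subseteq> ?A"
    by (auto simp: k_def in_keys_iff lookup_add lookup_scaled)
  show "meval k x = meval g x + a * meval h x"
    unfolding meval_superset[OF A kA] meval_superset[OF A, of g, simplified]
      meval_superset[OF A, of h, simplified]
    by (simp add: k_def lookup_add lookup_scaled sum.distrib sum_distrib_left algebra_simps)
  show "meval (mpartial s k) x = meval (mpartial s g) x + a * meval (mpartial s h) x"
    unfolding meval_mpartial_superset[OF A kA] meval_mpartial_superset[OF A, of g, simplified]
      meval_mpartial_superset[OF A, of h, simplified]
    by (simp add: k_def lookup_add lookup_scaled sum.distrib sum_distrib_left algebra_simps)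
  show "mvars k \<subseteq> mvars g \<union> mvars h" using kA by (auto simp: mvars_def)
qed

text \<open>Multiplication by the \<open>N\<close>-th power of \<open>u\<close> clears negative
  exponents. The resulting polynomial has infinitely many zeros, so it is 0 together with its
  derivative at 1. The shift contributes \<open>N\<close> times its value at 1, which is also 0. The
  argument is valid in every characteristic.\<close>

lemma laurent_relation_derivative:
  fixes a :: "'m \<Rightarrow> 'k::field"
  assumes inf: "infinite (UNIV :: 'k set)" and A: "finite A"
    and z: "\<And>u. u \<noteq> 0 \<Longrightarrow> (\<Sum>m\<in>A. a m * u powi k m) = 0"
  shows "(\<Sum>m\<in>A. a m * of_int (k m)) = 0"
proof -
  define N where "N = (\<Sum>m\<in>A. \<bar>k m\<bar>)"
  have kN: "k m + N \<ge> 0" if "m \<in> A" for m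
    using member_le_sum[of m A "\<lambda>m. \<bar>k m\<bar>"] that A unfolding N_def by fastforce
  define p where "p = (\<Sum>m\<in>A. monom (a m) (nat (k m + N)))"
  have "poly p u = 0" if "u \<noteq> 0" for u
  proof -
    have "poly p u = (\<Sum>m\<in>A. a m * u powi (k m + N))"
      unfolding p_def poly_sum poly_monom using kN
      by (intro sum.cong) (auto simp: power_int_def)
    also have "\<dots> = (\<Sum>m\<in>A. a m * u powi k m) * u powi N"
      using that by (simp add: power_int_add sum_distrib_right mult.assoc)
    finally show ?thesis using z[OF that] by simp
  qed
  then have "UNIV - {0} \<subseteq> {u. poly p u = 0}" by auto
  moreover have "infinite (UNIV - {0 :: 'k})" using inf by simp
  ultimately have "p = 0" using poly_roots_finite finite_subset by blast
  have "poly p 1 = (\<Sum>m\<in>A. a m)" by (simp add: p_def poly_sum poly_monom)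
  moreover have "poly (pderiv p) 1 = (\<Sum>m\<in>A. a m * (of_int (k m) + of_int N))"
  proof -
    have "poly (pderiv p) 1 = (\<Sum>m\<in>A. of_nat (nat (k m + N)) * a m)"
      by (simp add: p_def higher_pderiv_sum[of 1, simplified] pderiv_monom poly_sum poly_monom)
    also have "\<dots> = (\<Sum>m\<in>A. a m * (of_int (k m) + of_int N))"
    proof (intro sum.cong refl)
      fix m assume "m \<in> A"
      have "(of_nat (nat (k m + N)) :: 'k) = of_int (int (nat (k m + N)))" by simp
      also have "\<dots> = of_int (k m) + of_int N" using kN[OF \<open>m \<in> A\<close>] by simp
      finally show "of_nat (nat (k m + N)) * a m = a m * (of_int (k m) + of_int N)" by simp
    qed
    finally show ?thesis .
  qed
  ultimately show ?thesis using \<open>p = 0\<close>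
    by (simp add: algebra_simps sum.distrib sum_distrib_left[symmetric])
qed

section \<open>Dimension of spaces of functions\<close>

interpretation fv: vector_space "\<lambda>(r :: 'k::field) v s. r * v s"
  by unfold_locales (auto simp: fun_eq_iff algebra_simps)

lemma fun_dim_eq: "fun_dim = fv.dim"
  by (simp add: fun_dim_def)

lemma fun_sum_apply: "(\<Sum>i\<in>I. f i) s = (\<Sum>i\<in>I. f i s)" for f :: "'i \<Rightarrow> 's \<Rightarrow> 'k::field"
  by (induction I rule: infinite_finite_induct) auto

lemma coord_space_span:
  fixes S :: "'s set"
  assumes "finite S"
  shows "(coord_space S :: ('s \<Rightarrow> 'k::field) set) \<subseteq> fv.span ((\<lambda>s i. if i = s then 1 else 0) ` S)"
proof
  fix v :: "'s \<Rightarrow> 'k" assume v: "v \<in> coord_space S"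
  have "v = (\<Sum>s\<in>S. (\<lambda>i. v s * (if i = s then 1 else 0)))"
  proof
    fix i
    have "(\<Sum>s\<in>S. v s * (if i = s then 1 else 0)) = (\<Sum>s\<in>S. if s = i then v s else 0)"
      by (intro sum.cong) auto
    then show "v i = (\<Sum>s\<in>S. (\<lambda>i. v s * (if i = s then 1 else 0))) i"
      using v assms by (auto simp: fun_sum_apply coord_space_def)
  qed
  also have "\<dots> \<in> fv.span ((\<lambda>s i. if i = s then 1 else 0) ` S)"
    by (intro fv.span_sum fv.span_scale fv.span_base) auto
  finally show "v \<in> fv.span ((\<lambda>s i. if i = s then 1 else 0) ` S)" .
qed

lemma fun_dim_ge:
  fixes v :: "'s \<Rightarrow> 's \<Rightarrow> 'k::field"
  assumes S: "finite S" and W: "W \<subseteq> coord_space S" and I: "finite I"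
    and v: "\<And>i. i \<in> I \<Longrightarrow> v i \<in> W" "\<And>i j. i \<in> I \<Longrightarrow> j \<in> I \<Longrightarrow> v i j = (if j = i then 1 else 0)"
  shows "card I \<le> fun_dim W"
proof -
  have inj: "inj_on v I"
    by (rule inj_onI) (metis v(2) one_neq_zero)
  have ind: "fv.independent (v ` I)"
  proof (rule fv.independent_if_scalars_zero)
    fix f x assume z: "(\<Sum>x\<in>v ` I. (\<lambda>s. f x * x s)) = 0" and "x \<in> v ` I"
    then obtain i where i: "i \<in> I" "x = v i" by blast
    have "0 = (\<Sum>x\<in>v ` I. (\<lambda>s. f x * x s)) i" using z by simp
    also have "\<dots> = (\<Sum>j\<in>I. f (v j) * v j i)" using inj by (simp add: fun_sum_apply sum.reindex)
    also have "\<dots> = (\<Sum>j\<in>I. if j = i then f (v j) else 0)" using v(2) i by (intro sum.cong) auto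
    also have "\<dots> = f x" using i I by simp
    finally show "f x = 0" by simp
  qed (use I in auto)
  obtain B where B: "v ` I \<subseteq> B" "B \<subseteq> W" "fv.independent B" "W \<subseteq> fv.span B"
    using fv.maximal_independent_subset_extend[of "v ` I" W] v(1) ind by blast
  \<comment> \<open>For an infinite \<open>B\<close> the cardinality would be the default value 0
    and the comparison with \<open>card I\<close> would fail.\<close>
  have "finite B"
    using fv.independent_span_bound[OF finite_imageI[OF S] B(3)]
      coord_space_span[OF S, where 'k = 'k] B(2) W by (meson order_trans)
  then have "card (v ` I) \<le> card B" using B(1) card_mono by blast
  then show ?thesis using card_image[OF inj] fv.basis_card_eq_dim[OF B(2,4,3)]
    by (simp add: fun_dim_eq)
qed

section \<open>Toric varieties of matrices of full rank over the ground field\<close>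

lemma laurent_monomial_nonzero: "t \<in> torus \<Longrightarrow> laurent_monomial t a \<noteq> 0"
  by (auto simp: torus_def laurent_monomial_def)

lemma laurent_monomial_add:
  "t \<in> torus \<Longrightarrow> laurent_monomial t (a + b) = laurent_monomial t a * laurent_monomial t b"
  by (simp add: torus_def laurent_monomial_def power_int_add prod.distrib)

lemma laurent_monomial_0: "laurent_monomial t 0 = 1"
  by (simp add: laurent_monomial_def)

lemma laurent_monomial_scaled_sum:
  fixes t :: "'a::finite \<Rightarrow> 'b::field"
  assumes t: "t \<in> torus"
  shows "laurent_monomial t (\<Sum>i\<in>I. c i *s a i) = (\<Prod>i\<in>I. laurent_monomial t (a i) powi c i)"
proof (induction I rule: infinite_finite_induct)
  case (insert i I)
  have pd: "(\<Prod>j\<in>J. f j powi k) = (\<Prod>j\<in>J. f j) powi k" for f :: "'a \<Rightarrow> 'b" and J k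
    by (induction J rule: infinite_finite_induct) (simp_all add: power_int_mult_distrib)
  have "laurent_monomial t (c i *s a i) = (\<Prod>j\<in>UNIV. (t j powi (a i $ j)) powi c i)"
    unfolding laurent_monomial_def by (simp add: power_int_mult[symmetric] mult.commute)
  also have "\<dots> = laurent_monomial t (a i) powi c i"
    unfolding laurent_monomial_def by (rule pd)
  finally have "laurent_monomial t (c i *s a i) = laurent_monomial t (a i) powi c i" .
  then show ?case using insert by (simp add: laurent_monomial_add[OF t])
qed (simp_all add: laurent_monomial_0)

text \<open>
  The grading by the rows in \<open>R\<close> allows to absorb the scalar factor in \<^const>\<open>toric_cone\<close> into
  the torus.
\<close>

locale graded_toric =
  fixes K :: "'k::alg_closed_field itself"
    and S :: "'s set" and M :: "'s \<Rightarrow> int ^ 'd::finite"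
    and b :: "'d \<Rightarrow> 's" and R :: "'d set"
  assumes finite_S: "finite S" and b_S: "b q \<in> S" and inj_b: "inj b"
    and det_b: "(of_int (det (\<chi> r q. M (b q) $ r)) :: 'k) \<noteq> 0"
    and graded: "s \<in> S \<Longrightarrow> (\<Sum>r\<in>R. M s $ r) = 1"
begin

definition \<phi> :: "('d \<Rightarrow> 'k) \<Rightarrow> 's \<Rightarrow> 'k" where
  "\<phi> t s = (if s \<in> S then laurent_monomial t (M s) else 0)"

text \<open>
  \<open>crit c t\<close>: the Laurent polynomial \<open>\<Sum> c\<^sub>s t\<^bsup>M s\<^esup>\<close> is singular at \<open>t\<close>. Its logarithmic
  derivatives vanish there, and so does its value, which is the sum of those in \<open>R\<close>.
\<close>

definition crit :: "('s \<Rightarrow> 'k) \<Rightarrow> ('d \<Rightarrow> 'k) \<Rightarrow> bool" where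
  "crit c t \<longleftrightarrow> (\<forall>r. (\<Sum>s\<in>S. c s * laurent_monomial t (M s) * of_int (M s $ r)) = 0)"

definition X :: "('s \<Rightarrow> 'k) set" where "X = toric_cone S M"

lemma scale_on_R:
  assumes "s \<in> S" "t \<in> torus" "l \<noteq> 0"
  shows "laurent_monomial (\<lambda>r. if r \<in> R then l * t r else t r) (M s) = l * laurent_monomial t (M s)"
proof -
  have "laurent_monomial (\<lambda>r. if r \<in> R then l * t r else t r) (M s) =
    (\<Prod>r\<in>UNIV. (if r \<in> R then l powi (M s $ r) else 1) * t r powi (M s $ r))"
    unfolding laurent_monomial_def by (intro prod.cong) (auto simp: power_int_mult_distrib)
  also have "\<dots> = (\<Prod>r\<in>R. l powi (M s $ r)) * laurent_monomial t (M s)"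
    by (simp add: prod.distrib laurent_monomial_def prod.If_cases)
  also have "(\<Prod>r\<in>R. l powi (M s $ r)) = l powi (\<Sum>r\<in>R. M s $ r)"
    using assms(3) by (induction R rule: infinite_finite_induct) (auto simp: power_int_add)
  finally show ?thesis using graded[OF assms(1)] by simp
qed

lemma X_eq: "X = zariski_closure S (\<phi> ` torus)"
proof -
  have "{(\<lambda>s. if s \<in> S then l * laurent_monomial t (M s) else 0) | l t. l \<noteq> 0 \<and> t \<in> torus} =
     \<phi> ` torus" (is "?l = ?r")
  proof
    show "?l \<subseteq> ?r"
    proof clarify
      fix l :: 'k and t :: "'d \<Rightarrow> 'k" assume lt: "l \<noteq> 0" "t \<in> torus"
      let ?t = "\<lambda>r. if r \<in> R then l * t r else t r"
      have "?t \<in> torus" using lt by (auto simp: torus_def)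
      moreover have "(\<lambda>s. if s \<in> S then l * laurent_monomial t (M s) else 0) = \<phi> ?t"
        using scale_on_R[OF _ lt(2,1)] by (auto simp: \<phi>_def)
      ultimately show "(\<lambda>s. if s \<in> S then l * laurent_monomial t (M s) else 0) \<in> \<phi> ` torus"
        by blast
    qed
    have "\<phi> t = (\<lambda>s. if s \<in> S then 1 * laurent_monomial t (M s) else 0)" for t
      by (auto simp: \<phi>_def)
    then show "?r \<subseteq> ?l" by (auto intro!: exI[of _ "1 :: 'k"])
  qed
  then show ?thesis by (simp add: X_def toric_cone_def)
qed

lemma phi_in_X: "t \<in> torus \<Longrightarrow> \<phi> t \<in> X"
proof -
  have "\<phi> ` torus \<subseteq> coord_space S" by (auto simp: \<phi>_def coord_space_def)
  then show "t \<in> torus \<Longrightarrow> \<phi> t \<in> X"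
    using zariski_closure_superset[of "\<phi> ` torus" S] unfolding X_eq by blast
qed

section \<open>Tangent spaces at the points of the torus\<close>

lemma basis_independent:
  assumes "\<And>r. (\<Sum>q\<in>UNIV. a q * of_int (M (b q) $ r)) = (0::'k)"
  shows "a q = 0"
proof -
  let ?B = "(\<chi> r q. of_int (M (b q) $ r)) :: 'k ^ 'd ^ 'd"
  have "det ?B = of_int (det (\<chi> r q. M (b q) $ r))"
    by (simp add: det_def of_int_sum of_int_prod)
  then have "invertible ?B" using det_b by (simp add: invertible_det_nz)
  moreover have "?B *v (\<chi> q. a q) = 0"
    using assms by (simp add: matrix_vector_mult_def vec_eq_iff mult.commute)
  ultimately have "(\<chi> q. a q) = 0"
    by (metis invertible_def matrix_left_invertible_ker)
  then show ?thesis by (simp add: vec_eq_iff)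
qed

lemma dual_basis_solve: "\<exists>\<mu>. \<forall>q. (\<Sum>r\<in>UNIV. \<mu> r * of_int (M (b q) $ r)) = (w q :: 'k)"
proof -
  let ?B = "(\<chi> q r. of_int (M (b q) $ r)) :: 'k ^ 'd ^ 'd"
  have "det ?B = det (transpose ?B)" by (simp add: det_transpose)
  also have "transpose ?B = (\<chi> r q. of_int (M (b q) $ r))" by (simp add: transpose_def)
  also have "det \<dots> = of_int (det (\<chi> r q. M (b q) $ r))"
    by (simp add: det_def of_int_sum of_int_prod)
  finally have "invertible ?B" using det_b by (simp add: invertible_det_nz)
  then obtain x where "?B *v x = (\<chi> q. w q)"
    by (metis invertible_def matrix_right_invertible_surjective surjD)
  then have "(\<Sum>r\<in>UNIV. x $ r * of_int (M (b q) $ r)) = w q" for q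
    by (simp add: matrix_vector_mult_def vec_eq_iff mult.commute)
  then show ?thesis by blast
qed

text \<open>Cramer's rule over the rationals with the integer numerators \<open>c q\<close>. An
  integral relation is required because its coefficients become exponents of a binomial; the
  determinant in front can be cancelled later, being nonzero in the field.\<close>

lemma basis_relation:
  "\<exists>c. \<forall>r. det (\<chi> r q. M (b q) $ r) * M s $ r = (\<Sum>q\<in>UNIV. c q * M (b q) $ r)"
proof -
  let ?Z = "(\<chi> r q. M (b q) $ r) :: int ^ 'd ^ 'd"
  let ?B = "(\<chi> r q. of_int (M (b q) $ r)) :: rat ^ 'd ^ 'd"
  define w :: "rat ^ 'd" where "w = (\<chi> r. of_int (M s $ r))"
  have dB: "det ?B = of_int (det ?Z)" by (simp add: det_def of_int_sum of_int_prod)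
  moreover have "det ?Z \<noteq> 0" using det_b by (metis of_int_0)
  ultimately have "invertible ?B" by (simp add: invertible_det_nz)
  then obtain x where x: "?B *v x = w"
    by (metis invertible_def matrix_right_invertible_surjective surjD)
  define c where "c q = det ((\<chi> r j. if j = q then M s $ r else M (b j) $ r) :: int ^ 'd ^ 'd)" for q
  have c: "of_int (c q) = x $ q * of_int (det ?Z)" for q
  proof -
    have "of_int (c q) = det ((\<chi> r j. if j = q then (?B *v x) $ r else ?B $ r $ j) :: rat ^ 'd ^ 'd)"
      unfolding x by (simp add: c_def w_def det_def of_int_sum of_int_prod if_distrib cong: if_cong)
    then show ?thesis unfolding cramer_lemma dB .
  qed
  have "det ?Z * M s $ r = (\<Sum>q\<in>UNIV. c q * M (b q) $ r)" for r
  proof -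
    have "(of_int (det ?Z * M s $ r) :: rat) = of_int (det ?Z) * (?B *v x) $ r"
      unfolding x by (simp add: w_def)
    also have "\<dots> = of_int (\<Sum>q\<in>UNIV. c q * M (b q) $ r)"
      by (simp add: matrix_vector_mult_def c sum_distrib_left mult_ac)
    finally show ?thesis by (simp only: of_int_eq_iff)
  qed
  then show ?thesis by blast
qed

text \<open>Multiplying the coordinate \<open>r\<close> of \<open>t\<close> by \<open>u\<close>
  scales the monomial \<open>m\<close> by \<open>u\<close> to the power \<open>k m\<close>, its
  weight in the row \<open>r\<close>. As \<open>g\<close> vanishes along this curve, the derivative
  at \<open>u = 1\<close> yields the relation.\<close>

lemma euler_relation:
  assumes g: "g \<in> vanishing_ideal S X" and t: "t \<in> torus"
  shows "(\<Sum>s\<in>S. meval (mpartial s g) (\<phi> t) * \<phi> t s * of_int (M s $ r)) = 0"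
proof -
  let ?K = "Poly_Mapping.keys g"
  have gS: "mvars g \<subseteq> S" and g0: "\<And>t. t \<in> torus \<Longrightarrow> meval g (\<phi> t) = 0"
    using g phi_in_X by (auto simp: vanishing_ideal_def)
  define k where "k m = (\<Sum>s\<in>S. int (Poly_Mapping.lookup m s) * M s $ r)" for m
  have "(\<Sum>m\<in>?K. Poly_Mapping.lookup g m * mmon m (\<phi> t) * of_int (k m)) = 0"
  proof (rule laurent_relation_derivative[OF infinite_alg_closed finite_keys])
    fix u :: 'k assume u: "u \<noteq> 0"
    define t' where "t' = t(r := u * t r)"
    have t': "t' \<in> torus" using t u by (auto simp: torus_def t'_def)
    have lm: "laurent_monomial t' (M s) = u powi (M s $ r) * laurent_monomial t (M s)" for s
    proof -
      have "laurent_monomial t' (M s) =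
        (\<Prod>j\<in>UNIV. (if j = r then u powi (M s $ j) else 1) * t j powi (M s $ j))"
        unfolding laurent_monomial_def t'_def by (intro prod.cong) (auto simp: power_int_mult_distrib)
      then show ?thesis by (simp add: prod.distrib laurent_monomial_def)
    qed
    have "mmon m (\<phi> t') = u powi k m * mmon m (\<phi> t)" if m: "m \<in> ?K" for m
    proof -
      have mS: "Poly_Mapping.keys m \<subseteq> S" using keys_mvars[OF m] gS by blast
      have "mmon m (\<phi> t') = (\<Prod>s\<in>S. u powi (int (Poly_Mapping.lookup m s) * M s $ r) *
          \<phi> t s ^ Poly_Mapping.lookup m s)"
        unfolding mmon_superset[OF finite_S mS]
        by (intro prod.cong)
           (auto simp: \<phi>_def lm power_mult_distrib power_int_mult mult.commute)
      also have "\<dots> = (\<Prod>s\<in>S. u powi (int (Poly_Mapping.lookup m s) * M s $ r)) * mmon m (\<phi> t)"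
        unfolding mmon_superset[OF finite_S mS] by (rule prod.distrib)
      also have "(\<Prod>s\<in>S. u powi (int (Poly_Mapping.lookup m s) * M s $ r)) = u powi k m"
        unfolding k_def using finite_S u by (induction S rule: finite_induct) (auto simp: power_int_add)
      finally show ?thesis .
    qed
    then have "(\<Sum>m\<in>?K. Poly_Mapping.lookup g m * mmon m (\<phi> t) * u powi k m) = meval g (\<phi> t')"
      unfolding meval_superset[OF finite_keys order_refl] by (intro sum.cong) auto
    then show "(\<Sum>m\<in>?K. Poly_Mapping.lookup g m * mmon m (\<phi> t) * u powi k m) = 0"
      using g0[OF t'] by simp
  qed
  also have "(\<Sum>m\<in>?K. Poly_Mapping.lookup g m * mmon m (\<phi> t) * of_int (k m)) =
     (\<Sum>s\<in>S. \<Sum>m\<in>?K. of_nat (Poly_Mapping.lookup m s) * Poly_Mapping.lookup g m *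
        mmon m (\<phi> t) * of_int (M s $ r))"
    by (subst sum.swap) (simp add: k_def sum_distrib_left mult_ac)
  finally show ?thesis by (simp add: meval_mpartial_times sum_distrib_right)
qed

text \<open>The positive and negative parts of \<open>w\<close> are the exponents of two monomials
  that agree on the toric variety. The differential of their difference at \<open>\<phi> t\<close>,
  divided by the common nonzero value of the monomials, is the asserted linear form.\<close>

lemma binomial_relation:
  assumes t: "t \<in> torus" and v: "v \<in> tangent_space S X (\<phi> t)"
    and w: "\<And>r. (\<Sum>s\<in>S. w s * M s $ r) = 0"
  shows "(\<Sum>s\<in>S. of_int (w s) * (v s / \<phi> t s)) = 0"
proof -
  define mp mn where "mp = (\<Sum>s\<in>S. Poly_Mapping.single s (nat (w s)))"
    and "mn = (\<Sum>s\<in>S. Poly_Mapping.single s (nat (- w s)))"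
  have lp: "Poly_Mapping.lookup mp s = (if s \<in> S then nat (w s) else 0)"
    and ln: "Poly_Mapping.lookup mn s = (if s \<in> S then nat (- w s) else 0)" for s
    using finite_S by (auto simp: mp_def mn_def lookup_sum lookup_single when_def)
  have kS: "Poly_Mapping.keys mp \<subseteq> S" "Poly_Mapping.keys mn \<subseteq> S"
    by (auto simp: in_keys_iff lp ln split: if_splits)
  define g :: "('s, 'k) mpoly" where "g = Poly_Mapping.single mp 1 + Poly_Mapping.single mn (- 1)"
  have eq: "mmon mp (\<phi> t) = mmon mn (\<phi> t)" if t: "t \<in> torus" for t
  proof -
    have "mmon mp (\<phi> t) = (\<Prod>s\<in>S. laurent_monomial t (M s) powi w s) * mmon mn (\<phi> t)"
      unfolding mmon_superset[OF finite_S kS(1)] mmon_superset[OF finite_S kS(2)] prod.distrib[symmetric]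
    proof (intro prod.cong refl)
      fix s assume s: "s \<in> S"
      have "\<phi> t s \<noteq> 0" using s laurent_monomial_nonzero[OF t] by (simp add: \<phi>_def)
      then show "\<phi> t s ^ Poly_Mapping.lookup mp s =
          laurent_monomial t (M s) powi w s * \<phi> t s ^ Poly_Mapping.lookup mn s"
        using s by (cases "w s \<ge> 0") (auto simp: \<phi>_def lp ln power_int_def power_inverse)
    qed
    also have "(\<Prod>s\<in>S. laurent_monomial t (M s) powi w s) = laurent_monomial t (\<Sum>s\<in>S. w s *s M s)"
      by (rule laurent_monomial_scaled_sum[OF t, symmetric])
    also have "(\<Sum>s\<in>S. w s *s M s) = 0" using w by (simp add: vec_eq_iff)
    finally show ?thesis by (simp add: laurent_monomial_0)
  qed
  have "mvars (Poly_Mapping.single mp 1) \<subseteq> S" "mvars (Poly_Mapping.single mn (- 1 :: 'k)) \<subseteq> S"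
    using mvars_single kS by (meson order_trans)+
  then have gS: "mvars g \<subseteq> S"
    unfolding g_def using mvars_add by (meson Un_least order_trans)
  have "meval g (\<phi> t) = 0" if "t \<in> torus" for t
    by (simp add: g_def meval_add meval_single eq[OF that])
  then have "meval g x = 0" if "x \<in> X" for x
    using zariski_closureD[of x S "\<phi> ` torus" "\<lambda>x. meval g x"] that meval_lfun[OF gS]
    unfolding X_eq by blast
  then have "g \<in> vanishing_ideal S X" using gS by (simp add: vanishing_ideal_def)
  then have "(\<Sum>s\<in>S. meval (mpartial s g) (\<phi> t) * v s) = 0"
    using v by (auto simp: tangent_space_def)
  also have "(\<Sum>s\<in>S. meval (mpartial s g) (\<phi> t) * v s) =
     (\<Sum>s\<in>S. mmon mn (\<phi> t) * (of_int (w s) * (v s / \<phi> t s)))"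
  proof (intro sum.cong refl)
    fix s assume s: "s \<in> S"
    have p: "\<phi> t s \<noteq> 0" using s laurent_monomial_nonzero[OF t] by (simp add: \<phi>_def)
    have kg: "Poly_Mapping.keys g \<subseteq> {mp, mn}"
      by (auto simp: g_def in_keys_iff lookup_add lookup_single when_def split: if_splits)
    have "meval (mpartial s g) (\<phi> t) * \<phi> t s = (\<Sum>m\<in>{mp, mn}.
        of_nat (Poly_Mapping.lookup m s) * Poly_Mapping.lookup g m * mmon m (\<phi> t))"
      unfolding meval_mpartial_times using kg
      by (intro sum.mono_neutral_left) (auto simp: in_keys_iff)
    also have "\<dots> = of_int (w s) * mmon mn (\<phi> t)"
    \<comment> \<open>If the two monomials coincide, the index set collapses to one element and
      \<open>g\<close> is 0; \<open>w\<close> is then 0 on \<open>S\<close>.\<close>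
    proof (cases "mp = mn")
      case True
      then have "nat (w s) = nat (- w s)" using lp[of s] ln[of s] s by simp
      then have "w s = 0" by linarith
      then show ?thesis using True by (simp add: g_def lookup_add)
    next
      case False
      then have "(\<Sum>m\<in>{mp, mn}. of_nat (Poly_Mapping.lookup m s) * Poly_Mapping.lookup g m *
          mmon m (\<phi> t)) = (of_nat (nat (w s)) - of_nat (nat (- w s))) * mmon mn (\<phi> t)"
        using s by (simp add: g_def lookup_add lookup_single_not_eq lp ln eq[OF t] algebra_simps)
      also have "of_nat (nat (w s)) - of_nat (nat (- w s)) = (of_int (w s) :: 'k)"
        by (cases "w s \<ge> 0") auto
      finally show ?thesis .
    qed
    finally have "meval (mpartial s g) (\<phi> t) = of_int (w s) * mmon mn (\<phi> t) / \<phi> t s"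
      using p by (simp add: field_simps)
    then show "meval (mpartial s g) (\<phi> t) * v s = mmon mn (\<phi> t) * (of_int (w s) * (v s / \<phi> t s))"
      by simp
  qed
  also have "\<dots> = mmon mn (\<phi> t) * (\<Sum>s\<in>S. of_int (w s) * (v s / \<phi> t s))"
    by (simp add: sum_distrib_left)
  finally show ?thesis
    using kS laurent_monomial_nonzero[OF t] by (auto simp: mmon_def \<phi>_def)
qed

text \<open>The Euler relations make the rows of the matrix, scaled by \<open>\<phi> t\<close>,
  tangent. Conversely, \<open>\<mu>\<close> is fitted to a tangent vector on the basis columns,
  where the system is invertible, and binomials carry the formula over to every other
  column.\<close>

lemma tangent_space_torus:
  assumes t: "t \<in> torus"
  shows "tangent_space S X (\<phi> t) =
    {v \<in> coord_space S. \<exists>\<mu>. \<forall>s\<in>S. v s = \<phi> t s * (\<Sum>r\<in>UNIV. \<mu> r * of_int (M s $ r))}"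
proof (intro equalityI subsetI)
  fix v assume v: "v \<in> {v \<in> coord_space S.
    \<exists>\<mu>. \<forall>s\<in>S. v s = \<phi> t s * (\<Sum>r\<in>UNIV. \<mu> r * of_int (M s $ r))}"
  then obtain \<mu> where \<mu>: "\<And>s. s \<in> S \<Longrightarrow> v s = \<phi> t s * (\<Sum>r\<in>UNIV. \<mu> r * of_int (M s $ r))" by blast
  have "(\<Sum>s\<in>S. meval (mpartial s g) (\<phi> t) * v s) = 0" if g: "g \<in> vanishing_ideal S X" for g
  proof -
    have "(\<Sum>s\<in>S. meval (mpartial s g) (\<phi> t) * v s) = (\<Sum>s\<in>S. \<Sum>r\<in>UNIV.
        \<mu> r * (meval (mpartial s g) (\<phi> t) * \<phi> t s * of_int (M s $ r)))"
      by (intro sum.cong) (auto simp: \<mu> sum_distrib_left mult_ac)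
    also have "\<dots> = 0"
      by (subst sum.swap) (simp add: sum_distrib_left[symmetric] euler_relation[OF g t])
    finally show ?thesis .
  qed
  then show "v \<in> tangent_space S X (\<phi> t)" using v by (auto simp: tangent_space_def)
next
  fix v assume v: "v \<in> tangent_space S X (\<phi> t)"
  let ?\<delta> = "det (\<chi> r q. M (b q) $ r)"
  obtain \<mu> where \<mu>: "\<And>q. (\<Sum>r\<in>UNIV. \<mu> r * of_int (M (b q) $ r)) = v (b q) / \<phi> t (b q)"
    using dual_basis_solve[of "\<lambda>q. v (b q) / \<phi> t (b q)"] by blast
  have "v s = \<phi> t s * (\<Sum>r\<in>UNIV. \<mu> r * of_int (M s $ r))" if s: "s \<in> S" for s
  proof -
    obtain c where c: "\<And>r. ?\<delta> * M s $ r = (\<Sum>q\<in>UNIV. c q * M (b q) $ r)"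
      using basis_relation by blast
    define w where "w i = (if i = s then ?\<delta> else 0) - (\<Sum>q\<in>UNIV. if i = b q then c q else 0)" for i
    \<comment> \<open>Proved for every commutative ring: over the integers it verifies the relation
      between the columns, over the field it evaluates the conclusion of
      \<open>binomial_relation\<close>.\<close>
    have *: "(\<Sum>i\<in>S. of_int (w i) * f i) = of_int ?\<delta> * f s - (\<Sum>q\<in>UNIV. of_int (c q) * f (b q))"
      for f :: "'s \<Rightarrow> 'x::comm_ring_1"
    proof -
      have "(\<Sum>i\<in>S. of_int (w i) * f i) = (\<Sum>i\<in>S. if i = s then of_int ?\<delta> * f i else 0) -
         (\<Sum>i\<in>S. \<Sum>q\<in>UNIV. if i = b q then of_int (c q) * f i else 0)"
        unfolding w_def of_int_diff left_diff_distrib sum_subtractf of_int_sum sum_distrib_right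
        by (intro arg_cong2[of _ _ _ _ "(-)"] sum.cong) auto
      also have "(\<Sum>i\<in>S. \<Sum>q\<in>UNIV. if i = b q then of_int (c q) * f i else 0) =
        (\<Sum>q\<in>UNIV. \<Sum>i\<in>S. if i = b q then of_int (c q) * f i else 0)" by (rule sum.swap)
      finally show ?thesis using s b_S finite_S by simp
    qed
    have "(\<Sum>i\<in>S. w i * M i $ r) = 0" for r
      using *[of "\<lambda>i. M i $ r"] c by simp
    from binomial_relation[OF t v this]
    have "of_int ?\<delta> * (v s / \<phi> t s) = (\<Sum>q\<in>UNIV. of_int (c q) * (v (b q) / \<phi> t (b q)))"
      unfolding * by simp
    also have "\<dots> = (\<Sum>r\<in>UNIV. \<mu> r * (\<Sum>q\<in>UNIV. of_int (c q) * of_int (M (b q) $ r)))"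
      unfolding \<mu>[symmetric] sum_distrib_left by (subst sum.swap) (simp add: mult_ac)
    also have "\<dots> = (\<Sum>r\<in>UNIV. \<mu> r * of_int (?\<delta> * M s $ r))"
      unfolding c by simp
    also have "\<dots> = of_int ?\<delta> * (\<Sum>r\<in>UNIV. \<mu> r * of_int (M s $ r))"
      unfolding sum_distrib_left of_int_mult by (intro sum.cong refl) (simp only: mult_ac)
    finally have "v s / \<phi> t s = (\<Sum>r\<in>UNIV. \<mu> r * of_int (M s $ r))"
      by (simp only: mult_left_cancel[OF det_b])
    moreover have "\<phi> t s \<noteq> 0" using s laurent_monomial_nonzero[OF t] by (simp add: \<phi>_def)
    ultimately show ?thesis by (simp add: field_simps)
  qed
  then show "v \<in> {v \<in> coord_space S.
    \<exists>\<mu>. \<forall>s\<in>S. v s = \<phi> t s * (\<Sum>r\<in>UNIV. \<mu> r * of_int (M s $ r))}"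
    using v by (auto simp: tangent_space_def)
qed

lemma conormal_torus:
  assumes t: "t \<in> torus"
  shows "(\<forall>v\<in>tangent_space S X (\<phi> t). (\<Sum>s\<in>S. c s * v s) = 0) \<longleftrightarrow> crit c t"
proof
  assume c: "\<forall>v\<in>tangent_space S X (\<phi> t). (\<Sum>s\<in>S. c s * v s) = 0"
  show "crit c t"
    unfolding crit_def
  proof
    fix r
    let ?v = "\<lambda>s. \<phi> t s * of_int (M s $ r)"
    have "(\<Sum>j\<in>UNIV. (if j = r then 1 else 0) * of_int (M s $ j)) = (of_int (M s $ r) :: 'k)" for s
    proof -
      have "(\<Sum>j\<in>UNIV. (if j = r then 1 else 0) * of_int (M s $ j)) =
        (\<Sum>j\<in>UNIV. if j = r then of_int (M s $ j) else (0::'k))" by (intro sum.cong) auto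
      then show ?thesis by simp
    qed
    then have "?v \<in> tangent_space S X (\<phi> t)"
      unfolding tangent_space_torus[OF t]
      by (auto simp: coord_space_def \<phi>_def intro!: exI[of _ "\<lambda>j. if j = r then 1 else 0"])
    from bspec[OF c this] show "(\<Sum>s\<in>S. c s * laurent_monomial t (M s) * of_int (M s $ r)) = 0"
      by (simp add: \<phi>_def mult.assoc cong: sum.cong)
  qed
next
  assume c: "crit c t"
  show "\<forall>v\<in>tangent_space S X (\<phi> t). (\<Sum>s\<in>S. c s * v s) = 0"
  proof
    fix v assume "v \<in> tangent_space S X (\<phi> t)"
    then obtain \<mu> where "\<And>s. s \<in> S \<Longrightarrow> v s = \<phi> t s * (\<Sum>r\<in>UNIV. \<mu> r * of_int (M s $ r))"
      unfolding tangent_space_torus[OF t] by blast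
    then have "(\<Sum>s\<in>S. c s * v s) = (\<Sum>s\<in>S. \<Sum>r\<in>UNIV.
        \<mu> r * (c s * laurent_monomial t (M s) * of_int (M s $ r)))"
      by (intro sum.cong) (auto simp: \<phi>_def sum_distrib_left mult_ac)
    also have "\<dots> = 0"
      using c by (subst sum.swap) (simp add: sum_distrib_left[symmetric] crit_def)
    finally show "(\<Sum>s\<in>S. c s * v s) = 0" .
  qed
qed

text \<open>For \<open>c\<close> supported on the basis columns, the critical equations are a
  homogeneous system with an invertible matrix for the terms of the polynomial. By linearity, a
  conormal vector is determined by its entries outside the basis.\<close>

lemma crit_on_basis:
  assumes "crit c t" "t \<in> torus" "\<And>s. s \<in> S - range b \<Longrightarrow> c s = 0"
  shows "c (b q) = 0"
proof -
  have "c (b q) * laurent_monomial t (M (b q)) = 0" for q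
  proof (rule basis_independent)
    fix r
    have "(\<Sum>q\<in>UNIV. c (b q) * laurent_monomial t (M (b q)) * of_int (M (b q) $ r)) =
      (\<Sum>s\<in>range b. c s * laurent_monomial t (M s) * of_int (M s $ r))"
      using inj_b by (simp add: sum.reindex)
    also have "\<dots> = (\<Sum>s\<in>S. c s * laurent_monomial t (M s) * of_int (M s $ r))"
      using finite_S b_S assms(3) by (intro sum.mono_neutral_left) auto
    finally show "(\<Sum>q\<in>UNIV. c (b q) * laurent_monomial t (M (b q)) * of_int (M (b q) $ r)) = 0"
      using assms(1) by (simp add: crit_def)
  qed
  then show ?thesis using laurent_monomial_nonzero[OF assms(2)] by auto
qed

lemma card_S: "card S = card (S - range b) + CARD('d)"
proof -
  have "card (range b) = CARD('d)" using inj_b by (simp add: card_image)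
  moreover have "range b \<subseteq> S" using b_S by auto
  ultimately show ?thesis using finite_S card_mono[of S "range b"]
    by (metis card_Diff_subset finite_subset le_add_diff_inverse2)
qed

lemma dim_tangent_torus:
  assumes t: "t \<in> torus"
  shows "fun_dim (tangent_space S X (\<phi> t)) \<le> CARD('d)"
proof -
  define e where "e r = (\<lambda>s. \<phi> t s * of_int (M s $ r))" for r
  have "tangent_space S X (\<phi> t) \<subseteq> fv.span (range e)"
  proof
    fix v assume v: "v \<in> tangent_space S X (\<phi> t)"
    then obtain \<mu> where \<mu>: "\<And>s. s \<in> S \<Longrightarrow> v s = \<phi> t s * (\<Sum>r\<in>UNIV. \<mu> r * of_int (M s $ r))"
      unfolding tangent_space_torus[OF t] by blast
    have "v = (\<Sum>r\<in>UNIV. (\<lambda>s. \<mu> r * e r s))"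
    proof
      fix s
      show "v s = (\<Sum>r\<in>UNIV. (\<lambda>s. \<mu> r * e r s)) s"
      proof (cases "s \<in> S")
        case True
        then show ?thesis by (simp add: \<mu> fun_sum_apply e_def sum_distrib_left mult_ac)
      next
        case False
        then show ?thesis using v
          by (auto simp: tangent_space_def coord_space_def fun_sum_apply e_def \<phi>_def)
      qed
    qed
    also have "\<dots> \<in> fv.span (range e)" by (intro fv.span_sum fv.span_scale fv.span_base) auto
    finally show "v \<in> fv.span (range e)" .
  qed
  then have "fun_dim (tangent_space S X (\<phi> t)) \<le> card (range e)"
    unfolding fun_dim_eq by (intro fv.dim_le_card) auto
  also have "\<dots> \<le> CARD('d)" by (intro card_image_le) auto
  finally show ?thesis .
qed

section \<open>Conormal vectors, smooth points and the dual cone\<close>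

text \<open>The conormal space at \<open>p\<close>; by \<open>double_annihilator\<close> its
  elements account on \<open>S\<close> for everything that annihilates the tangent space.\<close>

definition differentials :: "('s \<Rightarrow> 'k) \<Rightarrow> ('s \<Rightarrow> 'k) set" where
  "differentials p = (\<lambda>g s. meval (mpartial s g) p) ` vanishing_ideal S X"

lemma lin_closed_differentials: "lin_closed (differentials p)"
  unfolding lin_closed_def
proof (intro conjI ballI allI)
  have "0 \<in> vanishing_ideal S X" by (simp add: vanishing_ideal_def mvars_def meval_0)
  moreover have "(\<lambda>s. meval (mpartial s 0) p) = (\<lambda>_. 0 :: 'k)"
    by (simp add: mpartial_def meval_0)
  ultimately show "(\<lambda>_. 0) \<in> differentials p" unfolding differentials_def
    by (intro image_eqI[where x = 0]) simp_all
  fix v w a assume "v \<in> differentials p" "w \<in> differentials p"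
  then obtain g h where gh: "g \<in> vanishing_ideal S X" "h \<in> vanishing_ideal S X"
    "v = (\<lambda>s. meval (mpartial s g) p)" "w = (\<lambda>s. meval (mpartial s h) p)"
    unfolding differentials_def by blast
  then have "g + Poly_Mapping.map ((*) a) h \<in> vanishing_ideal S X"
    using lin_comb_meval(3)[of g a h] by (auto simp: vanishing_ideal_def lin_comb_meval(1))
  then show "(\<lambda>s. v s + a * w s) \<in> differentials p"
    unfolding differentials_def gh by (intro image_eqI) (auto simp: lin_comb_meval(2))
qed

text \<open>A smaller tangent space at \<open>q\<close> would mean more than
  \<open>card S - CARD('d)\<close> differentials independent at \<open>q\<close>. Independence is an
  open condition and the torus is dense, so they would be independent at some
  \<open>\<phi> t\<close>; but conormal vectors there are determined by their entries outside the
  basis.\<close>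

lemma dim_tangent_ge:
  assumes q: "q \<in> X"
  shows "CARD('d) \<le> fun_dim (tangent_space S X q)"
proof -
  obtain J l where Jl: "J \<subseteq> S \<and> (\<forall>j\<in>J. l j \<in> differentials q) \<and>
      (\<forall>j\<in>J. \<forall>i\<in>J. l j i = (if i = j then 1 else 0)) \<and>
      (\<forall>v\<in>differentials q. \<forall>s\<in>S. v s = (\<Sum>j\<in>J. v j * l j s))"
    using echelon_basis[OF finite_S lin_closed_differentials[of q]] by (elim exE) (rule that)
  note J = Jl[THEN conjunct1] Jl[THEN conjunct2, THEN conjunct1, rule_format]
    Jl[THEN conjunct2, THEN conjunct2, THEN conjunct1, rule_format]
    Jl[THEN conjunct2, THEN conjunct2, THEN conjunct2, rule_format]
  have fJ: "finite J" using J(1) finite_S finite_subset by blast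
  have "\<forall>j\<in>J. \<exists>g\<in>vanishing_ideal S X. l j = (\<lambda>s. meval (mpartial s g) q)"
    using J(2) unfolding differentials_def by blast
  then obtain G where G: "\<And>j. j \<in> J \<Longrightarrow> G j \<in> vanishing_ideal S X"
    "\<And>j s. j \<in> J \<Longrightarrow> l j s = meval (mpartial s (G j)) q" by metis
  have "\<exists>h\<in>lfun S {}. h q \<noteq> 0 \<and> (\<forall>p a. h p \<noteq> 0 \<longrightarrow>
    (\<forall>s\<in>S. (\<Sum>j\<in>J. a j * meval (mpartial s (G j)) p) = 0) \<longrightarrow> (\<forall>j\<in>J. a j = 0))"
  proof (rule lfun_independence_open[OF fJ])
    show "(\<lambda>x. meval (mpartial s (G j)) x) \<in> lfun S {}" if "j \<in> J" for j s
      using G(1)[OF that] by (intro mpartial_lfun) (auto simp: vanishing_ideal_def)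
    fix a assume a: "\<And>s. s \<in> S \<Longrightarrow> (\<Sum>j\<in>J. a j * meval (mpartial s (G j)) q) = 0"
    show "\<forall>j\<in>J. a j = 0"
    proof
      fix i assume i: "i \<in> J"
      have "(\<Sum>j\<in>J. a j * meval (mpartial i (G j)) q) = (\<Sum>j\<in>J. if j = i then a j else 0)"
        using J(3) i by (intro sum.cong) (auto simp: G(2)[symmetric])
      then show "a i = 0" using a[of i] i J(1) fJ by auto
    qed
  qed
  then obtain h where h: "h \<in> lfun S {}" "h q \<noteq> 0" "\<And>p a. h p \<noteq> 0 \<Longrightarrow>
    (\<forall>s\<in>S. (\<Sum>j\<in>J. a j * meval (mpartial s (G j)) p) = 0) \<Longrightarrow> (\<forall>j\<in>J. a j = 0)" by blast
  then obtain t where t: "t \<in> torus" "h (\<phi> t) \<noteq> 0"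
    using zariski_closureD[of q S "\<phi> ` torus" h] q unfolding X_eq by blast
  have "card J \<le> card (S - range b)"
  proof (rule ccontr)
    assume "\<not> card J \<le> card (S - range b)"
    then obtain a where a: "\<exists>j\<in>J. a j \<noteq> 0"
      "\<And>s. s \<in> S - range b \<Longrightarrow> (\<Sum>j\<in>J. a j * meval (mpartial s (G j)) (\<phi> t)) = 0"
      using underdetermined_system[of "S - range b" J "\<lambda>j s. meval (mpartial s (G j)) (\<phi> t)"]
        finite_S fJ by auto
    define c where "c s = (\<Sum>j\<in>J. a j * meval (mpartial s (G j)) (\<phi> t))" for s
    have "crit c t"
      unfolding crit_def
    proof
      fix r
      have "(\<Sum>s\<in>S. c s * laurent_monomial t (M s) * of_int (M s $ r)) =
        (\<Sum>s\<in>S. \<Sum>j\<in>J. a j * (meval (mpartial s (G j)) (\<phi> t) * \<phi> t s * of_int (M s $ r)))"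
        by (intro sum.cong) (auto simp: c_def \<phi>_def sum_distrib_left mult_ac)
      also have "\<dots> = 0"
        by (subst sum.swap) (simp add: sum_distrib_left[symmetric] euler_relation[OF G(1) t(1)])
      finally show "(\<Sum>s\<in>S. c s * laurent_monomial t (M s) * of_int (M s $ r)) = 0" .
    qed
    from crit_on_basis[OF this t(1)] a(2) have "\<forall>s\<in>S. c s = 0" unfolding c_def by blast
    then show False using h(3)[OF t(2), of a] a(1) unfolding c_def by blast
  qed
  then have "CARD('d) \<le> card S - card J" using card_S by linarith
  also have "\<dots> = card (S - J)" using J(1) fJ by (simp add: card_Diff_subset)
  also have "\<dots> \<le> fun_dim (tangent_space S X q)"
  proof (rule fun_dim_ge[OF finite_S])
    \<comment> \<open>The solution of the echelon system whose only free variable different from 0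
      is the one at \<open>s\<close>.\<close>
    define v where "v s = (\<lambda>i. if i = s then 1 else if i \<in> J then - l i s else 0)" for s
    show "tangent_space S X q \<subseteq> coord_space S" by (auto simp: tangent_space_def)
    show "finite (S - J)" using finite_S by simp
    show "v i j = (if j = i then 1 else 0)" if "i \<in> S - J" "j \<in> S - J" for i j
      using that by (auto simp: v_def)
    show "v s \<in> tangent_space S X q" if s: "s \<in> S - J" for s
    proof -
      have "(\<Sum>i\<in>S. meval (mpartial i g) q * v s i) = 0" if g: "g \<in> vanishing_ideal S X" for g
      proof -
        let ?u = "\<lambda>i. meval (mpartial i g) q"
        have "(\<Sum>i\<in>S. ?u i * v s i) = (\<Sum>i\<in>insert s J. ?u i * v s i)"
          using finite_S s J(1) by (intro sum.mono_neutral_right) (auto simp: v_def)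
        also have "\<dots> = ?u s + (\<Sum>j\<in>J. ?u j * v s j)" using fJ s by (simp add: v_def)
        also have "(\<Sum>j\<in>J. ?u j * v s j) = (\<Sum>j\<in>J. - (?u j * l j s))"
          using s by (intro sum.cong) (auto simp: v_def)
        also have "\<dots> = - ?u s"
          using J(4)[of ?u s] g s by (simp add: differentials_def sum_negf)
        finally show ?thesis by simp
      qed
      moreover have "v s \<in> coord_space S" using s J(1) by (auto simp: v_def coord_space_def)
      ultimately show ?thesis by (simp add: tangent_space_def)
    qed
  qed
  finally show ?thesis .
qed

lemma smooth_torus: "t \<in> torus \<Longrightarrow> smooth_cone_point S X (\<phi> t)"
proof -
  assume t: "t \<in> torus"
  \<comment> \<open>Any basis column serves to show that the point is not the vertex of the
    cone.\<close>
  have "\<phi> t (b undefined) \<noteq> 0"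
    using b_S laurent_monomial_nonzero[OF t] by (simp add: \<phi>_def)
  then have "\<phi> t \<noteq> 0" by auto
  then show ?thesis unfolding smooth_cone_point_def
    using phi_in_X[OF t] dim_tangent_torus[OF t] dim_tangent_ge le_trans by blast
qed

text \<open>
  A conormal vector at an arbitrary point \<open>p\<close> is the differential at \<open>p\<close> of some \<open>g\<close> in the
  ideal of \<open>X\<close>, and the differential of the same \<open>g\<close> is conormal at all points of the torus,
  which are dense.
\<close>

lemma dual_cone_eq:
  "dual_cone S X = zariski_closure S {c \<in> coord_space S. c \<noteq> 0 \<and> (\<exists>t\<in>torus. crit c t)}"
  unfolding dual_cone_def
proof (rule zariski_closure_eqI)
  fix F :: "('s \<Rightarrow> 'k) \<Rightarrow> 'k" assume F: "F \<in> lfun S {}"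
  let ?N = "{c \<in> coord_space S. c \<noteq> 0 \<and> (\<exists>p. smooth_cone_point S X p \<and>
      (\<forall>v\<in>tangent_space S X p. (\<Sum>s\<in>S. c s * v s) = 0))}"
  let ?W = "{c \<in> coord_space S. c \<noteq> 0 \<and> (\<exists>t\<in>torus. crit c t)}"
  have "?W \<subseteq> ?N" using conormal_torus smooth_torus by fastforce
  moreover have "F c = 0" if F0: "\<forall>c\<in>?W. F c = 0" and c: "c \<in> ?N" for c
  proof -
    obtain p where p: "p \<in> X" "\<And>v. v \<in> tangent_space S X p \<Longrightarrow> (\<Sum>s\<in>S. c s * v s) = 0"
      using c unfolding smooth_cone_point_def by blast
    have "\<exists>l\<in>differentials p. \<forall>s\<in>S. c s = l s"
    proof (rule double_annihilator[OF finite_S lin_closed_differentials])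
      fix v assume "v \<in> coord_space S" "\<forall>l\<in>differentials p. (\<Sum>s\<in>S. l s * v s) = 0"
      then have "v \<in> tangent_space S X p" by (auto simp: tangent_space_def differentials_def)
      then show "(\<Sum>s\<in>S. c s * v s) = 0" by (rule p(2))
    qed
    then obtain g where g: "g \<in> vanishing_ideal S X" "\<And>s. s \<in> S \<Longrightarrow> c s = meval (mpartial s g) p"
      unfolding differentials_def by blast
    have c0: "c \<in> coord_space S" "c \<noteq> 0" using c by simp_all
    obtain s0 where "c s0 \<noteq> 0" using c0(2) unfolding fun_eq_iff by auto
    moreover from this have "s0 \<in> S" using c0(1) unfolding coord_space_def by blast
    ultimately have s0: "c s0 \<noteq> 0" "s0 \<in> S" .
    let ?d = "\<lambda>x s. if s \<in> S then meval (mpartial s g) x else 0"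
    have cong: "F (\<lambda>s. meval (mpartial s g) x) = F (?d x)" for x
      by (rule lfun_cong[OF F]) simp
    have gS: "mvars g \<subseteq> S" using g by (simp add: vanishing_ideal_def)
    \<comment> \<open>The second factor takes care of points where the differential of
      \<open>g\<close> is 0 and hence excluded from \<open>?W\<close>; it is nonzero at
      \<open>p\<close>, so it can be cancelled there.\<close>
    have "F (\<lambda>s. meval (mpartial s g) p) * meval (mpartial s0 g) p = 0"
    proof (rule zariski_closureD[of p S "\<phi> ` torus"])
      show "p \<in> zariski_closure S (\<phi> ` torus)" using p(1) by (simp add: X_eq)
      show "(\<lambda>x. F (\<lambda>s. meval (mpartial s g) x) * meval (mpartial s0 g) x) \<in> lfun S {}"
        by (intro lfun.mult mpartial_lfun[OF gS] lfun_subst[OF F])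
      fix y assume "y \<in> \<phi> ` torus"
      then obtain t where t: "t \<in> torus" "y = \<phi> t" by blast
      have "crit (?d y) t"
        unfolding crit_def using euler_relation[OF g(1) t(1)]
        by (simp add: \<phi>_def t(2) cong: sum.cong)
      show "F (\<lambda>s. meval (mpartial s g) y) * meval (mpartial s0 g) y = 0"
      proof (cases "meval (mpartial s0 g) y = 0")
        case False
        then have "?d y s0 \<noteq> 0" using s0 by simp
        then have "?d y \<noteq> 0" using s0(2) unfolding fun_eq_iff by (auto intro!: exI[of _ s0])
        then have "?d y \<in> ?W" using \<open>crit (?d y) t\<close> t(1) by (auto simp: coord_space_def)
        then have "F (?d y) = 0" by (rule bspec[OF F0])
        then show ?thesis unfolding cong by simp
      qed simp
    qed
    moreover have "F (\<lambda>s. meval (mpartial s g) p) = F c"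
      by (rule lfun_cong[OF F]) (simp add: g(2))
    ultimately show ?thesis using s0 g(2) by simp
  qed
  ultimately show "(\<forall>c\<in>?N. F c = 0) \<longleftrightarrow> (\<forall>c\<in>?W. F c = 0)" by blast
qed

end


section \<open>Parametrised hypersurfaces\<close>

text \<open>
  For general values of the other coordinates, \<open>g = 0\<close> can be solved for the coordinate \<open>v0\<close>,
  because the field is algebraically closed.
\<close>

lemma hypersurface_independent:
  fixes g :: "('v, 'k::alg_closed_field) mpoly"
  assumes S: "finite S" and g: "mvars g \<subseteq> S" "v0 \<in> mvars g"
    and q: "q \<in> lfun (S - {v0}) {}" "\<And>x. x \<in> zero_set S g \<Longrightarrow> q x = 0"
  shows "q x = 0"
proof -
  let ?K = "Poly_Mapping.keys g" and ?S = "S - {v0}"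
  let ?c = "\<lambda>m x. Poly_Mapping.lookup g m * (\<Prod>v\<in>?S. x v ^ Poly_Mapping.lookup m v)"
  define Q where "Q x = (\<Sum>m\<in>?K. monom (?c m x) (Poly_Mapping.lookup m v0))" for x
  obtain m0 where m0: "m0 \<in> ?K" "v0 \<in> Poly_Mapping.keys m0" using g(2) by (auto simp: mvars_def)
  \<comment> \<open>A positive exponent of \<open>v0\<close> that occurs in \<open>g\<close>.
    Wherever the coefficient at \<open>k\<close> is nonzero, \<open>Q x\<close> is not constant and
    has a root.\<close>
  define k where "k = Poly_Mapping.lookup m0 v0"
  have k: "k > 0" using m0 by (simp add: k_def in_keys_iff)
  define Mk where "Mk = {m\<in>?K. Poly_Mapping.lookup m v0 = k}"
  have fin: "finite Mk" by (simp add: Mk_def)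
  have v0: "v0 \<in> S" using g by blast
  have Qk: "coeff (Q x) k = (\<Sum>m\<in>Mk. ?c m x)" for x
    by (simp add: Q_def coeff_sum Mk_def sum.inter_filter cong: sum.cong)
  have eval: "poly (Q x) z = meval g (x(v0 := z))" for x z
  proof -
    have "mmon m (x(v0 := z)) = (\<Prod>v\<in>?S. x v ^ Poly_Mapping.lookup m v) * z ^ Poly_Mapping.lookup m v0"
      if "m \<in> ?K" for m
    proof -
      have "Poly_Mapping.keys m \<subseteq> S" using keys_mvars[OF that] g(1) by (rule order_trans)
      then have "mmon m (x(v0 := z)) = (\<Prod>v\<in>S. (x(v0 := z)) v ^ Poly_Mapping.lookup m v)"
        by (rule mmon_superset[OF S])
      also have "\<dots> = z ^ Poly_Mapping.lookup m v0 *
          (\<Prod>v\<in>?S. (x(v0 := z)) v ^ Poly_Mapping.lookup m v)"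
        using S v0 by (subst prod.remove[of _ v0]) auto
      also have "(\<Prod>v\<in>?S. (x(v0 := z)) v ^ Poly_Mapping.lookup m v) =
          (\<Prod>v\<in>?S. x v ^ Poly_Mapping.lookup m v)"
        by (intro prod.cong) auto
      finally show ?thesis by (simp only: mult.commute)
    qed
    then show ?thesis
      unfolding Q_def poly_sum poly_monom meval_superset[OF finite_keys order_refl]
      by (intro sum.cong) (auto simp: mult_ac)
  qed
  have nz: "\<exists>x. coeff (Q x) k \<noteq> 0"
  proof (rule ccontr)
    assume "\<nexists>x. coeff (Q x) k \<noteq> 0"
    then have z: "(\<Sum>m\<in>Mk. ?c m x) = 0" for x using Qk by metis
    \<comment> \<open>\<open>monomials_independent\<close> takes plain functions as exponents, so
      the coefficient is looked up through the abstraction function.\<close>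
    let ?a = "\<lambda>f. Poly_Mapping.lookup g (Poly_Mapping.Abs_poly_mapping f)"
    have injl: "inj_on Poly_Mapping.lookup Mk" by (intro inj_onI) (simp add: lookup_inject)
    have "\<forall>f\<in>Poly_Mapping.lookup ` Mk. ?a f = 0"
    proof (rule monomials_independent[OF infinite_alg_closed, of ?S])
      show "finite ?S" using S by simp
      show "finite (Poly_Mapping.lookup ` Mk)" using fin by simp
      show "inj_on (\<lambda>m. restrict m ?S) (Poly_Mapping.lookup ` Mk)"
      proof (rule inj_onI)
        fix f f' assume ff: "f \<in> Poly_Mapping.lookup ` Mk" "f' \<in> Poly_Mapping.lookup ` Mk"
          "restrict f ?S = restrict f' ?S"
        then obtain m m' where m: "m \<in> Mk" "f = Poly_Mapping.lookup m"
          "m' \<in> Mk" "f' = Poly_Mapping.lookup m'" by blast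
        have "Poly_Mapping.keys m \<subseteq> S" "Poly_Mapping.keys m' \<subseteq> S"
          using keys_mvars g(1) m by (auto simp: Mk_def dest!: keys_mvars)
        then have out: "f v = 0" "f' v = 0" if "v \<notin> S" for v
          using that m by (auto simp: not_in_keys_iff_lookup_eq_zero[symmetric])
        show "f = f'"
        proof
          fix v
          consider "v \<notin> S" | "v = v0" | "v \<in> ?S" by blast
          then show "f v = f' v"
          proof cases
            case 1 then show ?thesis using out by simp
          next
            case 2 then show ?thesis using m by (simp add: Mk_def)
          next
            case 3 then show ?thesis using fun_cong[OF ff(3), of v] by simp
          qed
        qed
      qed
      fix x show "(\<Sum>m\<in>Poly_Mapping.lookup ` Mk. ?a m * (\<Prod>i\<in>?S. x i ^ m i)) = 0"
        using z[of x] by (simp add: sum.reindex[OF injl] lookup_inverse)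
    qed
    moreover have "m0 \<in> Mk" using m0 by (simp add: Mk_def k_def)
    ultimately have "Poly_Mapping.lookup g m0 = 0" by (simp add: lookup_inverse)
    then show False using m0 by (simp add: in_keys_iff)
  qed
  have "q x * coeff (Q x) k = 0" for x
  proof (cases "coeff (Q x) k = 0")
    case False
    then have "degree (Q x) \<ge> k" by (rule le_degree)
    then obtain z where z: "poly (Q x) z = 0" using alg_closed_imp_poly_has_root[of "Q x"] k by auto
    define y where "y v = (if v \<in> S then (x(v0 := z)) v else 0)" for v
    have "meval g y = meval g (x(v0 := z))"
      by (rule lfun_cong[OF meval_lfun[OF g(1)]]) (simp add: y_def)
    then have "y \<in> zero_set S g"
      using z eval[of x z] by (simp add: zero_set_def coord_space_def y_def)
    then have "q y = 0" by (rule q(2))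
    moreover have "q x = q y" by (rule lfun_cong[OF q(1)]) (auto simp: y_def)
    ultimately show ?thesis by simp
  qed simp
  moreover have "(\<lambda>x. coeff (Q x) k) \<in> lfun ?S {}"
    unfolding Qk by (intro lfun_sum lfun_cmult lfun_prod lfun_power lfun.var)
  ultimately have "(\<forall>x\<in>units_on {}. q x = 0) \<or> (\<forall>x\<in>units_on {}. coeff (Q x) k = 0)"
    by (intro lfun_prod_eq_0[OF infinite_alg_closed _ q(1)]) auto
  then show ?thesis using nz by auto
qed

text \<open>The image of one parameter fewer than there are coordinates: what a hypersurface admits,
  expressed without a notion of dimension.\<close>

locale parametrisation =
  fixes S :: "'s set" and V T :: "'v set" and \<Phi> :: "('v \<Rightarrow> 'k::alg_closed_field) \<Rightarrow> 's \<Rightarrow> 'k"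
  assumes S: "finite S" and V: "finite V" and T: "T \<subseteq> V" and card_S_V: "card S = card V + 1"
    and \<Phi>: "s \<in> S \<Longrightarrow> (\<lambda>p. \<Phi> p s) \<in> lfun V T" and \<Phi>_coord: "\<Phi> p \<in> coord_space S"
begin

lemma fin_T: "finite T"
  using T V finite_subset by blast

definition image_closure :: "('s \<Rightarrow> 'k) set" where
  "image_closure = zariski_closure S (\<Phi> ` units_on T)"

lemma pullback: "F \<in> lfun S {} \<Longrightarrow> (\<lambda>p. F (\<Phi> p)) \<in> lfun V T"
  using lfun_subst[of F S "\<lambda>s p. \<Phi> p s" V T] \<Phi> by simp

lemma vanish_on_closure:
  assumes "F \<in> lfun S {}" "\<And>p. p \<in> units_on T \<Longrightarrow> F (\<Phi> p) = 0" "x \<in> image_closure"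
  shows "F x = 0"
  using zariski_closureD[OF assms(3)[unfolded image_closure_def] assms(1)] assms(2) by blast

text \<open>\<open>H\<close> takes the place of the coordinate \<open>v0\<close>, which keeps the
  number of functions one above the number of parameters. Their relation is read as a polynomial in
  \<open>H\<close>; the least \<open>k\<close> with a nonzero coefficient function permits a power
  of \<open>H\<close> to be split off.\<close>

lemma algebraic_relation:
  assumes v0: "v0 \<in> S" and H: "H \<in> lfun V T"
  obtains Q D k where "\<And>p. p \<in> units_on T \<Longrightarrow> poly (Q (\<Phi> p)) (H p) = 0"
    "\<And>k. (\<lambda>x. coeff (Q x) k) \<in> lfun (S - {v0}) {}" "\<And>x. degree (Q x) \<le> D"
    "\<exists>x. coeff (Q x) k \<noteq> 0" "\<And>x j. j < k \<Longrightarrow> coeff (Q x) j = 0"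
proof -
  define F where "F i = (if i = v0 then H else (\<lambda>p. \<Phi> p i))" for i
  have "\<exists>P\<in>lfun S {}. (\<exists>x. P x \<noteq> 0) \<and> (\<forall>p\<in>units_on T. P (\<lambda>i. F i p) = 0)"
    by (rule lfun_algebraically_dependent[OF infinite_alg_closed V T S card_S_V])
       (simp add: F_def H \<Phi>)
  then obtain P where P: "P \<in> lfun S {}" "\<exists>x. P x \<noteq> 0" "\<And>p. p \<in> units_on T \<Longrightarrow> P (\<lambda>i. F i p) = 0"
    by blast
  obtain Q D where Q: "\<And>x. P x = poly (Q x) (x v0)"
    "\<And>k. (\<lambda>x. coeff (Q x) k) \<in> lfun (S - {v0}) {}" "\<And>x. degree (Q x) \<le> D"
    using lfun_as_poly[OF P(1), of v0] by metis
  have "\<exists>k x. coeff (Q x) k \<noteq> 0"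
  proof (rule ccontr)
    assume "\<nexists>k x. coeff (Q x) k \<noteq> 0"
    then have "Q x = 0" for x by (simp add: poly_eq_iff)
    then show False using P(2) Q(1) by simp
  qed
  then obtain k where k: "\<exists>x. coeff (Q x) k \<noteq> 0" "\<And>j. j < k \<Longrightarrow> \<not> (\<exists>x. coeff (Q x) j \<noteq> 0)"
    using exists_least_iff[of "\<lambda>k. \<exists>x. coeff (Q x) k \<noteq> 0"] by blast
  have "poly (Q (\<Phi> p)) (H p) = 0" if p: "p \<in> units_on T" for p
  proof -
    have "coeff (Q (\<lambda>i. F i p)) k = coeff (Q (\<Phi> p)) k" for k
      by (rule lfun_cong[OF Q(2)]) (simp add: F_def)
    then have "Q (\<lambda>i. F i p) = Q (\<Phi> p)" by (simp add: poly_eq_iff)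
    then show ?thesis using P(3)[OF p] Q(1)[of "\<lambda>i. F i p"] by (simp add: F_def)
  qed
  then show thesis using that[of Q D k] Q(2,3) k by blast
qed

text \<open>The relation satisfied by \<open>g\<close> over all coordinates but \<open>v0\<close>
  factors as \<open>g ^ k\<close> times \<open>P\<close>, and one factor vanishes on the whole
  image. If \<open>P\<close> did, it would vanish on the zeros of \<open>g\<close>, where it equals
  the coefficient at \<open>k\<close>; by \<open>hypersurface_independent\<close> this coefficient
  would be 0 everywhere.\<close>

lemma closure_subset_hypersurface:
  assumes g: "mvars g \<subseteq> S" "mvars g \<noteq> {}" and sub: "zero_set S g \<subseteq> image_closure"
  shows "image_closure \<subseteq> zero_set S g"
proof -
  obtain v0 where v0: "v0 \<in> mvars g" "v0 \<in> S" using g by blast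
  have gl: "(\<lambda>x. meval g x) \<in> lfun S {}" by (rule meval_lfun[OF g(1)])
  let ?H = "\<lambda>p. meval g (\<Phi> p)"
  have H: "?H \<in> lfun V T" by (rule pullback[OF gl])
  obtain Q D k where Q: "\<And>p. p \<in> units_on T \<Longrightarrow> poly (Q (\<Phi> p)) (?H p) = 0"
    "\<And>k. (\<lambda>x. coeff (Q x) k) \<in> lfun (S - {v0}) {}" "\<And>x. degree (Q x) \<le> D"
    "\<exists>x. coeff (Q x) k \<noteq> 0" "\<And>x j. j < k \<Longrightarrow> coeff (Q x) j = 0"
    by (rule algebraic_relation[OF v0(2) H]) blast
  have kD: "k \<le> D" using Q(3,4) le_degree le_trans by blast
  define P where "P x = (\<Sum>j=k..D. coeff (Q x) j * meval g x ^ (j - k))" for x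
  have P: "P \<in> lfun S {}"
    unfolding P_def using lfun_mono[OF Q(2)] by (intro lfun_sum lfun.mult lfun_power gl) auto
  have factor: "poly (Q x) (meval g x) = meval g x ^ k * P x" for x
  proof -
    have "poly (Q x) (meval g x) = (\<Sum>j\<le>degree (Q x). coeff (Q x) j * meval g x ^ j)"
      by (rule poly_altdef)
    also have "\<dots> = (\<Sum>j\<le>D. coeff (Q x) j * meval g x ^ j)"
      using Q(3)[of x] by (intro sum.mono_neutral_left) (auto simp: coeff_eq_0)
    also have "\<dots> = (\<Sum>j=k..D. coeff (Q x) j * meval g x ^ j)"
      using Q(5) by (intro sum.mono_neutral_right) (auto simp: not_le)
    also have "\<dots> = meval g x ^ k * P x"
      unfolding P_def sum_distrib_left
      by (intro sum.cong refl) (simp add: power_add[symmetric] mult.left_commute)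
    finally show ?thesis .
  qed
  have "(\<forall>p\<in>units_on T. ?H p ^ k = 0) \<or> (\<forall>p\<in>units_on T. P (\<Phi> p) = 0)"
  proof (rule lfun_prod_eq_0[OF infinite_alg_closed fin_T])
    show "(\<lambda>p. ?H p ^ k) \<in> lfun V T" by (rule lfun_power[OF H])
    show "(\<lambda>p. P (\<Phi> p)) \<in> lfun V T" by (rule pullback[OF P])
    show "?H p ^ k * P (\<Phi> p) = 0" if "p \<in> units_on T" for p
      using Q(1)[OF that] factor by simp
  qed
  moreover have "\<not> (\<forall>p\<in>units_on T. P (\<Phi> p) = 0)"
  proof
    assume P0: "\<forall>p\<in>units_on T. P (\<Phi> p) = 0"
    have "coeff (Q x) k = 0" for x
    proof (rule hypersurface_independent[OF S g(1) v0(1) Q(2)])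
      fix x assume x: "x \<in> zero_set S g"
      then have "x \<in> image_closure" using sub by blast
      then have "P x = 0" using vanish_on_closure[OF P] P0 by blast
      moreover have "P x = coeff (Q x) k"
      proof -
        have "P x = (\<Sum>j\<in>{k}. coeff (Q x) j * meval g x ^ (j - k))"
          unfolding P_def using x kD by (intro sum.mono_neutral_right) (auto simp: zero_set_def)
        then show ?thesis by simp
      qed
      ultimately show "coeff (Q x) k = 0" by simp
    qed
    then show False using Q(4) by blast
  qed
  ultimately have "\<forall>p\<in>units_on T. ?H p = 0" by auto
  then have "meval g x = 0" if "x \<in> image_closure" for x
    using vanish_on_closure[OF gl _ that] by blast
  then show ?thesis by (auto simp: zero_set_def image_closure_def zariski_closure_def)
qed

text \<open>
  The parameters are algebraic over all but one of the coordinates, because \<open>card V\<close> of these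
  are independent on the hypersurface.
\<close>

lemma generically_finite:
  assumes g: "mvars g \<subseteq> S" "mvars g \<noteq> {}" and sub: "zero_set S g \<subseteq> image_closure"
  obtains w where "w \<in> lfun V T" "\<exists>p\<in>units_on T. w p \<noteq> 0"
    "\<And>p. w p \<noteq> 0 \<Longrightarrow> finite ((\<lambda>p'. restrict p' V) ` {p' \<in> units_on T. \<Phi> p' = \<Phi> p})"
proof -
  obtain v0 where v0: "v0 \<in> mvars g" "v0 \<in> S" using g by blast
  have "\<exists>Q k. (\<forall>p\<in>units_on T. poly (Q (\<Phi> p)) (p v) = 0) \<and>
      (\<lambda>x. coeff (Q x) k) \<in> lfun S {} \<and> (\<exists>p\<in>units_on T. coeff (Q (\<Phi> p)) k \<noteq> 0)"
    if v: "v \<in> V" for v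
  proof -
    have "(\<lambda>p. p v) \<in> lfun V T" using v by (rule lfun.var)
    then obtain Q D k where Q: "\<And>p. p \<in> units_on T \<Longrightarrow> poly (Q (\<Phi> p)) (p v) = 0"
      "\<And>k. (\<lambda>x. coeff (Q x) k) \<in> lfun (S - {v0}) {}" "\<And>x. degree (Q x) \<le> D"
      "\<exists>x. coeff (Q x) k \<noteq> 0" "\<And>x j. j < k \<Longrightarrow> coeff (Q x) j = 0"
      by (rule algebraic_relation[OF v0(2)]) blast
    have QS: "(\<lambda>x. coeff (Q x) k) \<in> lfun S {}" by (rule lfun_mono[OF Q(2)]) auto
    have "\<exists>p\<in>units_on T. coeff (Q (\<Phi> p)) k \<noteq> 0"
    proof (rule ccontr)
      assume "\<not> ?thesis"
      then have "coeff (Q x) k = 0" if "x \<in> image_closure" for x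
        using vanish_on_closure[OF QS _ that] by blast
      then have "coeff (Q x) k = 0" for x
        using hypersurface_independent[OF S g(1) v0(1) Q(2)] sub by blast
      then show False using Q(4) by blast
    qed
    then show ?thesis using Q(1) QS by blast
  qed
  then obtain Q k where Q: "\<And>v p. v \<in> V \<Longrightarrow> p \<in> units_on T \<Longrightarrow> poly (Q v (\<Phi> p)) (p v) = 0"
    "\<And>v. v \<in> V \<Longrightarrow> (\<lambda>x. coeff (Q v x) (k v)) \<in> lfun S {}"
    "\<And>v. v \<in> V \<Longrightarrow> \<exists>p\<in>units_on T. coeff (Q v (\<Phi> p)) (k v) \<noteq> 0" by metis
  \<comment> \<open>Where \<open>w\<close> is nonzero, every parameter is a root of a nonzero
    polynomial that depends only on the image point.\<close>
  define w where "w p = (\<Prod>v\<in>V. coeff (Q v (\<Phi> p)) (k v))" for p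
  have wl: "(\<lambda>p. coeff (Q v (\<Phi> p)) (k v)) \<in> lfun V T" if "v \<in> V" for v
    by (rule pullback[OF Q(2)[OF that]])
  show thesis
  proof
    show "w \<in> lfun V T" unfolding w_def by (rule lfun_prod[OF wl])
    show "\<exists>p\<in>units_on T. w p \<noteq> 0"
      using lfun_common_nonzero[OF infinite_alg_closed fin_T V wl Q(3)] V
      by (auto simp: w_def)
    fix p assume "w p \<noteq> 0"
    then have nz: "Q v (\<Phi> p) \<noteq> 0" if "v \<in> V" for v
      using that V by (auto simp: w_def)
    have "(\<lambda>p'. restrict p' V) ` {p' \<in> units_on T. \<Phi> p' = \<Phi> p} \<subseteq>
      PiE V (\<lambda>v. {z. poly (Q v (\<Phi> p)) z = 0})"
    proof
      fix f assume "f \<in> (\<lambda>p'. restrict p' V) ` {p' \<in> units_on T. \<Phi> p' = \<Phi> p}"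
      then obtain p' where p': "f = restrict p' V" "p' \<in> units_on T" "\<Phi> p' = \<Phi> p" by blast
      then show "f \<in> PiE V (\<lambda>v. {z. poly (Q v (\<Phi> p)) z = 0})"
        using Q(1)[OF _ p'(2)] by auto
    qed
    moreover have "finite (PiE V (\<lambda>v. {z. poly (Q v (\<Phi> p)) z = 0}))"
      using V nz by (intro finite_PiE poly_roots_finite) auto
    ultimately show "finite ((\<lambda>p'. restrict p' V) ` {p' \<in> units_on T. \<Phi> p' = \<Phi> p})"
      by (rule finite_subset)
  qed
qed

end

section \<open>Parametrisation of the dual variety\<close>

context graded_toric
begin

text \<open>Critical points come in orbits of the scaling of the rows in \<open>R\<close>; the value
  1 at this coordinate picks one point from each orbit.\<close>

definition row1 :: 'd where "row1 = (SOME r. r \<in> R)"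

lemma row1: "row1 \<in> R"
proof -
  have "R \<noteq> {}" using graded[OF b_S] by auto
  then show ?thesis by (simp add: row1_def some_in_eq)
qed

lemma crit_rescale:
  assumes "crit c t" "t \<in> torus" "l \<noteq> 0"
  shows "crit c (\<lambda>r. if r \<in> R then l * t r else t r)"
proof -
  have "(\<Sum>s\<in>S. c s * laurent_monomial (\<lambda>r. if r \<in> R then l * t r else t r) (M s) * of_int (M s $ r)) =
    (\<Sum>s\<in>S. l * (c s * laurent_monomial t (M s) * of_int (M s $ r)))" for r
    by (intro sum.cong refl) (simp add: scale_on_R[OF _ assms(2,3)] mult_ac)
  then show ?thesis using assms(1) by (simp add: crit_def sum_distrib_left[symmetric])
qed

lemma crit_normalised:
  assumes "crit c t" "t \<in> torus"
  shows "\<exists>t'\<in>torus. t' row1 = 1 \<and> crit c t'"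
proof -
  have t1: "t row1 \<noteq> 0" using assms(2) by (simp add: torus_def)
  let ?t = "\<lambda>r. if r \<in> R then inverse (t row1) * t r else t r"
  have "?t \<in> torus" using assms(2) t1 by (simp add: torus_def)
  moreover have "?t row1 = 1 \<and> crit c ?t"
    using t1 row1 crit_rescale[OF assms, of "inverse (t row1)"] by simp
  ultimately show ?thesis by - (rule bexI[of _ ?t])
qed

section \<open>Solving the critical equations for the basis coefficients\<close>

text \<open>The coordinates of the columns with respect to the basis columns, over the
  field.\<close>

definition \<kappa> :: "'s \<Rightarrow> 'd \<Rightarrow> 'k" where
  "\<kappa> = (SOME k. \<forall>s r. of_int (M s $ r) = (\<Sum>q\<in>UNIV. k s q * of_int (M (b q) $ r)))"

lemma \<kappa>: "of_int (M s $ r) = (\<Sum>q\<in>UNIV. \<kappa> s q * of_int (M (b q) $ r))"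
proof -
  let ?\<delta> = "det (\<chi> r q. M (b q) $ r)"
  have "\<exists>k. \<forall>r. (of_int (M s $ r) :: 'k) = (\<Sum>q\<in>UNIV. k q * of_int (M (b q) $ r))" for s
  proof -
    obtain c where c: "\<And>r. ?\<delta> * M s $ r = (\<Sum>q\<in>UNIV. c q * M (b q) $ r)"
      using basis_relation by blast
    have "(of_int (M s $ r) :: 'k) = (\<Sum>q\<in>UNIV. of_int (c q) / of_int ?\<delta> * of_int (M (b q) $ r))" for r
    proof -
      have "of_int ?\<delta> * (of_int (M s $ r) :: 'k) = (\<Sum>q\<in>UNIV. of_int (c q) * of_int (M (b q) $ r))"
        unfolding of_int_mult[symmetric] c by simp
      also have "\<dots> = of_int ?\<delta> * (\<Sum>q\<in>UNIV. of_int (c q) / of_int ?\<delta> * of_int (M (b q) $ r))"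
        unfolding sum_distrib_left using det_b by (intro sum.cong) auto
      finally show ?thesis by (simp only: mult_left_cancel[OF det_b])
    qed
    then show ?thesis by (intro exI[of _ "\<lambda>q. of_int (c q) / of_int ?\<delta>"]) blast
  qed
  then have "\<exists>k. \<forall>s r. (of_int (M s $ r) :: 'k) = (\<Sum>q\<in>UNIV. k s q * of_int (M (b q) $ r))"
    by metis
  from someI_ex[OF this] show ?thesis unfolding \<kappa>_def by blast
qed

text \<open>Expanding all columns in the basis turns the critical equations into an equivalent
  system in which each equation contains exactly one basis coefficient.\<close>

lemma crit_iff:
  "crit c t \<longleftrightarrow> (\<forall>q. c (b q) * laurent_monomial t (M (b q)) =
     - (\<Sum>s\<in>S - range b. \<kappa> s q * c s * laurent_monomial t (M s)))"
proof -
  define e where "e q = c (b q) * laurent_monomial t (M (b q)) +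
    (\<Sum>s\<in>S - range b. \<kappa> s q * c s * laurent_monomial t (M s))" for q
  have "(\<Sum>s\<in>S. c s * laurent_monomial t (M s) * of_int (M s $ r)) =
    (\<Sum>q\<in>UNIV. e q * of_int (M (b q) $ r))" for r
  proof -
    let ?f = "\<lambda>s. c s * laurent_monomial t (M s) * of_int (M s $ r)"
    have "(\<Sum>s\<in>S. ?f s) = (\<Sum>s\<in>S - range b. ?f s) + (\<Sum>s\<in>range b. ?f s)"
      using b_S finite_S by (intro sum.subset_diff) auto
    also have "(\<Sum>s\<in>range b. ?f s) = (\<Sum>q\<in>UNIV. ?f (b q))"
      using inj_b by (simp add: sum.reindex)
    also have "(\<Sum>s\<in>S - range b. ?f s) = (\<Sum>s\<in>S - range b. \<Sum>q\<in>UNIV.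
        \<kappa> s q * c s * laurent_monomial t (M s) * of_int (M (b q) $ r))"
    proof (intro sum.cong refl)
      fix s
      have "?f s = c s * laurent_monomial t (M s) * (\<Sum>q\<in>UNIV. \<kappa> s q * of_int (M (b q) $ r))"
        by (subst \<kappa>) (rule refl)
      then show "?f s = (\<Sum>q\<in>UNIV. \<kappa> s q * c s * laurent_monomial t (M s) * of_int (M (b q) $ r))"
        by (simp add: sum_distrib_left mult_ac)
    qed
    also have "\<dots> = (\<Sum>q\<in>UNIV. (\<Sum>s\<in>S - range b. \<kappa> s q * c s * laurent_monomial t (M s)) *
        of_int (M (b q) $ r))"
      by (subst sum.swap) (simp add: sum_distrib_right)
    finally show ?thesis by (simp add: e_def sum.distrib[symmetric] distrib_right add.commute)
  qed
  then have "crit c t \<longleftrightarrow> (\<forall>r. (\<Sum>q\<in>UNIV. e q * of_int (M (b q) $ r)) = 0)"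
    by (simp add: crit_def)
  also have "\<dots> \<longleftrightarrow> (\<forall>q. e q = 0)"
  proof
    assume *: "\<forall>r. (\<Sum>q\<in>UNIV. e q * of_int (M (b q) $ r)) = 0"
    show "\<forall>q. e q = 0" by (rule allI, rule basis_independent[where a = e], rule spec[OF *])
  qed simp
  finally show ?thesis by (simp add: e_def eq_neg_iff_add_eq_0)
qed

text \<open>The coordinates of a normalised critical point other than \<open>row1\<close>; they must
  be invertible. With the coefficients outside the basis, added in \<open>params\<close>, they
  number \<open>card S - 1\<close>.\<close>

definition unit_params :: "('d + 's) set" where "unit_params = Inl ` (UNIV - {row1})"

definition params :: "('d + 's) set" where "params = unit_params \<union> Inr ` (S - range b)"

definition tpar :: "('d + 's \<Rightarrow> 'k) \<Rightarrow> 'd \<Rightarrow> 'k" where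
  "tpar p r = (if r = row1 then 1 else p (Inl r))"

text \<open>Coefficients outside the basis are free; those on the basis are the values forced by
  \<open>crit_iff\<close>, with the exponent \<open>- M s\<close> inverting the monomial.\<close>

definition \<Psi> :: "('d + 's \<Rightarrow> 'k) \<Rightarrow> 's \<Rightarrow> 'k" where
  "\<Psi> p s = (if s \<in> S - range b then p (Inr s)
     else if s \<in> range b then - (\<Sum>s'\<in>S - range b. \<kappa> s' (inv b s) * p (Inr s') *
         laurent_monomial (tpar p) (M s')) * laurent_monomial (tpar p) (- M s)
     else 0)"

lemma tpar_torus: "p \<in> units_on unit_params \<longleftrightarrow> tpar p \<in> torus"
  by (auto simp: units_on_def unit_params_def tpar_def torus_def)

lemma \<Psi>_coord: "\<Psi> p \<in> coord_space S"
  using b_S by (auto simp: \<Psi>_def coord_space_def)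

lemma \<Psi>_crit:
  assumes "p \<in> units_on unit_params"
  shows "crit (\<Psi> p) (tpar p)"
proof -
  have t: "tpar p \<in> torus" using assms tpar_torus by simp
  have lm_inv: "laurent_monomial (tpar p) (- a) * laurent_monomial (tpar p) a = 1" for a
    using laurent_monomial_add[OF t, of "- a" a] by (simp add: laurent_monomial_0)
  have sum_eq: "(\<Sum>s\<in>S - range b. \<kappa> s q * \<Psi> p s * laurent_monomial (tpar p) (M s)) =
    (\<Sum>s\<in>S - range b. \<kappa> s q * p (Inr s) * laurent_monomial (tpar p) (M s))" for q
    by (intro sum.cong) (auto simp: \<Psi>_def)
  show ?thesis
    unfolding crit_iff
  proof
    fix q
    let ?s = "\<Sum>s\<in>S - range b. \<kappa> s q * p (Inr s) * laurent_monomial (tpar p) (M s)"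
    have "\<Psi> p (b q) * laurent_monomial (tpar p) (M (b q)) =
        - ?s * (laurent_monomial (tpar p) (- M (b q)) * laurent_monomial (tpar p) (M (b q)))"
      using inj_b by (simp add: \<Psi>_def)
    also have "\<dots> = - ?s" by (simp only: lm_inv mult_1_right)
    finally show "\<Psi> p (b q) * laurent_monomial (tpar p) (M (b q)) =
        - (\<Sum>s\<in>S - range b. \<kappa> s q * \<Psi> p s * laurent_monomial (tpar p) (M s))"
      by (simp only: sum_eq)
  qed
qed

text \<open>The entries of \<open>case_sum t c\<close> at \<open>row1\<close> and at the basis
  columns are never read by \<open>tpar\<close> and \<open>\<Psi>\<close>, so no restriction to
  \<open>params\<close> is required.\<close>

lemma \<Psi>_surj:
  assumes c: "c \<in> coord_space S" and t: "t \<in> torus" "t row1 = 1" and crit: "crit c t"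
  shows "\<Psi> (case_sum t c) = c" "tpar (case_sum t c) = t"
proof -
  show tp: "tpar (case_sum t c) = t" using t(2) by (auto simp: tpar_def)
  show "\<Psi> (case_sum t c) = c"
  proof
    fix s
    consider "s \<in> S - range b" | q where "s = b q" | "s \<notin> S" by blast
    then show "\<Psi> (case_sum t c) s = c s"
    proof cases
      case 2
      have "laurent_monomial t (M s) * laurent_monomial t (- M s) = 1"
        using laurent_monomial_add[OF t(1), of "M s" "- M s"] by (simp add: laurent_monomial_0)
      then have "c s = c s * laurent_monomial t (M s) * laurent_monomial t (- M s)"
        by (simp add: mult.assoc)
      also have "c s * laurent_monomial t (M s) =
          - (\<Sum>s\<in>S - range b. \<kappa> s q * c s * laurent_monomial t (M s))"
        using crit 2 unfolding crit_iff by blast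
      finally show ?thesis using 2 inj_b by (simp add: \<Psi>_def tp)
    qed (use c b_S in \<open>auto simp: \<Psi>_def coord_space_def\<close>)
  qed
qed

lemma lm_tpar_lfun: "(\<lambda>p. laurent_monomial (tpar p) a) \<in> lfun params unit_params"
  unfolding laurent_monomial_def
proof (intro lfun_prod)
  fix r
  show "(\<lambda>p. tpar p r powi (a $ r)) \<in> lfun params unit_params"
  proof (cases "r = row1")
    case True
    then show ?thesis by (simp add: tpar_def lfun.const)
  next
    case False
    then have "Inl r \<in> params" "Inl r \<in> unit_params" by (auto simp: params_def unit_params_def)
    from lfun_power_int[OF this] show ?thesis using False by (simp add: tpar_def)
  qed
qed

lemma \<Psi>_lfun: "(\<lambda>p. \<Psi> p s) \<in> lfun params unit_params"
proof -
  have var: "(\<lambda>p. p (Inr s)) \<in> lfun params unit_params" if "s \<in> S - range b" for s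
    using that by (intro lfun.var) (auto simp: params_def)
  consider "s \<in> S - range b" | "s \<notin> S - range b" "s \<in> range b" | "s \<notin> S - range b" "s \<notin> range b"
    by blast
  then show ?thesis
  proof cases
    case 1
    from var[OF this] show ?thesis using 1 by (simp add: \<Psi>_def)
  next
    case 2
    have "(\<lambda>p. - (\<Sum>s'\<in>S - range b. \<kappa> s' (inv b s) * p (Inr s') *
         laurent_monomial (tpar p) (M s')) * laurent_monomial (tpar p) (- M s)) \<in> lfun params unit_params"
      by (intro lfun.mult lfun_uminus lfun_sum lfun_cmult lm_tpar_lfun var)
    then show ?thesis using 2 by (simp add: \<Psi>_def)
  next
    case 3
    then show ?thesis by (simp add: \<Psi>_def lfun.const)
  qed
qed

sublocale par: parametrisation S params unit_params \<Psi>
proof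
  show fin: "finite params"
    unfolding params_def unit_params_def using finite_S by simp
  show "unit_params \<subseteq> params" by (simp add: params_def)
  have "card params = card unit_params + card (S - range b)"
    unfolding params_def using finite_S
    by (subst card_Un_disjoint) (auto simp: unit_params_def card_image)
  moreover have "card unit_params = CARD('d) - 1"
    by (simp add: unit_params_def card_image)
  moreover have "CARD('d) > 0" by simp
  ultimately show "card S = card params + 1" using card_S by linarith
qed (simp_all add: finite_S \<Psi>_lfun \<Psi>_coord)

text \<open>The dual cone is the closure of nonzero vectors only, whereas \<open>\<Psi>\<close> may
  take the value 0. A coefficient outside the basis is a free parameter, and the locus where it is 0
  can be discarded. If all columns are in the basis, \<open>\<Psi>\<close> is constantly 0 while the
  dual cone is empty.\<close>

lemma dual_cone_param:
  assumes "S \<noteq> range b"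
  shows "dual_cone S X = par.image_closure"
  unfolding dual_cone_eq par.image_closure_def
proof (rule zariski_closure_eqI)
  let ?W = "{c \<in> coord_space S. c \<noteq> 0 \<and> (\<exists>t\<in>torus. crit c t)}"
  fix F :: "('s \<Rightarrow> 'k) \<Rightarrow> 'k" assume F: "F \<in> lfun S {}"
  obtain s0 where s0: "s0 \<in> S - range b" using assms b_S by blast
  show "(\<forall>c\<in>?W. F c = 0) \<longleftrightarrow> (\<forall>c\<in>\<Psi> ` units_on unit_params. F c = 0)"
  proof
    assume F0: "\<forall>c\<in>\<Psi> ` units_on unit_params. F c = 0"
    show "\<forall>c\<in>?W. F c = 0"
    proof
      fix c assume c: "c \<in> ?W"
      then obtain t where t: "t \<in> torus" "t row1 = 1" "crit c t"
        using crit_normalised by blast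
      have "c \<in> coord_space S" using c by blast
      note * = \<Psi>_surj[OF this t]
      then have "case_sum t c \<in> units_on unit_params" using t(1) by (simp add: tpar_torus)
      then have "F (\<Psi> (case_sum t c)) = 0" using F0 by (rule_tac bspec) auto
      then show "F c = 0" using * by simp
    qed
  next
    assume F0: "\<forall>c\<in>?W. F c = 0"
    have "(\<forall>p\<in>units_on unit_params. F (\<Psi> p) = 0) \<or>
      (\<forall>p\<in>units_on unit_params. p (Inr s0) = (0 :: 'k))"
    proof (rule lfun_prod_eq_0[OF infinite_alg_closed par.fin_T par.pullback[OF F]])
      show "(\<lambda>p. p (Inr s0)) \<in> lfun params unit_params"
        using s0 by (intro lfun.var) (auto simp: params_def)
      fix p :: "'d + 's \<Rightarrow> 'k" assume p: "p \<in> units_on unit_params"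
      show "F (\<Psi> p) * p (Inr s0) = 0"
      proof (cases "p (Inr s0) = 0")
        case False
        then have "\<Psi> p s0 \<noteq> 0" using s0 by (simp add: \<Psi>_def)
        then have "\<Psi> p \<noteq> 0" by auto
        then have "\<Psi> p \<in> ?W" using \<Psi>_crit[OF p] \<Psi>_coord p tpar_torus by blast
        then show ?thesis using bspec[OF F0] by simp
      qed simp
    qed
    moreover have "(\<lambda>_. 1 :: 'k) \<in> units_on unit_params" by (simp add: units_on_def)
    ultimately show "\<forall>c\<in>\<Psi> ` units_on unit_params. F c = 0" by force
  qed
qed

lemma dual_cone_degenerate:
  assumes "S = range b"
  shows "dual_cone S X = {}"
proof -
  have "c = 0" if "c \<in> coord_space S" "t \<in> torus" "crit c t" for c t
  proof
    fix s
    show "c s = 0 s"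
      using crit_on_basis[OF that(3,2)] that(1) assms by (cases "s \<in> S") (auto simp: coord_space_def)
  qed
  then have W: "{c \<in> coord_space S. c \<noteq> 0 \<and> (\<exists>t\<in>torus. crit c t)} = {}" by blast
  have "x \<notin> zariski_closure S ({} :: ('s \<Rightarrow> 'k) set)" for x
    using zariski_closureD[of x S "{}" "\<lambda>_. 1"] lfun.const[of 1 S "{}"] by auto
  then show ?thesis unfolding dual_cone_eq W by blast
qed

lemma hypersurface_in_dual_cone:
  assumes "hypersurface S Z" "Z \<subseteq> dual_cone S X"
  shows "Z = dual_cone S X"
proof (cases "S = range b")
  case True
  then show ?thesis using dual_cone_degenerate assms(2) by blast
next
  case False
  obtain g where "mvars g \<subseteq> S" "mvars g \<noteq> {}" "Z = zero_set S g"
    using assms(1) unfolding hypersurface_def by blast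
  then show ?thesis
    using par.closure_subset_hypersurface assms(2) dual_cone_param[OF False] by blast
qed

text \<open>The fibre of \<open>\<Psi>\<close> through a parameter point corresponds, on
  \<open>params\<close>, to the normalised critical points of its image. Finite fibres off the zeros
  of \<open>w\<close> place the image of a general point in \<open>Y\<close>, and a test function
  that vanishes on \<open>Y\<close> then vanishes on the whole image.\<close>

lemma dual_cone_le_closure:
  assumes hyp: "hypersurface S (dual_cone S X)"
    and Y: "\<And>c. c \<in> coord_space S \<Longrightarrow> (\<exists>t\<in>torus. crit c t) \<Longrightarrow>
      finite {t \<in> torus. t row1 = 1 \<and> crit c t} \<Longrightarrow> c \<in> Y"
  shows "dual_cone S X \<subseteq> zariski_closure S Y"
proof (cases "S = range b")
  case True
  then show ?thesis using dual_cone_degenerate by blast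
next
  case False
  note eq = dual_cone_param[OF False]
  obtain g where "mvars g \<subseteq> S" "mvars g \<noteq> {}" "zero_set S g \<subseteq> par.image_closure"
    using hyp unfolding hypersurface_def eq by blast
  then obtain w where w: "w \<in> lfun params unit_params" "\<exists>p\<in>units_on unit_params. w p \<noteq> 0"
    "\<And>p. w p \<noteq> 0 \<Longrightarrow>
      finite ((\<lambda>p'. restrict p' params) ` {p' \<in> units_on unit_params. \<Psi> p' = \<Psi> p})"
    by (rule par.generically_finite) blast
  have in_Y: "\<Psi> p \<in> Y" if p: "p \<in> units_on unit_params" "w p \<noteq> 0" for p
  proof (rule Y[OF \<Psi>_coord])
    show "\<exists>t\<in>torus. crit (\<Psi> p) t" using \<Psi>_crit[OF p(1)] p(1) tpar_torus by blast
    let ?A = "{p' \<in> units_on unit_params. \<Psi> p' = \<Psi> p}"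
    \<comment> \<open>Recovers the critical point from its restricted parameters, which shows that
      finitely many restrictions allow finitely many critical points.\<close>
    let ?u = "\<lambda>f r. if r = row1 then 1 else f (Inl r)"
    have "{t \<in> torus. t row1 = 1 \<and> crit (\<Psi> p) t} \<subseteq> ?u ` (\<lambda>p'. restrict p' params) ` ?A"
    proof
      fix t assume "t \<in> {t \<in> torus. t row1 = 1 \<and> crit (\<Psi> p) t}"
      then have t: "t \<in> torus" "t row1 = 1" "crit (\<Psi> p) t" by auto
      let ?p = "case_sum t (\<Psi> p)"
      note * = \<Psi>_surj[OF \<Psi>_coord t]
      then have "?p \<in> ?A" using t(1) by (simp add: tpar_torus)
      moreover have "t = ?u (restrict ?p params)"
        using t(2) by (auto simp: params_def unit_params_def)
      ultimately show "t \<in> ?u ` (\<lambda>p'. restrict p' params) ` ?A" by blast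
    qed
    then show "finite {t \<in> torus. t row1 = 1 \<and> crit (\<Psi> p) t}"
      using w(3)[OF p(2)] by (rule finite_subset[OF _ finite_imageI])
  qed
  show ?thesis
  proof
    fix c assume c: "c \<in> dual_cone S X"
    have "F c = 0" if F: "F \<in> lfun S {}" and F0: "\<forall>y\<in>Y. F y = 0" for F
    proof -
      have "(\<forall>p\<in>units_on unit_params. F (\<Psi> p) = 0) \<or> (\<forall>p\<in>units_on unit_params. w p = 0)"
        using in_Y F0
        by (intro lfun_prod_eq_0[OF infinite_alg_closed par.fin_T par.pullback[OF F] w(1)])
           (metis mult_eq_0_iff)
      then have "\<And>p. p \<in> units_on unit_params \<Longrightarrow> F (\<Psi> p) = 0" using w(2) by blast
      then show ?thesis using par.vanish_on_closure[OF F] c eq by blast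
    qed
    then show "c \<in> zariski_closure S Y"
      using c unfolding zariski_closure_iff dual_cone_def by blast
  qed
qed

end


section \<open>Nonsingular solutions of square Laurent systems\<close>

lemma torus_units_on: "torus = units_on UNIV"
  by (simp add: torus_def units_on_def)

text \<open>Kernels of finite rank. The functions \<open>a\<close> and \<open>b\<close> may be
  arbitrary, because only the number of summands is used in
  \<open>finite_if_separated\<close>.\<close>

definition separated :: "(('d \<Rightarrow> 'k::field) \<Rightarrow> ('d \<Rightarrow> 'k) \<Rightarrow> 'k) \<Rightarrow> bool" where
  "separated h \<longleftrightarrow> (\<exists>xs. \<forall>x\<in>torus. \<forall>u\<in>torus. h x u = (\<Sum>(a, b)\<leftarrow>xs. a x * b u))"

lemma separated_elem: "separated (\<lambda>x u. a x * b u)"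
  unfolding separated_def by (rule exI[of _ "[(a, b)]"]) simp

lemma separated_const: "separated (\<lambda>x u. a)"
  using separated_elem[of "\<lambda>_. a" "\<lambda>_. 1"] by simp

lemma separated_left: "separated (\<lambda>x u. a x)"
  using separated_elem[of a "\<lambda>_. 1"] by simp

lemma separated_right: "separated (\<lambda>x u. b u)"
  using separated_elem[of "\<lambda>_. 1" b] by simp

lemma separated_add:
  assumes "separated g" "separated h"
  shows "separated (\<lambda>x u. g x u + h x u)"
proof -
  obtain xs ys where "\<forall>x\<in>torus. \<forall>u\<in>torus. g x u = (\<Sum>(a, b)\<leftarrow>xs. a x * b u)"
    "\<forall>x\<in>torus. \<forall>u\<in>torus. h x u = (\<Sum>(a, b)\<leftarrow>ys. a x * b u)"
    using assms unfolding separated_def by blast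
  then show ?thesis unfolding separated_def by (intro exI[of _ "xs @ ys"]) simp
qed

lemma separated_mult:
  assumes "separated g" "separated h"
  shows "separated (\<lambda>x u. g x u * h x u)"
proof -
  obtain xs ys where xs: "\<forall>x\<in>torus. \<forall>u\<in>torus. g x u = (\<Sum>(a, b)\<leftarrow>xs. a x * b u)"
    and ys: "\<forall>x\<in>torus. \<forall>u\<in>torus. h x u = (\<Sum>(a, b)\<leftarrow>ys. a x * b u)"
    using assms unfolding separated_def by blast
  have scale: "separated (\<lambda>x u. a x * b u * h x u)" for a b
  proof -
    have "(\<Sum>(a', b')\<leftarrow>map (\<lambda>(a', b'). (\<lambda>x. a x * a' x, \<lambda>u. b u * b' u)) ys. a' x * b' u) =
      a x * b u * (\<Sum>(a', b')\<leftarrow>ys. a' x * b' u)" for x u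
      by (induction ys) (auto simp: algebra_simps)
    then show ?thesis unfolding separated_def using ys
      by (intro exI[of _ "map (\<lambda>(a', b'). (\<lambda>x. a x * a' x, \<lambda>u. b u * b' u)) ys"]) simp
  qed
  have "separated (\<lambda>x u. (\<Sum>(a, b)\<leftarrow>xs. a x * b u) * h x u)"
  proof (induction xs)
    case Nil
    then show ?case using separated_const[of 0] by simp
  next
    case (Cons ab xs)
    obtain a b where "ab = (a, b)" by (cases ab)
    then show ?case using separated_add[OF scale[of a b] Cons] by (simp add: distrib_right)
  qed
  then show ?thesis using xs unfolding separated_def by auto
qed

lemma separated_sum: "(\<And>i. i \<in> I \<Longrightarrow> separated (h i)) \<Longrightarrow> separated (\<lambda>x u. \<Sum>i\<in>I. h i x u)"
  by (induction I rule: infinite_finite_induct) (simp_all add: separated_const separated_add)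

lemma separated_prod: "(\<And>i. i \<in> I \<Longrightarrow> separated (h i)) \<Longrightarrow> separated (\<lambda>x u. \<Prod>i\<in>I. h i x u)"
  by (induction I rule: infinite_finite_induct) (simp_all add: separated_const separated_mult)

text \<open>
  The functions \<open>h(-, u)\<close>, \<open>u \<in> X\<close>, are linearly independent and lie in a space of finite
  dimension.
\<close>

lemma finite_if_separated:
  fixes h :: "('d \<Rightarrow> 'k::field) \<Rightarrow> ('d \<Rightarrow> 'k) \<Rightarrow> 'k"
  assumes sep: "separated h" and X: "X \<subseteq> torus"
    and h: "\<And>x u. x \<in> X \<Longrightarrow> u \<in> X \<Longrightarrow> h x u = 0 \<longleftrightarrow> x \<noteq> u"
  shows "finite X"
proof (rule ccontr)
  assume inf: "infinite X"
  obtain xs where xs: "\<And>x u. x \<in> torus \<Longrightarrow> u \<in> torus \<Longrightarrow> h x u = (\<Sum>(a, b)\<leftarrow>xs. a x * b u)"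
    using sep unfolding separated_def by blast
  let ?n = "length xs"
  have h_sum: "h x u = (\<Sum>k<?n. fst (xs ! k) x * snd (xs ! k) u)" if "x \<in> torus" "u \<in> torus" for x u
    by (simp add: xs[OF that] sum_list_sum_nth atLeast0LessThan case_prod_beta)
  obtain F where F: "F \<subseteq> X" "finite F" "card F = Suc ?n"
    using infinite_arbitrarily_large[OF inf] by blast
  obtain b where b: "\<exists>u\<in>F. b u \<noteq> 0" "\<And>k. k < ?n \<Longrightarrow> (\<Sum>u\<in>F. b u * snd (xs ! k) u) = 0"
    using underdetermined_system[of "{..<?n}" F "\<lambda>u k. snd (xs ! k) u"] F by auto
  have "b x = 0" if x: "x \<in> F" for x
  proof -
    have "(\<Sum>u\<in>F. b u * h x u) = (\<Sum>u\<in>F. \<Sum>k<?n. fst (xs ! k) x * (b u * snd (xs ! k) u))"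
    proof (intro sum.cong refl)
      fix u assume "u \<in> F"
      then have "x \<in> torus" "u \<in> torus" using x F(1) X by auto
      then show "b u * h x u = (\<Sum>k<?n. fst (xs ! k) x * (b u * snd (xs ! k) u))"
        by (simp add: h_sum sum_distrib_left mult_ac)
    qed
    also have "\<dots> = 0"
      using b(2) by (subst sum.swap) (simp add: sum_distrib_left[symmetric])
    also have "(\<Sum>u\<in>F. b u * h x u) = (\<Sum>u\<in>{x}. b u * h x u)"
      using F x h by (intro sum.mono_neutral_right) auto
    finally show ?thesis using h[of x x] x F(1) by auto
  qed
  then show False using b(1) by blast
qed

section \<open>Difference quotients of Laurent polynomials\<close>

text \<open>An algebraic form of Hadamard's lemma: the difference quotients \<open>H\<close>
  restrict to the gradient on the diagonal, in every characteristic. Separatedness passes from them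
  to the determinant of their matrix.\<close>

definition has_gradient :: "(('d::finite \<Rightarrow> 'k::field) \<Rightarrow> 'k) \<Rightarrow> ('d \<Rightarrow> ('d \<Rightarrow> 'k) \<Rightarrow> 'k) \<Rightarrow> bool" where
  "has_gradient F G \<longleftrightarrow> (\<exists>H. (\<forall>j. separated (H j)) \<and>
     (\<forall>x\<in>torus. \<forall>u\<in>torus. F x - F u = (\<Sum>j\<in>UNIV. H j x u * (x j - u j))) \<and>
     (\<forall>u\<in>torus. \<forall>j. H j u u = G j u))"

lemma has_gradientI:
  assumes "\<And>j. separated (H j)"
    and "\<And>x u. x \<in> torus \<Longrightarrow> u \<in> torus \<Longrightarrow> F x - F u = (\<Sum>j\<in>UNIV. H j x u * (x j - u j))"
    and "\<And>u j. u \<in> torus \<Longrightarrow> H j u u = G j u"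
  shows "has_gradient F G"
  unfolding has_gradient_def using assms by (intro exI[of _ H]) simp

lemma has_gradientE:
  assumes "has_gradient F G"
  obtains H where "\<And>j. separated (H j)"
    "\<And>x u. x \<in> torus \<Longrightarrow> u \<in> torus \<Longrightarrow> F x - F u = (\<Sum>j\<in>UNIV. H j x u * (x j - u j))"
    "\<And>u j. u \<in> torus \<Longrightarrow> H j u u = G j u"
proof -
  obtain H where H: "(\<forall>j. separated (H j)) \<and>
     (\<forall>x\<in>torus. \<forall>u\<in>torus. F x - F u = (\<Sum>j\<in>UNIV. H j x u * (x j - u j))) \<and>
     (\<forall>u\<in>torus. \<forall>j. H j u u = G j u)"
    using assms unfolding has_gradient_def ..
  show thesis by (rule that[of H]) (simp_all add: H)
qed

lemma has_gradient_cong: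
  assumes "has_gradient F G" "\<And>x. x \<in> torus \<Longrightarrow> F' x = F x" "\<And>j x. x \<in> torus \<Longrightarrow> G' j x = G j x"
  shows "has_gradient F' G'"
proof (rule has_gradientE[OF assms(1)])
  fix H assume H: "\<And>j. separated (H j)"
    "\<And>x u. x \<in> torus \<Longrightarrow> u \<in> torus \<Longrightarrow> F x - F u = (\<Sum>j\<in>UNIV. H j x u * (x j - u j))"
    "\<And>u j. u \<in> torus \<Longrightarrow> H j u u = G j u"
  show ?thesis by (rule has_gradientI[of H]) (simp_all add: H assms(2,3))
qed

lemma has_gradient_const: "has_gradient (\<lambda>_. a) (\<lambda>_ _. 0)"
  by (rule has_gradientI[of "\<lambda>_ _ _. 0"]) (simp_all add: separated_const)

lemma has_gradient_add:
  assumes "has_gradient F G" "has_gradient F' G'"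
  shows "has_gradient (\<lambda>x. F x + F' x) (\<lambda>j x. G j x + G' j x)"
proof (rule has_gradientE[OF assms(1)], rule has_gradientE[OF assms(2)])
  fix H H' assume H: "\<And>j. separated (H j)"
    "\<And>x u. x \<in> torus \<Longrightarrow> u \<in> torus \<Longrightarrow> F x - F u = (\<Sum>j\<in>UNIV. H j x u * (x j - u j))"
    "\<And>u j. u \<in> torus \<Longrightarrow> H j u u = G j u"
  and H': "\<And>j. separated (H' j)"
    "\<And>x u. x \<in> torus \<Longrightarrow> u \<in> torus \<Longrightarrow> F' x - F' u = (\<Sum>j\<in>UNIV. H' j x u * (x j - u j))"
    "\<And>u j. u \<in> torus \<Longrightarrow> H' j u u = G' j u"
  show ?thesis
  proof (rule has_gradientI[of "\<lambda>j x u. H j x u + H' j x u"])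
    fix x u :: "'a \<Rightarrow> 'b" assume xu: "x \<in> torus" "u \<in> torus"
    have "F x + F' x - (F u + F' u) = (F x - F u) + (F' x - F' u)" by simp
    then show "F x + F' x - (F u + F' u) = (\<Sum>j\<in>UNIV. (H j x u + H' j x u) * (x j - u j))"
      unfolding H(2)[OF xu] H'(2)[OF xu] by (simp only: distrib_right sum.distrib)
  qed (simp_all add: H H' separated_add)
qed

lemma has_gradient_mult:
  assumes "has_gradient F G" "has_gradient F' G'"
  shows "has_gradient (\<lambda>x. F x * F' x) (\<lambda>j x. F x * G' j x + F' x * G j x)"
proof (rule has_gradientE[OF assms(1)], rule has_gradientE[OF assms(2)])
  fix H H' assume H: "\<And>j. separated (H j)"
    "\<And>x u. x \<in> torus \<Longrightarrow> u \<in> torus \<Longrightarrow> F x - F u = (\<Sum>j\<in>UNIV. H j x u * (x j - u j))"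
    "\<And>u j. u \<in> torus \<Longrightarrow> H j u u = G j u"
  and H': "\<And>j. separated (H' j)"
    "\<And>x u. x \<in> torus \<Longrightarrow> u \<in> torus \<Longrightarrow> F' x - F' u = (\<Sum>j\<in>UNIV. H' j x u * (x j - u j))"
    "\<And>u j. u \<in> torus \<Longrightarrow> H' j u u = G' j u"
  show ?thesis
  \<comment> \<open>Evaluating \<open>F\<close> at \<open>x\<close> and \<open>F'\<close> at
    \<open>u\<close> makes the product difference telescope exactly.\<close>
  proof (rule has_gradientI[of "\<lambda>j x u. F x * H' j x u + F' u * H j x u"])
    show "separated (\<lambda>x u. F x * H' j x u + F' u * H j x u)" for j
      by (intro separated_add separated_mult separated_left separated_right H H')
    fix x u :: "'a \<Rightarrow> 'b" assume xu: "x \<in> torus" "u \<in> torus"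
    have "F x * F' x - F u * F' u = F x * (F' x - F' u) + F' u * (F x - F u)"
      by (simp add: algebra_simps)
    then show "F x * F' x - F u * F' u =
        (\<Sum>j\<in>UNIV. (F x * H' j x u + F' u * H j x u) * (x j - u j))"
      unfolding H(2)[OF xu] H'(2)[OF xu]
      by (simp only: distrib_right sum.distrib sum_distrib_left mult.assoc)
  qed (simp_all add: H H')
qed

lemma has_gradient_cmult:
  "has_gradient F G \<Longrightarrow> has_gradient (\<lambda>x. a * F x) (\<lambda>j x. a * G j x)"
  using has_gradient_mult[OF has_gradient_const, of F G a] by simp

lemma has_gradient_sum:
  "(\<And>i. i \<in> I \<Longrightarrow> has_gradient (F i) (G i)) \<Longrightarrow>
    has_gradient (\<lambda>x. \<Sum>i\<in>I. F i x) (\<lambda>j x. \<Sum>i\<in>I. G i j x)"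
  by (induction I rule: infinite_finite_induct) (simp_all add: has_gradient_const has_gradient_add)

lemma has_gradient_coord: "has_gradient (\<lambda>x. x v) (\<lambda>j _. if j = v then 1 else 0)"
proof (rule has_gradientI[of "\<lambda>j _ _. if j = v then 1 else 0"])
  fix x u :: "'a \<Rightarrow> 'b"
  have "(\<Sum>j\<in>UNIV. (if j = v then 1 else 0) * (x j - u j)) = (\<Sum>j\<in>UNIV. if j = v then x j - u j else 0)"
    by (intro sum.cong) auto
  then show "x v - u v = (\<Sum>j\<in>UNIV. (if j = v then 1 else 0) * (x j - u j))" by simp
qed (simp_all add: separated_const)

lemma has_gradient_inverse:
  "has_gradient (\<lambda>x. inverse (x v)) (\<lambda>j x. if j = v then - inverse (x v) * inverse (x v) else 0)"
proof (rule has_gradientI[of "\<lambda>j x u. if j = v then - inverse (x v) * inverse (u v) else 0"])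
  show "separated (\<lambda>x u. if j = v then - inverse (x v) * inverse (u v) else 0)" for j
    using separated_elem[of "\<lambda>x. - inverse (x v)" "\<lambda>u. inverse (u v)"] separated_const[of 0]
    by (cases "j = v") simp_all
  fix x u :: "'a \<Rightarrow> 'b" assume "x \<in> torus" "u \<in> torus"
  then have "x v \<noteq> 0" "u v \<noteq> 0" by (simp_all add: torus_def)
  then have "inverse (x v) - inverse (u v) = - inverse (x v) * inverse (u v) * (x v - u v)"
    by (simp add: field_simps)
  also have "\<dots> = (\<Sum>j\<in>UNIV. if j = v then - inverse (x v) * inverse (u v) * (x j - u j) else 0)"
    by simp
  also have "\<dots> = (\<Sum>j\<in>UNIV. (if j = v then - inverse (x v) * inverse (u v) else 0) * (x j - u j))"
    by (intro sum.cong) auto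
  finally show "inverse (x v) - inverse (u v) =
    (\<Sum>j\<in>UNIV. (if j = v then - inverse (x v) * inverse (u v) else 0) * (x j - u j))" .
qed simp

lemma has_gradient_power_int:
  fixes v :: "'d::finite" and k :: int
  shows "has_gradient (\<lambda>x :: 'd \<Rightarrow> 'k::field. x v powi k)
    (\<lambda>j x. if j = v then of_int k * inverse (x v) * x v powi k else 0)"
proof (induction k rule: int_induct[where k = 0])
  case base
  show ?case by (rule has_gradient_cong[OF has_gradient_const[of 1]]) simp_all
next
  case (step1 i)
  show ?case
    by (rule has_gradient_cong[OF has_gradient_mult[OF step1(2) has_gradient_coord[of v]]])
       (auto simp: torus_def power_int_add field_simps)
next
  case (step2 i)
  show ?case
    by (rule has_gradient_cong[OF has_gradient_mult[OF step2(2) has_gradient_inverse[of v]]])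
       (auto simp: torus_def power_int_diff field_simps)
qed

lemma laurent_monomial_minus_axis:
  assumes x: "x \<in> torus"
  shows "laurent_monomial x (a - axis l 1) = inverse (x l) * laurent_monomial x a"
proof -
  have "laurent_monomial x (- axis l 1) = (\<Prod>j\<in>UNIV. if j = l then inverse (x j) else 1)"
    unfolding laurent_monomial_def by (intro prod.cong) (auto simp: axis_def)
  then have "laurent_monomial x (- axis l 1) = inverse (x l)" by simp
  then show ?thesis using laurent_monomial_add[OF x, of "- axis l 1" a] by simp
qed

lemma has_gradient_monomial:
  "has_gradient (\<lambda>x :: 'd::finite \<Rightarrow> 'k::field. laurent_monomial x a)
    (\<lambda>j x. of_int (a $ j) * laurent_monomial x (a - axis j 1))"
proof -
  have *: "has_gradient (\<lambda>x :: 'd \<Rightarrow> 'k. \<Prod>j\<in>J. x j powi (a $ j))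
    (\<lambda>l x. (if l \<in> J then of_int (a $ l) * inverse (x l) else 0) * (\<Prod>j\<in>J. x j powi (a $ j)))" for J
  proof (induction J rule: infinite_finite_induct)
    case (insert i J)
    show ?case
      by (rule has_gradient_cong[OF has_gradient_mult[OF has_gradient_power_int[of i "a $ i"] insert.IH]])
         (use insert.hyps in \<open>auto simp: algebra_simps\<close>)
  qed (simp_all add: has_gradient_const)
  show ?thesis
    by (rule has_gradient_cong[OF *[of UNIV]])
       (simp_all add: laurent_monomial_def[symmetric] laurent_monomial_minus_axis mult.assoc)
qed

lemma has_gradient_laurent_poly:
  "has_gradient (laurent_poly A c i) (\<lambda>j x. laurent_gradient A c i x $ j)"
  unfolding laurent_poly_def[abs_def] laurent_gradient_def vec_lambda_beta
  by (intro has_gradient_sum has_gradient_cmult has_gradient_monomial)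

text \<open>\<open>y\<close> lies in the left kernel of the Jacobian matrix at
  \<open>x\<close>.\<close>

definition gradient_relation ::
  "('n::finite \<Rightarrow> (int ^ 'n) set) \<Rightarrow> ('n \<times> (int ^ 'n) \<Rightarrow> 'k::field) \<Rightarrow> ('n \<Rightarrow> 'k) \<Rightarrow> ('n \<Rightarrow> 'k) \<Rightarrow> bool" where
  "gradient_relation A c x y \<longleftrightarrow> (\<forall>j. (\<Sum>i\<in>UNIV. y i * laurent_gradient A c i x $ j) = 0)"

text \<open>
  The difference quotients form a matrix \<open>H(x, u)\<close> with \<open>f(x) - f(u) = H(x, u) (x - u)\<close>, so its
  determinant vanishes at two distinct solutions, while \<open>det H(u, u)\<close> is the Jacobian.
\<close>

lemma finite_nonsingular_solutions:
  fixes A :: "'n::finite \<Rightarrow> (int ^ 'n) set" and c :: "'n \<times> (int ^ 'n) \<Rightarrow> 'k::field"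
  shows "finite {x \<in> solutions A c. \<forall>y. gradient_relation A c x y \<longrightarrow> (\<forall>i. y i = 0)}"
proof -
  have "\<forall>i. \<exists>H. (\<forall>j. separated (H j)) \<and>
     (\<forall>x\<in>torus. \<forall>u\<in>torus. laurent_poly A c i x - laurent_poly A c i u =
        (\<Sum>j\<in>UNIV. H j x u * (x j - u j))) \<and>
     (\<forall>u\<in>torus. \<forall>j. H j u u = laurent_gradient A c i u $ j)"
    using has_gradient_laurent_poly unfolding has_gradient_def by blast
  from choice[OF this] obtain H where H0: "\<forall>i. (\<forall>j. separated (H i j)) \<and>
     (\<forall>x\<in>torus. \<forall>u\<in>torus. laurent_poly A c i x - laurent_poly A c i u =
        (\<Sum>j\<in>UNIV. H i j x u * (x j - u j))) \<and>
     (\<forall>u\<in>torus. \<forall>j. H i j u u = laurent_gradient A c i u $ j)" ..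
  have H: "separated (H i j)"
    "x \<in> torus \<Longrightarrow> u \<in> torus \<Longrightarrow> laurent_poly A c i x - laurent_poly A c i u =
        (\<Sum>j\<in>UNIV. H i j x u * (x j - u j))"
    "u \<in> torus \<Longrightarrow> H i j u u = laurent_gradient A c i u $ j" for i j x u
    using H0 by simp_all
  define h where "h x u = det ((\<chi> i j. H i j x u) :: 'k ^ 'n ^ 'n)" for x u
  show ?thesis
  proof (rule finite_if_separated)
    show "separated h"
      unfolding h_def[abs_def] det_def
      by (intro separated_sum separated_mult separated_prod separated_const)
         (simp add: H(1))
    fix x u
    assume x: "x \<in> {x \<in> solutions A c. \<forall>y. gradient_relation A c x y \<longrightarrow> (\<forall>i. y i = 0)}"
      and u: "u \<in> {x \<in> solutions A c. \<forall>y. gradient_relation A c x y \<longrightarrow> (\<forall>i. y i = 0)}"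
    have t: "x \<in> torus" "u \<in> torus" using x u by (auto simp: solutions_def)
    show "h x u = 0 \<longleftrightarrow> x \<noteq> u"
    proof (cases "x = u")
      case True
      let ?J = "(\<chi> i j. H i j u u) :: 'k ^ 'n ^ 'n"
      have "\<forall>y. transpose ?J *v y = 0 \<longrightarrow> y = 0"
      proof (intro allI impI)
        fix y assume "transpose ?J *v y = 0"
        then have "gradient_relation A c u (\<lambda>i. y $ i)"
          by (simp add: gradient_relation_def matrix_vector_mult_def transpose_def vec_eq_iff
              H(3)[OF t(2)] mult.commute)
        then show "y = 0" using u by (simp add: vec_eq_iff)
      qed
      then have "invertible (transpose ?J)"
        using matrix_left_invertible_ker invertible_left_inverse by blast
      then have "det (transpose ?J) \<noteq> 0" by (simp add: invertible_det_nz)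
      then show ?thesis using True by (simp add: h_def det_transpose)
    next
      case False
      let ?J = "(\<chi> i j. H i j x u) :: 'k ^ 'n ^ 'n"
      have "laurent_poly A c i x - laurent_poly A c i u = 0" for i
        using x u by (simp add: solutions_def)
      then have "?J *v (\<chi> j. x j - u j) = 0"
        using H(2)[OF t] by (simp add: matrix_vector_mult_def vec_eq_iff)
      moreover have "(\<chi> j. x j - u j) \<noteq> (0 :: 'k ^ 'n)"
        using False by (auto simp: vec_eq_iff)
      ultimately have "\<not> invertible ?J"
        using matrix_left_invertible_ker[of ?J] unfolding invertible_left_inverse by blast
      then show ?thesis using False by (simp add: h_def invertible_det_nz)
    qed
  qed (auto simp: solutions_def)
qed

text \<open>Injectivity is absorbed by the coefficient condition: two equal vectors satisfy a
  relation with coefficients 1 and -1.\<close>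

lemma independent_family_iff:
  fixes v :: "'i \<Rightarrow> 'k::field ^ 'n"
  assumes I: "finite I"
  shows "independent_family v I \<longleftrightarrow>
    (\<forall>y. (\<forall>j. (\<Sum>i\<in>I. y i * v i $ j) = 0) \<longrightarrow> (\<forall>i\<in>I. y i = 0))"
proof
  assume ind: "independent_family v I"
  then have inj: "inj_on v I" by (simp add: independent_family_def)
  show "\<forall>y. (\<forall>j. (\<Sum>i\<in>I. y i * v i $ j) = 0) \<longrightarrow> (\<forall>i\<in>I. y i = 0)"
  proof (intro allI impI ballI)
    fix y i assume y: "\<forall>j. (\<Sum>i\<in>I. y i * v i $ j) = 0" and i: "i \<in> I"
    let ?u = "\<lambda>w. y (inv_into I v w)"
    have "(\<Sum>w\<in>v ` I. ?u w *s w) = (\<Sum>i\<in>I. y i *s v i)"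
      using inj by (simp add: sum.reindex)
    also have "\<dots> = 0" using y by (simp add: vec_eq_iff)
    finally have "?u (v i) = 0"
      using ind I i by (intro vec.independentD[of "v ` I" "v ` I"]) (auto simp: independent_family_def)
    then show "y i = 0" using inj i by simp
  qed
next
  assume y: "\<forall>y. (\<forall>j. (\<Sum>i\<in>I. y i * v i $ j) = 0) \<longrightarrow> (\<forall>i\<in>I. y i = 0)"
  have inj: "inj_on v I"
  proof (rule inj_onI, rule ccontr)
    fix i k assume ik: "i \<in> I" "k \<in> I" "v i = v k" "i \<noteq> k"
    define z where "z l = (if l = i then 1 else if l = k then - 1 else (0 :: 'k))" for l
    have "(\<Sum>l\<in>I. z l * v l $ j) = 0" for j
    proof -
      have "(\<Sum>l\<in>I. z l * v l $ j) = (\<Sum>l\<in>{i, k}. z l * v l $ j)"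
        using ik I by (intro sum.mono_neutral_right) (auto simp: z_def)
      then show ?thesis using ik by (simp add: z_def)
    qed
    then have "z i = 0" using y ik(1) by blast
    then show False by (simp add: z_def)
  qed
  moreover have "vec.independent (v ` I)"
  proof (rule vec.independent_if_scalars_zero)
    fix f x assume z: "(\<Sum>x\<in>v ` I. f x *s x) = 0" and "x \<in> v ` I"
    then obtain i where i: "i \<in> I" "x = v i" by blast
    have "(\<Sum>i\<in>I. f (v i) *s v i) = 0" using z inj by (simp add: sum.reindex)
    then have "\<forall>j. (\<Sum>i\<in>I. f (v i) * v i $ j) = 0" by (simp add: vec_eq_iff)
    then have "\<forall>i\<in>I. f (v i) = 0" using spec[OF y, of "\<lambda>i. f (v i)"] by simp
    then show "f x = 0" using i by simp
  qed (use I in simp)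
  ultimately show "independent_family v I" by (simp add: independent_family_def)
qed

text \<open>Closures are tested with polynomials, whereas gradients are Laurent functions; a
  denominator without zeros on \<open>units_on T\<close> bridges the two.\<close>

lemma lfun_clear_denominators:
  fixes F :: "('v \<Rightarrow> 'k::field) \<Rightarrow> 'k"
  shows "F \<in> lfun V T \<Longrightarrow> T \<subseteq> V \<Longrightarrow>
    \<exists>G\<in>lfun V {}. \<exists>E\<in>lfun V {}. \<forall>x\<in>units_on T. E x \<noteq> 0 \<and> F x * E x = G x"
proof (induction rule: lfun.induct)
  case (const a)
  show ?case
    by (rule bexI[of _ "\<lambda>_. a"], rule bexI[of _ "\<lambda>_. 1"]) (simp_all add: lfun.const)
next
  case (var v)
  then show ?case
    by - (rule bexI[of _ "\<lambda>x. x v"], rule bexI[of _ "\<lambda>_. 1"], simp_all add: lfun.const lfun.var)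
next
  case (inv v)
  then show ?case
    by - (rule bexI[of _ "\<lambda>_. 1"], rule bexI[of _ "\<lambda>x. x v"],
        auto simp: units_on_def intro: lfun.const lfun.var)
next
  case (add F G)
  then obtain P E P' E' where *: "P \<in> lfun V {}" "E \<in> lfun V {}" "P' \<in> lfun V {}" "E' \<in> lfun V {}"
    "\<And>x. x \<in> units_on T \<Longrightarrow> E x \<noteq> 0 \<and> F x * E x = P x"
    "\<And>x. x \<in> units_on T \<Longrightarrow> E' x \<noteq> 0 \<and> G x * E' x = P' x" by metis
  show ?case
  proof (rule bexI[of _ "\<lambda>x. P x * E' x + P' x * E x"], rule bexI[of _ "\<lambda>x. E x * E' x"],
      intro ballI conjI)
    fix x :: "'v \<Rightarrow> 'k" assume x: "x \<in> units_on T"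
    show "E x * E' x \<noteq> 0" using *(5,6)[OF x] by simp
    have "P x = F x * E x" "P' x = G x * E' x" using *(5,6)[OF x] by simp_all
    then show "(F x + G x) * (E x * E' x) = P x * E' x + P' x * E x" by (simp add: algebra_simps)
  qed (intro lfun.add lfun.mult *)+
next
  case (mult F G)
  then obtain P E P' E' where *: "P \<in> lfun V {}" "E \<in> lfun V {}" "P' \<in> lfun V {}" "E' \<in> lfun V {}"
    "\<And>x. x \<in> units_on T \<Longrightarrow> E x \<noteq> 0 \<and> F x * E x = P x"
    "\<And>x. x \<in> units_on T \<Longrightarrow> E' x \<noteq> 0 \<and> G x * E' x = P' x" by metis
  show ?case
  proof (rule bexI[of _ "\<lambda>x. P x * P' x"], rule bexI[of _ "\<lambda>x. E x * E' x"],
      intro ballI conjI)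
    fix x :: "'v \<Rightarrow> 'k" assume x: "x \<in> units_on T"
    show "E x * E' x \<noteq> 0" using *(5,6)[OF x] by simp
    have "P x = F x * E x" "P' x = G x * E' x" using *(5,6)[OF x] by simp_all
    then show "(F x * G x) * (E x * E' x) = P x * P' x" by (simp add: algebra_simps)
  qed (intro lfun.mult *)+
qed

lemma zariski_closure_torusD:
  assumes u: "u \<in> zariski_closure UNIV Y" "u \<in> torus" and Y: "Y \<subseteq> torus"
    and F: "F \<in> lfun UNIV UNIV" "\<And>y. y \<in> Y \<Longrightarrow> F y = 0"
  shows "F u = 0"
proof -
  obtain G E where GE: "G \<in> lfun UNIV {}" "\<And>x. x \<in> torus \<Longrightarrow> E x \<noteq> 0 \<and> F x * E x = G x"
    using lfun_clear_denominators[OF F(1)] unfolding torus_units_on by blast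
  have "G y = 0" if y: "y \<in> Y" for y
  proof -
    have "y \<in> torus" using Y y by blast
    then have "G y = F y * E y" using GE(2)[of y] by simp
    then show ?thesis using F(2)[OF y] by simp
  qed
  then have "G u = 0" by (rule zariski_closureD[OF u(1) GE(1)])
  then show ?thesis using GE(2)[OF u(2)] by auto
qed


section \<open>Cayley matrices\<close>

lemma prod_sum_type: "(\<Prod>r\<in>UNIV. f r) = (\<Prod>i\<in>UNIV. f (Inl i)) * (\<Prod>j\<in>UNIV. f (Inr j))"
  for f :: "'a::finite + 'b::finite \<Rightarrow> 'k::comm_monoid_mult"
  by (simp only: UNIV_Plus_UNIV[symmetric] prod.Plus[OF finite finite] o_def)

lemma laurent_monomial_cayley:
  "laurent_monomial t (cayley_matrix (i, a)) = t (Inl i) * laurent_monomial (\<lambda>j. t (Inr j)) a"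
proof -
  have "(\<Prod>k\<in>UNIV. t (Inl k) powi (if k = i then 1 else 0)) =
      (\<Prod>k\<in>UNIV. if k = i then t (Inl k) else 1)"
    by (intro prod.cong) auto
  then show ?thesis
    by (simp add: laurent_monomial_def prod_sum_type cayley_matrix_def)
qed

text \<open>A relation with \<open>y k = 0\<close> would be one among the remaining gradients. Thus
  independence of any \<open>n - 1\<close> gradients is what puts a nonzero relation into the
  torus.\<close>

lemma full_support:
  fixes A :: "'n::finite \<Rightarrow> (int ^ 'n) set" and c :: "'n \<times> (int ^ 'n) \<Rightarrow> 'k::field"
  assumes ind: "independent_family (\<lambda>i. laurent_gradient A c i u) (UNIV - {k})"
    and y: "gradient_relation A c u y" "y i \<noteq> 0"
  shows "y k \<noteq> 0"
proof
  assume k: "y k = 0"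
  have "(\<Sum>i\<in>UNIV - {k}. y i * laurent_gradient A c i u $ j) = 0" for j
    using y(1) sum.remove[of UNIV k "\<lambda>i. y i * laurent_gradient A c i u $ j"] k
    by (simp add: gradient_relation_def)
  then have "\<forall>i\<in>UNIV - {k}. y i = 0"
    using ind unfolding independent_family_iff[OF finite] by blast
  then show False using y(2) k by (cases "i = k") auto
qed

lemma card_minus_1_iff: "card (I :: 'n::finite set) = CARD('n) - 1 \<longleftrightarrow> (\<exists>k. I = UNIV - {k})"
proof
  assume "card I = CARD('n) - 1"
  moreover have "card I \<le> CARD('n)" by (intro card_mono) auto
  moreover have "CARD('n) > 0" by simp
  ultimately have "card (UNIV - I) = 1" by (simp add: card_Diff_subset)
  then obtain k where "UNIV - I = {k}" by (auto simp: card_1_singleton_iff)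
  then have "I = UNIV - {k}" by blast
  then show "\<exists>k. I = UNIV - {k}" ..
next
  assume "\<exists>k. I = UNIV - {k}"
  then show "card I = CARD('n) - 1" by auto
qed

text \<open>The zero system is solved by the whole torus. There a function vanishing off
  \<open>u\<close>, multiplied by a nonzero coordinate difference, is 0 everywhere, so no point is
  isolated. This yields the condition \<open>c \<noteq> 0\<close> imposed by the dual cone.\<close>

lemma not_isolated_if_zero:
  fixes A :: "'n::finite \<Rightarrow> (int ^ 'n) set" and u :: "'n \<Rightarrow> 'k::alg_closed_field"
  shows "\<not> isolated_solution A (\<lambda>_. 0) u"
proof
  assume iso: "isolated_solution A (\<lambda>_. 0) u"
  have sol: "solutions A (\<lambda>_. 0 :: 'k) = torus" by (simp add: solutions_def laurent_poly_def)
  have u: "u \<in> torus" using iso unfolding isolated_solution_def sol by blast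
  have "F u = 0" if F: "F \<in> lfun UNIV {}" and F0: "\<forall>y\<in>torus - {u}. F y = 0" for F
  proof -
    obtain j :: 'n where True by blast
    have "(\<forall>p\<in>units_on UNIV. F p = 0) \<or> (\<forall>p\<in>units_on UNIV. p j - u j = 0)"
    proof (rule lfun_prod_eq_0[OF infinite_alg_closed])
      show "F \<in> lfun UNIV UNIV" by (rule lfun_mono[OF F]) auto
      show "(\<lambda>p. p j - u j) \<in> lfun UNIV UNIV" by (intro lfun_diff lfun.const lfun.var) simp
      fix p :: "'n \<Rightarrow> 'k" assume "p \<in> units_on UNIV"
      then show "F p * (p j - u j) = 0"
        using F0 by (cases "p = u") (auto simp: torus_units_on)
    qed simp
    moreover have "\<exists>p\<in>units_on UNIV. p j - u j \<noteq> (0 :: 'k)"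
    proof -
      obtain z where z: "z \<notin> {0, u j}"
        using infinite_alg_closed ex_new_if_finite[of "{0, u j}"] by blast
      then show ?thesis by (intro bexI[of _ "\<lambda>_. z"]) (simp_all add: units_on_def)
    qed
    ultimately show ?thesis using u by (auto simp: torus_units_on)
  qed
  then have "u \<in> zariski_closure UNIV (torus - {u})"
    unfolding zariski_closure_iff coord_space_def by blast
  then show False using iso unfolding isolated_solution_def sol by blast
qed

section \<open>Critical points of the Cayley configuration and multiple roots\<close>

locale cayley_configuration =
  fixes K :: "'k::alg_closed_field itself" and A :: "'n::finite \<Rightarrow> (int ^ 'n) set"
    and b :: "'n + 'n \<Rightarrow> 'n \<times> (int ^ 'n)"
  assumes finite_A: "finite (A i)" and b_index: "b q \<in> cayley_index A" and b_inj: "inj b"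
    and b_det: "(of_int (det (\<chi> r q. cayley_matrix (b q) $ r)) :: 'k) \<noteq> 0"
begin

sublocale graded_toric K "cayley_index A" cayley_matrix b "range Inl"
proof
  show "finite (cayley_index A)" using finite_A by (simp add: cayley_index_def)
  show "(\<Sum>r\<in>range Inl. cayley_matrix s $ r) = 1" if "s \<in> cayley_index A" for s
    by (cases s) (simp add: sum.reindex cayley_matrix_def)
qed (simp_all add: b_index b_inj b_det)

lemma sum_cayley_index: "(\<Sum>s\<in>cayley_index A. f s) = (\<Sum>i\<in>UNIV. \<Sum>a\<in>A i. f (i, a))"
  unfolding cayley_index_def using finite_A by (subst sum.Sigma) (auto simp: case_prod_beta)

text \<open>The rows \<open>Inl k\<close> give the polynomials \<open>y_k f_k\<close>, the rows
  \<open>Inr j\<close> give \<open>x_j\<close> times the \<open>j\<close>-th entry of the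
  combination of the gradients with coefficients \<open>y\<close>; the factors \<open>y_k\<close>
  and \<open>x_j\<close> are units.\<close>

lemma crit_cayley:
  assumes t: "t \<in> torus"
  shows "crit c t \<longleftrightarrow> (\<lambda>j. t (Inr j)) \<in> solutions A c \<and>
    gradient_relation A c (\<lambda>j. t (Inr j)) (\<lambda>i. t (Inl i))"
proof -
  let ?x = "\<lambda>j. t (Inr j)"
  let ?f = "\<lambda>r. \<Sum>s\<in>cayley_index A. c s * laurent_monomial t (cayley_matrix s) *
      of_int (cayley_matrix s $ r)"
  have x: "?x \<in> torus" using t by (simp add: torus_def)
  have t0: "t r \<noteq> 0" for r using t by (simp add: torus_def)
  have inl: "?f (Inl k) = t (Inl k) * laurent_poly A c k ?x" for k
  proof -
    have "?f (Inl k) = (\<Sum>i\<in>UNIV. if i = k then t (Inl k) * laurent_poly A c k ?x else 0)"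
      unfolding sum_cayley_index laurent_monomial_cayley
      by (intro sum.cong) (auto simp: cayley_matrix_def laurent_poly_def sum_distrib_left mult_ac)
    then show ?thesis by simp
  qed
  have inr: "?f (Inr j) = ?x j * (\<Sum>i\<in>UNIV. t (Inl i) * laurent_gradient A c i ?x $ j)" for j
  proof -
    have shift: "?x j * laurent_monomial ?x (a - axis j 1) = laurent_monomial ?x a" for a
      using t0 by (simp add: laurent_monomial_minus_axis[OF x] mult.assoc[symmetric])
    have *: "?x j * (t (Inl i) * (c (i, a) * (of_int (a $ j) * laurent_monomial ?x (a - axis j 1)))) =
        c (i, a) * (t (Inl i) * laurent_monomial ?x a) * of_int (a $ j)" for i a
      unfolding shift[symmetric, of a] by (simp only: mult_ac)
    show ?thesis
      unfolding sum_cayley_index laurent_monomial_cayley laurent_gradient_def vec_lambda_beta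
        sum_distrib_left *
      by (simp add: cayley_matrix_def)
  qed
  have "crit c t \<longleftrightarrow> (\<forall>k. ?f (Inl k) = 0) \<and> (\<forall>j. ?f (Inr j) = 0)"
    unfolding crit_def by (rule split_sum_all)
  also have "\<dots> \<longleftrightarrow> (\<forall>k. laurent_poly A c k ?x = 0) \<and>
      (\<forall>j. (\<Sum>i\<in>UNIV. t (Inl i) * laurent_gradient A c i ?x $ j) = 0)"
    unfolding inl inr using t0 by simp
  finally show ?thesis using x by (simp add: solutions_def gradient_relation_def)
qed

lemma crit_of_multiple_root:
  fixes c :: "'n \<times> (int ^ 'n) \<Rightarrow> 'k"
  assumes "nondegenerate_multiple_root A c u"
  shows "c \<noteq> 0 \<and> (\<exists>t\<in>torus. crit c t)"
proof
  have iso: "isolated_solution A c u"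
    and dep: "\<not> independent_family (\<lambda>i. laurent_gradient A c i u) UNIV"
    and ind: "independent_family (\<lambda>i. laurent_gradient A c i u) (UNIV - {k})" for k
    using assms unfolding nondegenerate_multiple_root_def card_minus_1_iff by blast+
  show "c \<noteq> 0" using iso not_isolated_if_zero[of A u] by (auto simp: zero_fun_def)
  obtain y i where y: "gradient_relation A c u y" "y i \<noteq> 0"
    using dep unfolding independent_family_iff[OF finite] gradient_relation_def by blast
  have u: "u \<in> solutions A c" using iso by (simp add: isolated_solution_def)
  let ?t = "case_sum y u"
  have "y k \<noteq> 0" for k by (rule full_support[OF ind y])
  then have "?t \<in> torus" using u by (auto simp: torus_def solutions_def split: sum.split)
  moreover from this have "crit c ?t" using crit_cayley[of ?t c] u y(1) by simp
  ultimately show "\<exists>t\<in>torus. crit c t" by - (rule bexI[of _ ?t])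
qed

lemma crit_renormalised:
  assumes x: "x \<in> solutions A c" and y: "gradient_relation A c x y" "\<And>i. y i \<noteq> 0"
    and k: "row1 = Inl k"
  shows "case_sum (\<lambda>i. y i / y k) x \<in> {t \<in> torus. t row1 = 1 \<and> crit c t}"
proof -
  have t: "case_sum (\<lambda>i. y i / y k) x \<in> torus"
    using x y(2) by (auto simp: torus_def solutions_def split: sum.split)
  have "(\<Sum>i\<in>UNIV. y i / y k * laurent_gradient A c i x $ j) =
      inverse (y k) * (\<Sum>i\<in>UNIV. y i * laurent_gradient A c i x $ j)" for j
    unfolding sum_distrib_left by (intro sum.cong) (simp_all add: field_simps)
  then have "gradient_relation A c x (\<lambda>i. y i / y k)"
    using y(1) by (simp add: gradient_relation_def)
  then have "crit c (case_sum (\<lambda>i. y i / y k) x)" using crit_cayley[OF t] x by simp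
  then show ?thesis using t y(2) by (simp add: k)
qed

text \<open>
  If the critical points of \<open>c\<close> are finite in number, the left kernel of the Jacobian at such a
  point is a line: otherwise the pencil through two kernel vectors yields infinitely many.
\<close>

lemma kernel_line:
  assumes fin: "finite {t \<in> torus. t row1 = 1 \<and> crit c t}"
    and x: "x \<in> solutions A c" and y: "gradient_relation A c x y" "\<And>i. y i \<noteq> 0"
  shows "independent_family (\<lambda>i. laurent_gradient A c i x) (UNIV - {k})"
proof (rule ccontr)
  assume "\<not> ?thesis"
  then obtain z i where z: "\<forall>j. (\<Sum>i\<in>UNIV - {k}. z i * laurent_gradient A c i x $ j) = 0"
    "i \<noteq> k" "z i \<noteq> 0"
    unfolding independent_family_iff[OF finite] by blast
  \<comment> \<open>A second kernel vector, independent of \<open>y\<close> because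
    \<open>w k = 0\<close> and \<open>y k\<close> is nonzero.\<close>
  define w where "w = z(k := 0)"
  have w: "w k = 0" "w i \<noteq> 0" using z by (auto simp: w_def)
  have wrel: "(\<Sum>i\<in>UNIV. w i * laurent_gradient A c i x $ j) = 0" for j
  proof -
    have "(\<Sum>i\<in>UNIV. w i * laurent_gradient A c i x $ j) =
        (\<Sum>i\<in>UNIV - {k}. z i * laurent_gradient A c i x $ j)"
      by (subst sum.remove[of _ k]) (auto simp: w_def intro!: sum.cong)
    then show ?thesis using z(1) by simp
  qed
  obtain l where l: "row1 = Inl l" using row1 by blast
  \<comment> \<open>Off this finite set \<open>y + e w\<close> has no zero entry. An index with
    \<open>w i = 0\<close> contributes the default quotient 0, which merely excludes one more value
    of \<open>e\<close>.\<close>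
  define bad where "bad = (\<lambda>i. - y i / w i) ` UNIV"
  define v where "v e i = y i + e * w i" for e i
  have v0: "v e i \<noteq> 0" if "e \<notin> bad" for e i
  proof
    assume v: "v e i = 0"
    then have "w i \<noteq> 0" using y(2)[of i] by (auto simp: v_def)
    moreover have "e * w i = - y i" using v by (simp add: v_def eq_neg_iff_add_eq_0 add.commute)
    ultimately have "e = - y i / w i" by (metis nonzero_mult_div_cancel_right)
    then show False using that by (simp add: bad_def)
  qed
  have vrel: "gradient_relation A c x (v e)" for e
  proof -
    have "(\<Sum>i\<in>UNIV. v e i * laurent_gradient A c i x $ j) =
      (\<Sum>i\<in>UNIV. y i * laurent_gradient A c i x $ j) +
      e * (\<Sum>i\<in>UNIV. w i * laurent_gradient A c i x $ j)" for j
      by (simp add: v_def distrib_right sum.distrib sum_distrib_left mult.assoc)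
    then show ?thesis using y(1) wrel by (simp add: gradient_relation_def)
  qed
  define T where "T e = case_sum (\<lambda>i. v e i / v e l) x" for e
  have "T e \<in> {t \<in> torus. t row1 = 1 \<and> crit c t}" if "e \<in> UNIV - bad" for e
    unfolding T_def using that by (intro crit_renormalised[OF x vrel _ l] v0) auto
  then have "T ` (UNIV - bad) \<subseteq> {t \<in> torus. t row1 = 1 \<and> crit c t}" by blast
  then have "finite (T ` (UNIV - bad))" using fin finite_subset by blast
  moreover have "inj_on T (UNIV - bad)"
  proof (rule inj_onI)
    fix e e' assume e: "e \<in> UNIV - bad" "e' \<in> UNIV - bad" and eq: "T e = T e'"
    have q: "v e i / v e l = v e' i / v e' l" for i
      using fun_cong[OF eq, of "Inl i"] by (simp add: T_def)
    have nz: "v e l \<noteq> 0" "v e' l \<noteq> 0" using e v0 by auto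
    \<comment> \<open>The \<open>k\<close>-th entry is constant along the pencil, so equal ratios
      force equal \<open>l\<close>-th entries and then equal vectors.\<close>
    have "v e k = y k" "v e' k = y k" by (simp_all add: v_def w)
    then have "v e l = v e' l" using q[of k] nz y(2)[of k] by (simp add: frac_eq_eq)
    then have "v e i = v e' i" using q[of i] nz by simp
    then show "e = e'" using w(2) by (simp add: v_def)
  qed
  ultimately have "finite (UNIV - bad)" by (rule finite_imageD)
  moreover have "finite bad" by (simp add: bad_def)
  ultimately have "finite (UNIV :: 'k set)" by simp
  then show False using infinite_alg_closed by blast
qed

lemma laurent_gradient_lfun: "(\<lambda>x. laurent_gradient A c i x $ j) \<in> lfun UNIV UNIV"
  unfolding laurent_gradient_def vec_lambda_beta laurent_monomial_def
  by (intro lfun_sum lfun_cmult lfun_prod lfun_power_int) auto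

text \<open>
  Near a critical point the gradients of any \<open>n - 1\<close> of the equations stay independent, so the
  singular solutions nearby are critical points as well, and there are only finitely many of
  them. The nonsingular solutions are finite in number anyway.
\<close>

lemma multiple_root_of_crit:
  fixes c :: "'n \<times> (int ^ 'n) \<Rightarrow> 'k"
  assumes t: "t \<in> torus" "crit c t" and fin: "finite {t \<in> torus. t row1 = 1 \<and> crit c t}"
  shows "\<exists>u. nondegenerate_multiple_root A c u"
proof -
  define u y where "u j = t (Inr j)" and "y i = t (Inl i)" for i j
  have u: "u \<in> solutions A c" and rel: "gradient_relation A c u y"
    using crit_cayley[OF t(1)] t(2) by (simp_all add: u_def[abs_def] y_def[abs_def])
  have y0: "y i \<noteq> 0" for i using t(1) by (simp add: y_def torus_def)
  have ut: "u \<in> torus" using u by (simp add: solutions_def)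
  obtain l where l: "row1 = Inl l" using row1 by blast
  note ind = kernel_line[OF fin u rel y0]
  have dep: "\<not> independent_family (\<lambda>i. laurent_gradient A c i u) UNIV"
    using rel y0 unfolding independent_family_iff[OF finite] gradient_relation_def by blast
  have "\<exists>h\<in>lfun UNIV UNIV. h u \<noteq> 0 \<and> (\<forall>x z. h x \<noteq> 0 \<longrightarrow>
      (\<forall>j\<in>UNIV. (\<Sum>i\<in>UNIV - {k}. z i * laurent_gradient A c i x $ j) = 0) \<longrightarrow>
      (\<forall>i\<in>UNIV - {k}. z i = 0))" for k
  proof (rule lfun_independence_open)
    show "\<forall>i\<in>UNIV - {k}. z i = 0"
      if "\<And>j. j \<in> UNIV \<Longrightarrow> (\<Sum>i\<in>UNIV - {k}. z i * laurent_gradient A c i u $ j) = 0" for z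
      using ind[of k] that unfolding independent_family_iff[OF finite] by blast
  qed (simp_all add: laurent_gradient_lfun)
  then have "\<forall>k. \<exists>h. h \<in> lfun UNIV UNIV \<and> h u \<noteq> 0 \<and> (\<forall>x. h x \<noteq> 0 \<longrightarrow>
      independent_family (\<lambda>i. laurent_gradient A c i x) (UNIV - {k}))"
    unfolding independent_family_iff[OF finite] by (simp add: Bex_def)
  from choice[OF this] obtain h where h0: "\<forall>k. h k \<in> lfun UNIV UNIV \<and> h k u \<noteq> 0 \<and>
      (\<forall>x. h k x \<noteq> 0 \<longrightarrow> independent_family (\<lambda>i. laurent_gradient A c i x) (UNIV - {k}))" ..
  have h: "h k \<in> lfun UNIV UNIV" "h k u \<noteq> 0"
    "h k x \<noteq> 0 \<Longrightarrow> independent_family (\<lambda>i. laurent_gradient A c i x) (UNIV - {k})" for k x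
    using h0 by simp_all
  define N where "N = {x \<in> solutions A c. \<forall>y. gradient_relation A c x y \<longrightarrow> (\<forall>i. y i = 0)}"
  define C where "C = (\<lambda>t j. t (Inr j)) ` {t \<in> torus. t row1 = 1 \<and> crit c t}"
  have finNC: "finite (N \<union> C - {u})"
    using finite_nonsingular_solutions[of A c] fin by (simp add: N_def C_def)
  have uN: "u \<notin> N" using rel y0 by (auto simp: N_def)
  have cover: "x \<in> N \<union> C" if x: "x \<in> solutions A c" and hx: "\<And>k. h k x \<noteq> 0" for x
  proof (cases "x \<in> N")
    case False
    then obtain z i where z: "gradient_relation A c x z" "z i \<noteq> 0" using x by (auto simp: N_def)
    have z0: "z k \<noteq> 0" for k by (rule full_support[OF h(3)[OF hx] z])
    have "x = (\<lambda>j. case_sum (\<lambda>i. z i / z l) x (Inr j))" by simp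
    then have "x \<in> C" unfolding C_def using crit_renormalised[OF x z(1) z0 l] by (rule image_eqI)
    then show ?thesis ..
  qed simp
  define jj where "jj x = (SOME j. u j \<noteq> x j)" for x
  have jj: "u (jj x) \<noteq> x (jj x)" if "x \<noteq> u" for x
    unfolding jj_def using that by (intro someI_ex[of "\<lambda>j. u j \<noteq> x j"]) (metis ext)
  \<comment> \<open>A Laurent function that is nonzero at \<open>u\<close> and vanishes at every
    other solution: off the zeros of the \<open>h k\<close>, only the finitely many points of
    \<open>N\<close> and \<open>C\<close> are left, and each \<open>z\<close> among them other than
    \<open>u\<close> differs from \<open>u\<close> in the coordinate \<open>jj z\<close>.\<close>
  define E where "E x = (\<Prod>k\<in>UNIV. h k x) * (\<Prod>z\<in>N \<union> C - {u}. x (jj z) - z (jj z))" for x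
  have "u \<notin> zariski_closure UNIV (solutions A c - {u})"
  proof
    assume cl: "u \<in> zariski_closure UNIV (solutions A c - {u})"
    have "E u = 0"
    proof (rule zariski_closure_torusD[OF cl ut])
      show "solutions A c - {u} \<subseteq> torus" by (auto simp: solutions_def)
      show "E \<in> lfun UNIV UNIV"
        unfolding E_def by (intro lfun.mult lfun_prod h(1) lfun_diff lfun.const lfun.var) simp
      fix x assume x: "x \<in> solutions A c - {u}"
      show "E x = 0"
      proof (cases "\<exists>k. h k x = 0")
        case True
        then show ?thesis by (auto simp: E_def)
      next
        case False
        then have "x \<in> N \<union> C - {u}" using cover x by blast
        then have "(\<Prod>z\<in>N \<union> C - {u}. x (jj z) - z (jj z)) = 0"
          using finNC by (intro prod_zero) auto
        then show ?thesis by (simp add: E_def)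
      qed
    qed
    moreover have "E u \<noteq> 0"
      using h(2) finNC jj by (auto simp: E_def)
    ultimately show False by contradiction
  qed
  then have "isolated_solution A c u" using u by (simp add: isolated_solution_def)
  then have "nondegenerate_multiple_root A c u"
    using dep ind unfolding nondegenerate_multiple_root_def card_minus_1_iff by blast
  then show ?thesis by (rule exI[of _ u])
qed

lemma hypersurface_discriminantal_variety:
  assumes "hypersurface (cayley_index A) (discriminantal_variety A :: ('n \<times> (int ^ 'n) \<Rightarrow> 'k) set) \<or>
    hypersurface (cayley_index A) (dual_cone (cayley_index A) X)"
  shows "discriminantal_variety A = dual_cone (cayley_index A) X"
proof -
  let ?S = "cayley_index A"
  let ?L = "{c \<in> coord_space ?S. \<exists>u. nondegenerate_multiple_root A c u} :: ('n \<times> (int ^ 'n) \<Rightarrow> 'k) set"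
  have "?L \<subseteq> {c \<in> coord_space ?S. c \<noteq> 0 \<and> (\<exists>t\<in>torus. crit c t)}"
    using crit_of_multiple_root by blast
  then have sub: "discriminantal_variety A \<subseteq> dual_cone ?S X"
    unfolding discriminantal_variety_def dual_cone_eq zariski_closure_def vanishing_ideal_def by blast
  from assms show ?thesis
  proof
    assume "hypersurface ?S (discriminantal_variety A :: ('n \<times> (int ^ 'n) \<Rightarrow> 'k) set)"
    then show ?thesis using hypersurface_in_dual_cone sub by blast
  next
    assume "hypersurface ?S (dual_cone ?S X)"
    then have "dual_cone ?S X \<subseteq> zariski_closure ?S ?L"
    proof (rule dual_cone_le_closure)
      fix c assume c: "c \<in> coord_space ?S" "\<exists>t\<in>torus. crit c t"
        "finite {t \<in> torus. t row1 = 1 \<and> crit c t}"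
      then show "c \<in> ?L" using multiple_root_of_crit by blast
    qed
    then show ?thesis using sub by (auto simp: discriminantal_variety_def)
  qed
qed

end

section \<open>Choice of the basis columns and comparison of the discriminants\<close>

text \<open>Columns forming a basis over the ground field give an integral maximal minor whose image
  in that field is nonzero, whatever the characteristic.\<close>

lemma cayley_configuration_exists:
  fixes A :: "'n::finite \<Rightarrow> (int ^ 'n) set"
  assumes fin: "\<And>i. finite (A i)"
    and rank: "matrix_rank_over TYPE('k::alg_closed_field) (cayley_index A) cayley_matrix = 2 * CARD('n)"
  shows "\<exists>b. cayley_configuration TYPE('k) A b"
proof -
  let ?S = "cayley_index A"
  let ?M = "\<lambda>s. (\<chi> r. of_int (cayley_matrix s $ r)) :: 'k ^ ('n + 'n)"
  obtain B where B: "B \<subseteq> ?M ` ?S" "vec.independent B" "card B = vec.dim (?M ` ?S)"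
    using vec.basis_exists[of "?M ` ?S"] by metis
  have card: "card B = CARD('n + 'n)" using B(3) rank by (simp add: matrix_rank_over_def)
  have finB: "finite B" using vec.finiteI_independent[OF B(2)] .
  obtain f where f: "bij_betw f (UNIV :: ('n + 'n) set) B"
    using card finB finite_same_card_bij[of "UNIV :: ('n + 'n) set" B] by auto
  have "\<forall>q. \<exists>s. s \<in> ?S \<and> ?M s = f q"
  proof
    fix q
    have "f q \<in> B" using bij_betw_apply[OF f] by simp
    then have "f q \<in> ?M ` ?S" using B(1) by (rule rev_subsetD)
    then show "\<exists>s. s \<in> ?S \<and> ?M s = f q" by (elim imageE) auto
  qed
  from choice[OF this] obtain b where b0: "\<forall>q. b q \<in> ?S \<and> ?M (b q) = f q" ..
  then have b: "b q \<in> ?S" "?M (b q) = f q" for q by simp_all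
  have inj: "inj b"
  proof (rule injI)
    fix q q' assume "b q = b q'"
    then have "f q = f q'" using b(2)[of q] b(2)[of q'] by simp
    then show "q = q'" using f by (auto simp: bij_betw_def inj_on_def)
  qed
  let ?J = "(\<chi> r q. of_int (cayley_matrix (b q) $ r)) :: 'k ^ ('n + 'n) ^ ('n + 'n)"
  have "x = 0" if x: "?J *v x = 0" for x
  proof -
    have "x $ q = 0" for q
    proof -
      have "(\<Sum>w\<in>B. x $ (inv f w) *s w) = (\<Sum>q\<in>UNIV. x $ q *s f q)"
        using f by (subst sum.reindex_bij_betw[OF f, symmetric]) (simp add: bij_betw_def)
      also have "\<dots> = ?J *v x"
        by (simp add: vec_eq_iff matrix_vector_mult_def b(2)[symmetric] mult.commute)
      finally have "x $ (inv f (f q)) = 0"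
        using x B(2) finB f by (intro vec.independentD[of B B]) (auto simp: bij_betw_def)
      then show ?thesis using f by (simp add: bij_betw_def)
    qed
    then show ?thesis by (simp add: vec_eq_iff)
  qed
  then have "invertible ?J"
    unfolding invertible_left_inverse matrix_left_invertible_ker by blast
  then have "det ?J \<noteq> 0" by (simp add: invertible_det_nz)
  moreover have "det ?J = of_int (det (\<chi> r q. cayley_matrix (b q) $ r))"
    by (simp add: det_def of_int_sum of_int_prod)
  ultimately have "cayley_configuration TYPE('k) A b"
    using fin b(1) inj by unfold_locales auto
  then show ?thesis by (rule exI[of _ b])
qed

theorem theorem2p1:
  fixes A :: "'n::finite \<Rightarrow> (int ^ 'n) set"
    and D :: "('n \<times> (int ^ 'n), int) mpoly"
  assumes "\<And>i. finite (A i)"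
    and "matrix_rank_over TYPE('k::alg_closed_field) (cayley_index A) cayley_matrix = 2 * CARD('n)"
  shows "is_mixed_discriminant TYPE('k) A D \<longleftrightarrow>
         is_A_discriminant TYPE('k) (cayley_index A) cayley_matrix D"
proof -
  obtain b where "cayley_configuration TYPE('k) A b"
    using cayley_configuration_exists[of A, where 'k = 'k] assms by blast
  then interpret cayley_configuration "TYPE('k)" A b .
  let ?S = "cayley_index A"
  show ?thesis
  \<comment> \<open>If the varieties differ, neither is a hypersurface, and both predicates reduce
    to \<open>D = 1\<close>.\<close>
  proof (cases "discriminantal_variety A = dual_cone ?S X")
    case True
    then show ?thesis
      by (simp add: is_mixed_discriminant_def is_A_discriminant_def X_def)
  next
    case False
    then have "\<not> hypersurface ?S (discriminantal_variety A :: ('n \<times> (int ^ 'n) \<Rightarrow> 'k) set)"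
      "\<not> hypersurface ?S (dual_cone ?S X)"
      using hypersurface_discriminantal_variety by blast+
    then show ?thesis
      by (simp add: is_mixed_discriminant_def is_A_discriminant_def is_discriminant_of_def X_def)
  qed
qed

end
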